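(* Let $p\geq 2$ be a prime, let $n\geq 1$ be an integer, and let $F$ be a field of characteristic $0$ containing the $p$-th roots of unity. Let the group $H_{n,p}\subseteq \Sigma_n$ act on the field of rational functions $F(x_1,\dots,x_n)$ by $F$-automorphisms permuting the variables ($g\cdot x_j=x_{g(j)}$). Then the field of fixed points $F(x_1,\dots,x_n)^{H_{n,p}}$ is rational over $F$.
   Context: A field extension $K/F$ is called rational over $F$ if $K$ is a purely transcendental, finitely generated extension of $F$, i.e. $K=F(y_1,\dots,y_r)$ with $y_1,\dots,y_r$ algebraically independent over $F$. $\Sigma_n$ is the group of all permutations of $\{1,\dots,n\}$. For integers $i,s$ with $0\leq i\leq \lfloor\log_p(n)\rfloor-1$ and $1\leq s\leq \lfloor n/p^{i+1}\rfloor$, let $\sigma_{i,s}\in\Sigma_n$ be the permutation consisting of the cycles $$(s-1)p^{i+1}+j\mapsto (s-1)p^{i+1}+p^i+j\mapsto\dots\mapsto (s-1)p^{i+1}+(p-1)p^i+j\mapsto (s-1)p^{i+1}+j$$ for $1\leq j\leq p^i$, all remaining elements being fixed. (The $\sigma_{i,s}$ generate a $p$-Sylow subgroup $G_{n,p}$ of $\Sigma_n$.) The group $H_{n,p}\subseteq\Sigma_n$ is the subgroup generated by all elements $\sigma_{0,s}\sigma_{0,s'}^{-1}$ with $1\leq s,s'\leq\lfloor n/p\rfloor$, and all $\sigma_{i,s}$ with $1\leq i\leq \lfloor\log_p(n)\rfloor-1$ and $1\leq s\leq \lfloor n/p^{i+1}\rfloor$. *)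

theory Defs
  imports
    Complex_Main
    "HOL-Library.Poly_Mapping"
    "HOL-Computational_Algebra.Fraction_Field"
    "HOL-Computational_Algebra.Primes"
    "HOL-Algebra.Generated_Groups"
    "HOL-Algebra.Generated_Fields"
    "HOL-Algebra.Sym_Groups"
    "HOL-Algebra.Algebraic_Closure_Type"
begin

text \<open>
  Polynomials in countably many variables \<open>x\<^sub>0, x\<^sub>1, \<dots>\<close>: a monomial is a finitely supported
  exponent vector, a polynomial a finitely supported family of coefficients. The field
  \<open>F(x\<^sub>1, \<dots>, x\<^sub>n)\<close> is carved out below as the subfield generated by \<open>F\<close> and \<open>x\<^sub>1, \<dots>, x\<^sub>n\<close>.
\<close>

type_synonym 'a mpol = "(nat \<Rightarrow>\<^sub>0 nat) \<Rightarrow>\<^sub>0 'a"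

type_synonym 'a ratfun = "'a mpol fract"

definition rconst :: "'a::field \<Rightarrow> 'a ratfun" where
  "rconst c = Fract (Poly_Mapping.single 0 c) 1"

definition rvar :: "nat \<Rightarrow> 'a::field ratfun" where
  "rvar j = Fract (Poly_Mapping.single (Poly_Mapping.single j 1) 1) 1"

definition mpol_vars :: "'a::zero mpol \<Rightarrow> nat set" where
  "mpol_vars P = (\<Union>m\<in>Poly_Mapping.keys P. Poly_Mapping.keys m)"

definition mpol_eval :: "('a::field \<Rightarrow> 'b::field) \<Rightarrow> (nat \<Rightarrow> 'b) \<Rightarrow> 'a mpol \<Rightarrow> 'b" where
  "mpol_eval c y P = (\<Sum>m\<in>Poly_Mapping.keys P. c (Poly_Mapping.lookup P m) * (\<Prod>i\<in>Poly_Mapping.keys m. y i ^ Poly_Mapping.lookup m i))"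

definition field_gen :: "'b::field set \<Rightarrow> 'b set" where
  "field_gen S = generate_field ring_of_type_algebra S"

definition ratfun_field :: "nat \<Rightarrow> 'a::field ratfun set" where
  "ratfun_field n = field_gen (range rconst \<union> rvar ` {1..n})"

text \<open>
  In the next two definitions \<open>c\<close> is the embedding of the base field into the ambient field.
\<close>

definition alg_indep :: "('a::field \<Rightarrow> 'b::field) \<Rightarrow> nat \<Rightarrow> (nat \<Rightarrow> 'b) \<Rightarrow> bool" where
  "alg_indep c r y \<longleftrightarrow>
     (\<forall>P. mpol_vars P \<subseteq> {1..r} \<longrightarrow> mpol_eval c y P = 0 \<longrightarrow> P = 0)"

definition rational_over :: "('a::field \<Rightarrow> 'b::field) \<Rightarrow> 'b set \<Rightarrow> bool" where
  "rational_over c K \<longleftrightarrow>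
     (\<exists>r y. alg_indep c r y \<and> K = field_gen (range c \<union> y ` {1..r}))"

text \<open>
  The substitution \<open>x\<^sub>j \<mapsto> x\<^bsub>g(j)\<^esub>\<close>; it is well defined on fractions for injective \<open>g\<close>, see
  \<open>perm_act_Fract\<close> below.
\<close>

definition perm_act :: "(nat \<Rightarrow> nat) \<Rightarrow> 'a::field ratfun \<Rightarrow> 'a ratfun" where
  "perm_act g f = (THE h. \<exists>a b. b \<noteq> 0 \<and> f = Fract a b \<and>
     h = mpol_eval rconst (\<lambda>j. rvar (g j)) a / mpol_eval rconst (\<lambda>j. rvar (g j)) b)"

definition fixed_field :: "nat \<Rightarrow> (nat \<Rightarrow> nat) set \<Rightarrow> 'a::field ratfun set" where
  "fixed_field n G = {f \<in> ratfun_field n. \<forall>g\<in>G. perm_act g f = f}"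

text \<open>
  The cycles of \<open>\<sigma>\<^bsub>i,s\<^esub>\<close> add \<open>p\<^sup>i\<close> cyclically within the block
  \<open>(s - 1) p\<^bsup>i+1\<^esup> < x \<le> s p\<^bsup>i+1\<^esup>\<close>; compare \<open>sigma_cycle\<close> and \<open>sigma_fixed\<close> below.
\<close>

definition sigma :: "nat \<Rightarrow> nat \<Rightarrow> nat \<Rightarrow> nat \<Rightarrow> nat" where
  "sigma p i s x =
     (if (s - 1) * p ^ (i + 1) < x \<and> x \<le> s * p ^ (i + 1)
      then if x + p ^ i \<le> s * p ^ (i + 1) then x + p ^ i else x - (p - 1) * p ^ i
      else x)"

definition H_gens :: "nat \<Rightarrow> nat \<Rightarrow> (nat \<Rightarrow> nat) set" where
  "H_gens n p =
     {sigma p 0 s \<otimes>\<^bsub>sym_group n\<^esub> inv\<^bsub>sym_group n\<^esub> (sigma p 0 s') | s s'.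
        1 \<le> s \<and> s \<le> n div p \<and> 1 \<le> s' \<and> s' \<le> n div p} \<union>
     {sigma p i s | i s.
        1 \<le> i \<and> int i \<le> \<lfloor>log (real p) (real n)\<rfloor> - 1 \<and> 1 \<le> s \<and> s \<le> n div p ^ (i + 1)}"

definition H_group :: "nat \<Rightarrow> nat \<Rightarrow> (nat \<Rightarrow> nat) set" where
  "H_group n p = generate (sym_group n) (H_gens n p)"


lemma sigma_cycle:
  assumes "1 \<le> s" "k < p" "1 \<le> j" "j \<le> p ^ i"
  shows "sigma p i s ((s - 1) * p ^ (i + 1) + k * p ^ i + j) =
           (s - 1) * p ^ (i + 1) + (Suc k mod p) * p ^ i + j"
proof -
  obtain t where t: "s = Suc t" using assms(1) by (cases s) auto
  obtain q where q: "p = Suc q" using assms(2) by (cases p) auto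
  define d where "d = p ^ i"
  have pd: "p ^ (i + 1) = q * d + d" by (simp add: d_def q)
  have jd: "1 \<le> j" "j \<le> d" using assms by (auto simp: d_def)
  show ?thesis
  proof (cases "k = q")
    case True
    show ?thesis unfolding sigma_def pd d_def[symmetric] t
      using True jd by (simp add: q algebra_simps)
  next
    case False
    then have "Suc k \<le> q" using assms(2) q by simp
    then have le: "k * d + d \<le> q * d"
      by (metis add.commute mult_Suc mult_le_mono1)
    show ?thesis unfolding sigma_def pd d_def[symmetric] t
      using le jd \<open>Suc k \<le> q\<close> by (simp add: q algebra_simps)
  qed
qed

lemma sigma_fixed:
  assumes "x \<notin> {(s - 1) * p ^ (i + 1) <.. s * p ^ (i + 1)}"
  shows "sigma p i s x = x"
  using assms by (auto simp: sigma_def)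

lemma sigma_permutes:
  assumes "1 \<le> s" "s \<le> n div p ^ (i + 1)" "0 < p"
  shows "sigma p i s permutes {1..n}"
proof -
  obtain t where t: "s = Suc t" using assms(1) by (cases s) auto
  obtain q where q: "p = Suc q" using assms(3) by (cases p) auto
  define d where "d = p ^ i"
  define B where "B = {t * (q * d + d) <.. t * (q * d + d) + (q * d + d)}"
  have pd: "p ^ (i + 1) = q * d + d" by (simp add: d_def q)
  have d: "0 < d" using assms by (simp add: d_def)
  have "s * p ^ (i + 1) \<le> n"
    using assms by (simp add: less_eq_div_iff_mult_less_eq)
  then have "t * (q * d + d) + (q * d + d) \<le> n"
    unfolding pd t by (simp add: algebra_simps)
  then have B: "B \<subseteq> {1..n}" unfolding B_def by auto
  have *: "sigma p i s x = (if x \<in> B then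
       if x + d \<le> t * (q * d + d) + (q * d + d) then x + d else x - q * d else x)" for x
    unfolding sigma_def pd d_def[symmetric] t B_def by (auto simp: q algebra_simps)
  have "inj_on (sigma p i s) B"
    by (rule inj_onI) (auto simp: * B_def split: if_splits)
  moreover have "sigma p i s ` B \<subseteq> B"
    using d by (auto simp: * B_def)
  moreover have "finite B" by (simp add: B_def)
  ultimately have "bij_betw (sigma p i s) B B"
    by (simp add: bij_betw_def endo_inj_surj)
  then have "sigma p i s permutes B"
    by (rule bij_imp_permutes) (simp add: *)
  then show ?thesis using B by (rule permutes_subset)
qed

lemma H_group_subgroup:
  assumes "prime p"
  shows "subgroup (H_group n p) (sym_group n)"
proof -
  interpret group "sym_group n" by (rule sym_group_is_group)
  have p: "0 < p" using assms by (rule prime_gt_0_nat)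
  have s: "sigma p i s \<in> carrier (sym_group n)" if "1 \<le> s" "s \<le> n div p ^ (i + 1)" for i s
    using sigma_permutes[OF that p] by (simp add: sym_group_carrier)
  have "H_gens n p \<subseteq> carrier (sym_group n)"
    unfolding H_gens_def using s s[of _ 0]
    by (auto intro!: m_closed inv_closed simp del: sym_group_inv_equality)
  then show ?thesis unfolding H_group_def by (rule generate_is_subgroup)
qed

lemma Fract_add_1: "Fraction_Field.Fract (a + b) 1 = Fract a 1 + Fract b 1"
  by simp

lemma Fract_mult_1: "Fraction_Field.Fract (a * b) 1 = Fract a 1 * Fract b 1"
  by simp

lemma Fract_sum: "Fraction_Field.Fract (\<Sum>i\<in>A. f i) 1 = (\<Sum>i\<in>A. Fract (f i) 1)"
  by (induction A rule: infinite_finite_induct)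
    (simp_all add: Zero_fract_def Fract_add_1 del: add_fract)

lemma Fract_prod: "Fraction_Field.Fract (\<Prod>i\<in>A. f i) 1 = (\<Prod>i\<in>A. Fract (f i) 1)"
  by (induction A rule: infinite_finite_induct)
    (simp_all add: One_fract_def Fract_mult_1 del: mult_fract)

lemma Fract_power: "Fraction_Field.Fract (a ^ k) 1 = Fract a 1 ^ k"
  by (induction k) (simp_all add: One_fract_def Fract_mult_1 del: mult_fract)

lemma single_power:
  "Poly_Mapping.single (Poly_Mapping.single (j::nat) (e::nat)) (1::'a::field) ^ k =
     Poly_Mapping.single (Poly_Mapping.single j (k * e)) 1"
  by (induction k) (auto simp: mult_single simp flip: single_add)

lemma single_prod:
  "(\<Prod>i\<in>A. Poly_Mapping.single (f i) (1::'a::field)) =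
     Poly_Mapping.single (\<Sum>i\<in>A. f i :: nat \<Rightarrow>\<^sub>0 nat) 1"
  by (induction A rule: infinite_finite_induct) (auto simp: mult_single)

definition mon_rename :: "(nat \<Rightarrow> nat) \<Rightarrow> (nat \<Rightarrow>\<^sub>0 nat) \<Rightarrow> (nat \<Rightarrow>\<^sub>0 nat)" where
  "mon_rename g m = (\<Sum>i\<in>Poly_Mapping.keys m. Poly_Mapping.single (g i) (Poly_Mapping.lookup m i))"

definition mpol_rename :: "(nat \<Rightarrow> nat) \<Rightarrow> 'a::field mpol \<Rightarrow> 'a mpol" where
  "mpol_rename g P = (\<Sum>m\<in>Poly_Mapping.keys P. Poly_Mapping.single (mon_rename g m) (Poly_Mapping.lookup P m))"

lemma mpol_eval_rename:
  "mpol_eval rconst (\<lambda>j. rvar (g j)) P = Fract (mpol_rename g P) 1"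
proof -
  have "(\<Prod>i\<in>Poly_Mapping.keys m. rvar (g i) ^ Poly_Mapping.lookup m i) =
          Fract (Poly_Mapping.single (mon_rename g m) (1::'a)) 1" for m
    by (simp add: rvar_def mon_rename_def single_power single_prod flip: Fract_power Fract_prod)
  then show ?thesis
    by (simp add: mpol_eval_def mpol_rename_def Fract_sum rconst_def mult_single)
qed

lemma lookup_mon_rename: "inj g \<Longrightarrow> Poly_Mapping.lookup (mon_rename g m) (g j) = Poly_Mapping.lookup m j"
  by (auto simp: mon_rename_def lookup_sum lookup_single when_def inj_eq in_keys_iff)

lemma inj_mon_rename: "inj g \<Longrightarrow> inj (mon_rename g)"
  by (metis injI lookup_mon_rename poly_mapping_eqI)

lemma lookup_mpol_rename:
  "inj g \<Longrightarrow> Poly_Mapping.lookup (mpol_rename g P) (mon_rename g m) = Poly_Mapping.lookup P m"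
  using inj_mon_rename[of g]
  by (auto simp: mpol_rename_def lookup_sum lookup_single when_def inj_eq in_keys_iff)

lemma mpol_rename_eq_0_iff:
  assumes "inj g"
  shows "mpol_rename g P = 0 \<longleftrightarrow> P = 0"
proof
  assume *: "mpol_rename g P = 0"
  show "P = 0"
    by (rule poly_mapping_eqI) (use * lookup_mpol_rename[OF assms, of P] in simp)
qed (simp add: mpol_rename_def)

lemma mpol_rename_superset:
  assumes "finite A" "Poly_Mapping.keys P \<subseteq> A"
  shows "mpol_rename g P = (\<Sum>m\<in>A. Poly_Mapping.single (mon_rename g m) (Poly_Mapping.lookup P m))"
  unfolding mpol_rename_def by (rule sum.mono_neutral_left) (use assms in \<open>auto simp: in_keys_iff\<close>)

lemma mpol_rename_add: "mpol_rename g (P + Q) = mpol_rename g P + mpol_rename g Q"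
proof -
  let ?A = "Poly_Mapping.keys P \<union> Poly_Mapping.keys Q"
  have "Poly_Mapping.keys (P + Q) \<subseteq> ?A" by (rule keys_add)
  then show ?thesis
    by (simp add: mpol_rename_superset[of ?A] lookup_add single_add sum.distrib)
qed

lemma mon_rename_superset:
  assumes "finite A" "Poly_Mapping.keys m \<subseteq> A"
  shows "mon_rename g m = (\<Sum>i\<in>A. Poly_Mapping.single (g i) (Poly_Mapping.lookup m i))"
  unfolding mon_rename_def by (rule sum.mono_neutral_left) (use assms in \<open>auto simp: in_keys_iff\<close>)

lemma mon_rename_add: "mon_rename g (m + m') = mon_rename g m + mon_rename g m'"
proof -
  let ?A = "Poly_Mapping.keys m \<union> Poly_Mapping.keys m'"
  have "Poly_Mapping.keys (m + m') \<subseteq> ?A" by (rule keys_add)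
  then show ?thesis
    by (simp add: mon_rename_superset[of ?A] lookup_add single_add sum.distrib)
qed

lemma mpol_rename_single:
  "mpol_rename g (Poly_Mapping.single m c) = Poly_Mapping.single (mon_rename g m) c"
  by (simp add: mpol_rename_def)

lemma mpol_rename_sum: "mpol_rename g (\<Sum>i\<in>A. f i) = (\<Sum>i\<in>A. mpol_rename g (f i))"
  by (induction A rule: infinite_finite_induct) (auto simp: mpol_rename_add, auto simp: mpol_rename_def)

lemma mpol_expand: "(P :: 'a::field mpol) = (\<Sum>m\<in>Poly_Mapping.keys P. Poly_Mapping.single m (Poly_Mapping.lookup P m))"
  by (rule poly_mapping_eqI)
    (auto simp: lookup_sum lookup_single when_def in_keys_iff)

lemma mpol_rename_mult: "mpol_rename g (P * Q) = mpol_rename g P * mpol_rename g Q"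
proof -
  have "P * Q = (\<Sum>m\<in>Poly_Mapping.keys P. \<Sum>m'\<in>Poly_Mapping.keys Q.
      Poly_Mapping.single (m + m') (Poly_Mapping.lookup P m * Poly_Mapping.lookup Q m'))"
    by (subst mpol_expand[of P], subst mpol_expand[of Q]) (simp add: sum_product mult_single)
  then have "mpol_rename g (P * Q) = (\<Sum>m\<in>Poly_Mapping.keys P. \<Sum>m'\<in>Poly_Mapping.keys Q.
      Poly_Mapping.single (mon_rename g m + mon_rename g m') (Poly_Mapping.lookup P m * Poly_Mapping.lookup Q m'))"
    by (simp add: mpol_rename_sum mpol_rename_single mon_rename_add)
  also have "\<dots> = mpol_rename g P * mpol_rename g Q"
    unfolding mpol_rename_def by (simp add: sum_product mult_single)
  finally show ?thesis .
qed

lemma perm_act_Fract: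
  assumes "inj g" "b \<noteq> 0"
  shows "perm_act g (Fract a b) = Fract (mpol_rename g a) (mpol_rename g b)"
  unfolding perm_act_def
proof (rule the_equality)
  show "\<exists>a' b'. b' \<noteq> 0 \<and> Fract a b = Fract a' b' \<and>
      Fract (mpol_rename g a) (mpol_rename g b) =
      mpol_eval rconst (\<lambda>j. rvar (g j)) a' / mpol_eval rconst (\<lambda>j. rvar (g j)) b'"
    using assms by (intro exI[of _ a] exI[of _ b]) (simp add: mpol_eval_rename)
next
  fix h
  assume "\<exists>a' b'. b' \<noteq> 0 \<and> Fract a b = Fract a' b' \<and>
      h = mpol_eval rconst (\<lambda>j. rvar (g j)) a' / mpol_eval rconst (\<lambda>j. rvar (g j)) b'"
  then obtain a' b' where *: "b' \<noteq> 0" "Fract a b = Fract a' b'"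
    "h = Fract (mpol_rename g a') (mpol_rename g b')"
    by (auto simp: mpol_eval_rename)
  then have "mpol_rename g (a * b') = mpol_rename g (a' * b)"
    using assms by (simp add: eq_fract)
  then show "h = Fract (mpol_rename g a) (mpol_rename g b)"
    using * assms by (simp add: eq_fract mpol_rename_eq_0_iff mpol_rename_mult)
qed

lemma mpol_rename_1 [simp]: "mpol_rename g 1 = 1"
  using mpol_rename_single[of g 0 1] by (simp add: mon_rename_def)

lemma perm_act_rvar: "inj g \<Longrightarrow> perm_act g (rvar j) = rvar (g j)"
  by (simp add: rvar_def perm_act_Fract mpol_rename_single mon_rename_def)

lemma perm_act_rconst: "inj g \<Longrightarrow> perm_act g (rconst c) = rconst c"
  by (simp add: rconst_def perm_act_Fract mpol_rename_single mon_rename_def)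

lemma perm_act_add: "inj g \<Longrightarrow> perm_act g (f + f') = perm_act g f + perm_act g f'"
  by (cases f; cases f')
    (simp add: perm_act_Fract mpol_rename_add mpol_rename_mult mpol_rename_eq_0_iff)

lemma perm_act_mult: "inj g \<Longrightarrow> perm_act g (f * f') = perm_act g f * perm_act g f'"
  by (cases f; cases f') (simp add: perm_act_Fract mpol_rename_mult)

end

theory Submission
  imports Defs
begin

text \<open>
  Let \<open>G\<close> be the group generated by all \<open>\<sigma>\<^bsub>i,s\<^esub>\<close>. Then \<open>H\<close> is the kernel of the character of \<open>G\<close> that
  maps every \<open>\<sigma>\<^bsub>0,s\<^esub>\<close> to \<open>\<zeta>\<close> and every \<open>\<sigma>\<^bsub>i,s\<^esub>\<close> with \<open>i \<ge> 1\<close> to \<open>1\<close>, so the field fixed by \<open>H\<close> is obtained from the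
  field fixed by \<open>G\<close> by adjoining an eigenvector \<open>\<theta>\<close> of this character. It therefore suffices to find \<open>n\<close>
  generators of the field fixed by \<open>G\<close> one of which is \<open>\<theta>\<^sup>p\<close>, and to replace this one by \<open>\<theta>\<close>.

  Such generators are built block by block. For a block of length \<open>p\<close> they come from the Fourier transform of
  the variables. For a block of length \<open>p\<^bsup>k+1\<^esup>\<close> one has \<open>p\<close> translates of the generators for \<open>p\<^sup>k\<close>, permuted
  cyclically by \<open>\<tau>\<close>. With a Fourier coefficient \<open>e\<close>, \<open>\<tau> e = \<zeta> e\<close>, of one generator, the \<open>\<tau>\<close>-invariants are generated by
  \<open>e\<^sup>p\<close>, the coefficients of \<open>L = \<Sum> l\<^sub>j e\<^sup>j\<close> for \<open>L\<close> the \<open>p\<close>-th power of the old eigenvector, and further elements, while the new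
  \<open>\<theta>\<^sup>p\<close> is the norm of \<open>L\<close>. The cyclic algebra with parameters \<open>e\<^sup>p\<close> and \<open>\<theta>\<^sup>p\<close> is split, and exchanging the roles of its two
  parameters replaces \<open>(e\<^sup>p, l\<^sub>0, \<dots>, l\<^bsub>p-1\<^esub>)\<close> by \<open>(\<theta>\<^sup>p, m\<^sub>0, \<dots>, m\<^bsub>p-1\<^esub>)\<close>.

  The \<open>n\<close> generators are algebraically independent because the variables are algebraic over the field they
  generate: in characteristic \<open>0\<close>, if one of them were algebraic over the others, some nonzero derivation would kill all of
  them, hence all variables.
\<close>

section \<open>Subfields and endomorphisms\<close>

text \<open>Subfields are plain subsets of a type of class \<open>field\<close>, so membership
  arguments use the type class operations. Closure under \<open>inverse\<close> is harmless at 0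
  because \<open>inverse 0 = 0\<close>.\<close>

definition is_subfield :: "'b::field set \<Rightarrow> bool" where
  "is_subfield K \<longleftrightarrow> 1 \<in> K \<and> (\<forall>a\<in>K. - a \<in> K \<and> inverse a \<in> K) \<and>
     (\<forall>a\<in>K. \<forall>b\<in>K. a + b \<in> K \<and> a * b \<in> K)"

lemma is_subfieldD:
  assumes "is_subfield K"
  shows "1 \<in> K" "0 \<in> K" "a \<in> K \<Longrightarrow> - a \<in> K" "a \<in> K \<Longrightarrow> inverse a \<in> K"
    "a \<in> K \<Longrightarrow> b \<in> K \<Longrightarrow> a + b \<in> K" "a \<in> K \<Longrightarrow> b \<in> K \<Longrightarrow> a * b \<in> K"
    "a \<in> K \<Longrightarrow> b \<in> K \<Longrightarrow> a - b \<in> K" "a \<in> K \<Longrightarrow> b \<in> K \<Longrightarrow> a / b \<in> K"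
    "a \<in> K \<Longrightarrow> a ^ k \<in> K" "of_nat k \<in> K"
proof -
  note * = assms[unfolded is_subfield_def]
  show 1: "1 \<in> K" using * by blast
  have "1 + - 1 \<in> K" using * by blast
  then show 0: "0 \<in> K" by simp
  show neg: "a \<in> K \<Longrightarrow> - a \<in> K" for a using * by blast
  show inv: "a \<in> K \<Longrightarrow> inverse a \<in> K" for a using * by blast
  show add: "a \<in> K \<Longrightarrow> b \<in> K \<Longrightarrow> a + b \<in> K" for a b using * by blast
  show mult: "a \<in> K \<Longrightarrow> b \<in> K \<Longrightarrow> a * b \<in> K" for a b using * by blast
  show "a \<in> K \<Longrightarrow> b \<in> K \<Longrightarrow> a - b \<in> K" using add[of a "- b"] neg by simp
  show "a \<in> K \<Longrightarrow> b \<in> K \<Longrightarrow> a / b \<in> K" using mult[of a "inverse b"] inv by (simp add: divide_inverse)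
  show "a \<in> K \<Longrightarrow> a ^ k \<in> K" by (induction k) (auto intro: 1 mult)
  show "of_nat k \<in> K" by (induction k) (auto intro: 0 1 add)
qed

lemma is_subfield_sum: "is_subfield K \<Longrightarrow> (\<And>i. i \<in> A \<Longrightarrow> f i \<in> K) \<Longrightarrow> sum f A \<in> K"
  by (induction A rule: infinite_finite_induct) (simp_all add: is_subfieldD(2,5))

lemma is_subfield_prod: "is_subfield K \<Longrightarrow> (\<And>i. i \<in> A \<Longrightarrow> f i \<in> K) \<Longrightarrow> prod f A \<in> K"
  by (induction A rule: infinite_finite_induct) (simp_all add: is_subfieldD(1,6))

lemma ring_of_type_algebra_simps:
  "carrier (ring_of_type_algebra :: 'b::field ring) = UNIV"
  "\<one>\<^bsub>ring_of_type_algebra\<^esub> = (1 :: 'b)" "\<zero>\<^bsub>ring_of_type_algebra\<^esub> = (0 :: 'b)"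
  "a \<oplus>\<^bsub>ring_of_type_algebra\<^esub> b = a + (b :: 'b)" "a \<otimes>\<^bsub>ring_of_type_algebra\<^esub> b = a * (b :: 'b)"
  by (simp_all add: ring_of_type_algebra_def)

lemma ring_of_type_algebra_minus: "\<ominus>\<^bsub>ring_of_type_algebra\<^esub> a = - (a :: 'b::field)"
  using abelian_group.minus_equality[OF ring.is_abelian_group[OF ring_from_type_algebra], of "- a" a]
  by (simp add: ring_of_type_algebra_simps)

lemma ring_of_type_algebra_inv:
  "a \<noteq> 0 \<Longrightarrow> inv\<^bsub>ring_of_type_algebra\<^esub> a = inverse (a :: 'b::field)"
  using comm_monoid.comm_inv_char[OF cring.axioms(2)[OF cring_from_type_algebra], of a "inverse a"]
  by (simp add: ring_of_type_algebra_simps)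

lemma is_subfield_field_gen: "is_subfield (field_gen S)"
proof -
  note c = ring_of_type_algebra_simps ring_of_type_algebra_minus ring_of_type_algebra_inv
  have one: "1 \<in> field_gen S"
    using generate_field.one[of ring_of_type_algebra S] by (simp add: field_gen_def c)
  have add: "a + b \<in> field_gen S" "a * b \<in> field_gen S"
    if "a \<in> field_gen S" "b \<in> field_gen S" for a b
    using generate_field.eng_add[of a ring_of_type_algebra S b]
      generate_field.eng_mult[of a ring_of_type_algebra S b] that
    by (simp_all add: field_gen_def c)
  have minus: "- a \<in> field_gen S" if "a \<in> field_gen S" for a
    using generate_field.a_inv[of a ring_of_type_algebra S] that by (simp add: field_gen_def c)
  have inv: "inverse a \<in> field_gen S" if "a \<in> field_gen S" for a
    using generate_field.m_inv[of a ring_of_type_algebra S] that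
    by (cases "a = 0") (simp_all add: field_gen_def c)
  show ?thesis unfolding is_subfield_def by (simp add: one add minus inv)
qed

lemma field_gen_superset: "S \<subseteq> field_gen S"
  unfolding field_gen_def by (auto intro: generate_field.incl)

lemma field_gen_induct [consumes 1, case_names incl one minus inverse add mult]:
  assumes "f \<in> field_gen S"
    and "\<And>a. a \<in> S \<Longrightarrow> P a" "P 1" "\<And>a. P a \<Longrightarrow> P (- a)" "\<And>a. P a \<Longrightarrow> a \<noteq> 0 \<Longrightarrow> P (inverse a)"
    "\<And>a b. P a \<Longrightarrow> P b \<Longrightarrow> P (a + b)" "\<And>a b. P a \<Longrightarrow> P b \<Longrightarrow> P (a * b)"
  shows "P f"
  using assms(1) unfolding field_gen_def
proof (induction rule: generate_field.induct)
  case (m_inv a)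
  then show ?case by (simp add: ring_of_type_algebra_simps ring_of_type_algebra_inv assms(5))
qed (use assms(2-) in \<open>simp_all add: ring_of_type_algebra_simps ring_of_type_algebra_minus\<close>)

lemma field_gen_least:
  assumes "is_subfield K" "S \<subseteq> K"
  shows "field_gen S \<subseteq> K"
proof
  fix f assume "f \<in> field_gen S"
  then show "f \<in> K"
    by (induction rule: field_gen_induct) (use assms in \<open>auto simp: is_subfield_def\<close>)
qed

lemma field_gen_mono: "S \<subseteq> T \<Longrightarrow> field_gen S \<subseteq> field_gen T"
  by (intro field_gen_least is_subfield_field_gen) (use field_gen_superset[of T] in blast)

lemma field_gen_subset_iff: "field_gen S \<subseteq> field_gen T \<longleftrightarrow> S \<subseteq> field_gen T"
  using field_gen_least[OF is_subfield_field_gen, of S T] field_gen_superset[of S] by blast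

text \<open>Lets a tower of generated fields be regrouped, so that either set of generators can be
  absorbed into the base field.\<close>

lemma field_gen_field_gen_Un: "field_gen (field_gen S \<union> T) = field_gen (S \<union> T)"
proof (rule subset_antisym)
  show "field_gen (field_gen S \<union> T) \<subseteq> field_gen (S \<union> T)"
    using field_gen_mono[of S "S \<union> T"] field_gen_superset[of "S \<union> T"]
    by (simp add: field_gen_subset_iff)
  show "field_gen (S \<union> T) \<subseteq> field_gen (field_gen S \<union> T)"
    by (rule field_gen_mono) (use field_gen_superset[of S] in blast)
qed

section \<open>Unital ring endomorphisms of a field\<close>

definition is_endo :: "('b::field \<Rightarrow> 'b) \<Rightarrow> bool" where
  "is_endo h \<longleftrightarrow> h 1 = 1 \<and> (\<forall>a b. h (a + b) = h a + h b \<and> h (a * b) = h a * h b)"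

lemma is_endoD:
  assumes "is_endo h"
  shows "h 1 = 1" "h 0 = 0" "h (a + b) = h a + h b" "h (a * b) = h a * h b"
    "h (- a) = - h a" "h (inverse a) = inverse (h a)" "h (a - b) = h a - h b" "h (a / b) = h a / h b"
    "h (a ^ k) = h a ^ k" "h (of_nat k) = of_nat k" "h (sum f A) = (\<Sum>i\<in>A. h (f i))"
    "h (prod f A) = (\<Prod>i\<in>A. h (f i))" "h a = 0 \<longleftrightarrow> a = 0"
proof -
  show 1: "h 1 = 1" and add: "h (a + b) = h a + h b" and mult: "h (a * b) = h a * h b" for a b
    using assms by (auto simp: is_endo_def)
  show 0: "h 0 = 0" by (metis add add_0 add_cancel_left_left)
  show neg: "h (- a) = - h a" for a using add[of a "- a"] 0 by (simp add: eq_neg_iff_add_eq_0 add.commute)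
  show inv: "h (inverse a) = inverse (h a)" for a
    using mult[of a "inverse a"] 0 1 by (cases "a = 0") (auto intro: inverse_unique[symmetric])
  show "h (a - b) = h a - h b" using add[of a "- b"] neg by simp
  show "h (a / b) = h a / h b" using mult[of a "inverse b"] inv by (simp add: divide_inverse)
  show "h (a ^ k) = h a ^ k" by (induction k) (auto simp: 1 mult)
  show "h (of_nat k) = of_nat k" by (induction k) (auto simp: 0 1 add)
  show "h (sum f A) = (\<Sum>i\<in>A. h (f i))" by (induction A rule: infinite_finite_induct) (auto simp: 0 add)
  show "h (prod f A) = (\<Prod>i\<in>A. h (f i))" by (induction A rule: infinite_finite_induct) (auto simp: 1 mult)
  show "h a = 0 \<longleftrightarrow> a = 0"
    using mult[of a "inverse a"] 0 1 by (cases "a = 0") auto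
qed

lemma is_subfield_fixed: "is_endo h \<Longrightarrow> is_subfield {a. h a = a}"
  by (simp add: is_subfield_def is_endoD)

lemma is_subfield_Int: "is_subfield K \<Longrightarrow> is_subfield L \<Longrightarrow> is_subfield (K \<inter> L)"
  by (simp add: is_subfield_def)

lemma field_gen_fixed: "is_endo h \<Longrightarrow> (\<And>a. a \<in> S \<Longrightarrow> h a = a) \<Longrightarrow> f \<in> field_gen S \<Longrightarrow> h f = f"
  using field_gen_least[OF is_subfield_fixed, of h S] by blast

section \<open>Roots of unity and Kummer descent\<close>

locale root_of_unity =
  fixes \<zeta> :: "'b::field_char_0" and p :: nat
  assumes prime_p: "prime p" and zeta_power_p: "\<zeta> ^ p = 1" and zeta_neq_1: "\<zeta> \<noteq> 1"
begin

lemma p_gt_0 [simp]: "p > 0" and p_neq_0 [simp]: "p \<noteq> 0" and p_gt_1: "p > 1"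
  using prime_gt_0_nat[OF prime_p] prime_gt_1_nat[OF prime_p] by auto

lemma zeta_neq_0 [simp]: "\<zeta> \<noteq> 0"
  using zeta_power_p by (metis p_gt_0 power_0_left power_one_right zero_neq_one not_gr_zero)

text \<open>An exponent not divisible by the prime \<open>p\<close> is coprime to it, and Bezout
  would then turn \<open>\<zeta> ^ k = 1\<close> into \<open>\<zeta> = 1\<close>.\<close>

lemma zeta_power_eq_1_iff: "\<zeta> ^ k = 1 \<longleftrightarrow> p dvd k"
proof
  assume *: "\<zeta> ^ k = 1"
  show "p dvd k"
  proof (rule ccontr)
    assume "\<not> p dvd k"
    then have "coprime k p" "k \<noteq> 0"
      using prime_imp_coprime[OF prime_p] by (auto simp: coprime_commute intro!: Nat.gr0I)
    then obtain x y where "k * x = p * y + 1"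
      using bezout_nat[of k p] by (auto simp: coprime_iff_gcd_eq_1)
    then have "(\<zeta> ^ k) ^ x = (\<zeta> ^ p) ^ y * \<zeta>" by (simp flip: power_mult)
    then show False using * zeta_power_p zeta_neq_1 by simp
  qed
qed (auto simp: zeta_power_p power_mult)

lemma zeta_power_mod: "\<zeta> ^ (k mod p) = \<zeta> ^ k"
proof -
  have "\<zeta> ^ k = \<zeta> ^ (p * (k div p) + k mod p)" by simp
  then show ?thesis by (simp only: power_add power_mult zeta_power_p power_one mult_1)
qed

section \<open>Character sums and the finite Fourier transform\<close>

lemma sum_zeta_power: "(\<Sum>c<p. \<zeta> ^ (c * k)) = (if p dvd k then of_nat p else 0)"
proof (cases "p dvd k")
  case True
  then have "\<zeta> ^ (c * k) = 1" for c by (simp add: zeta_power_eq_1_iff)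
  then show ?thesis using True by simp
next
  case False
  then have "\<zeta> ^ k \<noteq> 1" by (simp add: zeta_power_eq_1_iff)
  moreover have "(\<zeta> ^ k) ^ p = 1" by (metis mult.commute power_mult power_one zeta_power_p)
  ultimately have "(\<Sum>c<p. (\<zeta> ^ k) ^ c) = 0" by (simp add: geometric_sum)
  then show ?thesis using False by (simp add: mult.commute flip: power_mult)
qed

lemma sum_zeta_quotient:
  assumes "i < p" "j < p"
  shows "(\<Sum>c<p. \<zeta> ^ (c * i) / \<zeta> ^ (c * j)) = (if i = j then of_nat p else 0)"
proof -
  \<comment> \<open>The exponent \<open>p - j\<close> stands in for \<open>- j\<close>, which turns
    the quotient into a power with natural exponent.\<close>
  have "\<zeta> ^ (c * i) / \<zeta> ^ (c * j) = \<zeta> ^ (c * (i + (p - j)))" for c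
  proof -
    have "\<zeta> ^ (c * (i + (p - j))) * \<zeta> ^ (c * j) = \<zeta> ^ (c * (i + (p - j) + j))"
      by (simp only: power_add distrib_left)
    also have "\<dots> = \<zeta> ^ (c * i) * (\<zeta> ^ p) ^ c"
      using assms by (simp add: power_add distrib_left mult.commute flip: power_mult)
    finally show ?thesis by (simp add: zeta_power_p field_simps)
  qed
  moreover have "p dvd i + (p - j) \<longleftrightarrow> i = j"
  proof
    assume "p dvd i + (p - j)"
    then obtain q where q: "i + (p - j) = p * q" by blast
    \<comment> \<open>The sum lies strictly between 0 and \<open>2 * p\<close>, so the only multiple
      of \<open>p\<close> it can equal is \<open>p\<close> itself.\<close>
    have "0 < p * q" "p * q < p * 2" using q assms by linarith+
    then have "q = 1" by (metis Suc_1 less_2_cases mult_0_right mult_less_cancel1 not_less_zero One_nat_def)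
    then show "i = j" using q assms by simp
  qed (use assms in simp)
  ultimately show ?thesis by (simp add: sum_zeta_power)
qed

lemma sum_shift_mod: "(\<Sum>c<p. f (Suc c mod p)) = (\<Sum>c<p. f c)" for f :: "nat \<Rightarrow> 'c::comm_monoid_add"
proof -
  obtain q where q: "p = Suc q" using p_gt_0 by (cases p) auto
  have "(\<Sum>c<p. f (Suc c mod p)) = (\<Sum>c<q. f (Suc c)) + f 0" by (simp add: q)
  also have "\<dots> = (\<Sum>c<p. f c)" by (simp only: q sum.lessThan_Suc_shift) (simp add: add.commute)
  finally show ?thesis .
qed

lemma prod_shift_mod: "(\<Prod>c<p. f (Suc c mod p)) = (\<Prod>c<p. f c)" for f :: "nat \<Rightarrow> 'c::comm_monoid_mult"
proof -
  obtain q where q: "p = Suc q" using p_gt_0 by (cases p) auto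
  have "(\<Prod>c<p. f (Suc c mod p)) = (\<Prod>c<q. f (Suc c)) * f 0" by (simp add: q)
  also have "\<dots> = (\<Prod>c<p. f c)" by (simp only: q prod.lessThan_Suc_shift) (simp add: mult.commute)
  finally show ?thesis .
qed

text \<open>These are Lagrange resolvents. Dividing by the root of unity, rather than multiplying,
  makes \<open>\<zeta> ^ k\<close> the eigenvalue under the cyclic shift of
  \<open>f\<close>.\<close>

definition fourier :: "(nat \<Rightarrow> 'b) \<Rightarrow> nat \<Rightarrow> 'b" where
  "fourier f k = (\<Sum>c<p. f c / \<zeta> ^ (c * k))"

lemma fourier_inversion:
  assumes "c < p"
  shows "f c = (\<Sum>k<p. \<zeta> ^ (c * k) * fourier f k) / of_nat p"
proof -
  have "(\<Sum>k<p. \<zeta> ^ (c * k) * fourier f k) = (\<Sum>k<p. \<Sum>d<p. f d * (\<zeta> ^ (k * c) / \<zeta> ^ (k * d)))"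
    unfolding fourier_def sum_distrib_left by (simp add: mult.commute)
  also have "\<dots> = (\<Sum>d<p. f d * (\<Sum>k<p. \<zeta> ^ (k * c) / \<zeta> ^ (k * d)))"
    by (subst sum.swap) (simp add: sum_distrib_left)
  also have "\<dots> = (\<Sum>d<p. if d = c then f c * of_nat p else 0)"
    by (rule sum.cong) (use assms in \<open>auto simp: sum_zeta_quotient\<close>)
  also have "\<dots> = f c * of_nat p" using assms by simp
  finally show ?thesis by simp
qed

lemma fourier_shift:
  assumes "is_endo h" "h \<zeta> = \<zeta>" "\<And>c. c < p \<Longrightarrow> h (f c) = f (Suc c mod p)"
  shows "h (fourier f k) = \<zeta> ^ k * fourier f k"
proof -
  have "h (fourier f k) = (\<Sum>c<p. f (Suc c mod p) / \<zeta> ^ (c * k))"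
    unfolding fourier_def using assms by (simp add: is_endoD)
  also have "\<dots> = (\<Sum>c<p. \<zeta> ^ k * (f (Suc c mod p) / \<zeta> ^ ((Suc c mod p) * k)))"
    by (simp add: power_mult zeta_power_mod power_mult_distrib)
  also have "\<dots> = (\<Sum>c<p. \<zeta> ^ k * (f c / \<zeta> ^ (c * k)))"
    by (rule sum_shift_mod[where f = "\<lambda>c. \<zeta> ^ k * (f c / \<zeta> ^ (c * k))"])
  finally show ?thesis by (simp add: fourier_def sum_distrib_left)
qed

text \<open>The inverse of \<open>f \<in> B[t]\<close> is the product of the other conjugates of \<open>f\<close> divided by
  the norm of \<open>f\<close>, which lies in \<open>B\<close>.\<close>

lemma kummer_descent:
  assumes B: "is_subfield B" "\<zeta> \<in> B" and t: "t ^ p \<in> B"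
    and h: "is_endo h" "\<And>b. b \<in> B \<Longrightarrow> h b = b" "h t = \<zeta> * t"
    and f: "f \<in> field_gen (B \<union> {t})" "h f = f"
  shows "f \<in> B"
proof -
  \<comment> \<open>\<open>A\<close> is \<open>B[t]\<close>: since \<open>t ^ p\<close> lies in
    \<open>B\<close>, exponents can be kept below \<open>p\<close>. The aim is that \<open>A\<close>
    is already a field and hence contains \<open>f\<close>.\<close>
  define A where "A = {f. \<exists>a. (\<forall>i. a i \<in> B) \<and> f = (\<Sum>i<p. a i * t ^ i)}"
  have hz: "h \<zeta> = \<zeta>" using B h by blast
  have fixed: "f \<in> B" if fA: "f \<in> A" and "h f = f" for f
  proof -
    obtain a where a: "\<And>i. a i \<in> B" "f = (\<Sum>i<p. a i * t ^ i)" using fA unfolding A_def by blast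
    \<comment> \<open>\<open>h\<close> multiplies the \<open>i\<close>-th term by
      \<open>\<zeta> ^ i\<close>, so the left-hand side is the fixed element \<open>f\<close> after
      \<open>c\<close> applications of \<open>h\<close>.\<close>
    have it: "(\<Sum>i<p. a i * \<zeta> ^ (c * i) * t ^ i) = f" for c
    proof (induction c)
      case (Suc c)
      have "(\<Sum>i<p. a i * \<zeta> ^ (Suc c * i) * t ^ i) = h (\<Sum>i<p. a i * \<zeta> ^ (c * i) * t ^ i)"
        using h hz a by (simp add: is_endoD power_mult_distrib power_add algebra_simps)
      then show ?case using Suc that by simp
    qed (simp add: a)
    \<comment> \<open>Averaging over all \<open>c\<close> leaves only the term with
      \<open>i = 0\<close>, which lies in \<open>B\<close>.\<close>
    have "of_nat p * f = (\<Sum>c<p. \<Sum>i<p. a i * \<zeta> ^ (c * i) * t ^ i)" by (simp add: it)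
    also have "\<dots> = (\<Sum>i<p. a i * t ^ i * (\<Sum>c<p. \<zeta> ^ (c * i)))"
      by (subst sum.swap) (simp add: sum_distrib_left mult_ac)
    also have "\<dots> = (\<Sum>i<p. if i = 0 then a i * of_nat p else 0)"
      by (rule sum.cong) (auto simp: sum_zeta_power dvd_imp_le dest: dvd_imp_le)
    also have "\<dots> = a 0 * of_nat p" by simp
    finally have "f = a 0" by simp
    then show ?thesis using a by simp
  qed
  have BA: "b * t ^ k \<in> A" if "b \<in> B" for b k
  proof -
    have "t ^ k = (t ^ p) ^ (k div p) * t ^ (k mod p)"
      by (simp flip: power_mult power_add)
    then have "b * t ^ k = (\<Sum>i<p. (if i = k mod p then b * (t ^ p) ^ (k div p) else 0) * t ^ i)"
      by (simp add: if_distrib[of "\<lambda>x. x * _"] cong: if_cong)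
    then show ?thesis unfolding A_def using B t that
      by (intro CollectI exI[of _ "\<lambda>i. if i = k mod p then b * (t ^ p) ^ (k div p) else 0"])
        (auto intro: is_subfieldD)
  qed
  have addA: "f + g \<in> A" if fA: "f \<in> A" and gA: "g \<in> A" for f g
  proof -
    obtain a b where a: "\<And>i. a i \<in> B" "f = (\<Sum>i<p. a i * t ^ i)"
      and b: "\<And>i. b i \<in> B" "g = (\<Sum>i<p. b i * t ^ i)" using fA gA unfolding A_def by blast
    then have "f + g = (\<Sum>i<p. (a i + b i) * t ^ i)" by (simp add: sum.distrib distrib_right)
    then show ?thesis unfolding A_def using a b B
      by (intro CollectI exI[of _ "\<lambda>i. a i + b i"]) (auto intro: is_subfieldD)
  qed
  have zeroA: "0 \<in> A" using BA[of 0 0] is_subfieldD(2)[OF B(1)] by simp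
  have sumA: "(\<Sum>i\<in>I. g i) \<in> A" if "\<And>i. i \<in> I \<Longrightarrow> g i \<in> A" for g and I :: "nat set"
    using that by (induction I rule: infinite_finite_induct) (auto intro: zeroA addA)
  have multA: "f * g \<in> A" if fA: "f \<in> A" and gA: "g \<in> A" for f g
  proof -
    obtain a b where a: "\<And>i. a i \<in> B" "f = (\<Sum>i<p. a i * t ^ i)"
      and b: "\<And>i. b i \<in> B" "g = (\<Sum>i<p. b i * t ^ i)" using fA gA unfolding A_def by blast
    have "f * g = (\<Sum>i<p. \<Sum>j<p. (a i * b j) * t ^ (i + j))"
      by (simp add: a b sum_product power_add mult_ac)
    then show ?thesis using a b B by (auto intro!: sumA BA is_subfieldD)
  qed
  have oneA: "1 \<in> A" using BA[of 1 0] is_subfieldD(1)[OF B(1)] by simp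
  have prodA: "(\<Prod>i\<in>I. g i) \<in> A" if "\<And>i. i \<in> I \<Longrightarrow> g i \<in> A" for g and I :: "nat set"
    using that by (induction I rule: infinite_finite_induct) (auto intro: oneA multA)
  have invA: "inverse f \<in> A" if fA: "f \<in> A" and "f \<noteq> 0" for f
  proof -
    obtain a where a: "\<And>i. a i \<in> B" "f = (\<Sum>i<p. a i * t ^ i)" using fA unfolding A_def by blast
    \<comment> \<open>\<open>g c\<close> is the conjugate of \<open>f\<close> under \<open>c\<close>
      applications of \<open>h\<close>; it depends on \<open>c\<close> only modulo
      \<open>p\<close>.\<close>
    define g where "g c = (\<Sum>i<p. a i * \<zeta> ^ (c * i) * t ^ i)" for c
    have g0: "g 0 = f" by (simp add: g_def a)
    have gA: "g c \<in> A" for c unfolding g_def using a B by (auto intro!: sumA BA is_subfieldD)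
    have hg: "h (g c) = g (Suc c)" for c
      using h hz a by (simp add: g_def is_endoD power_mult_distrib power_add algebra_simps)
    have gp: "g (c mod p) = g c" for c
      by (simp add: g_def power_mult zeta_power_mod)
    define N where "N = (\<Prod>c<p. g c)"
    have "h N = (\<Prod>c<p. g (Suc c mod p))" using h hg by (simp add: N_def is_endoD gp)
    also have "\<dots> = N" unfolding N_def by (rule prod_shift_mod)
    finally have NB: "N \<in> B" using gA by (intro fixed) (auto simp: N_def intro: prodA)
    \<comment> \<open>Conjugates of a nonzero element are nonzero because \<open>h\<close> is
      injective, so the norm can be inverted.\<close>
    have "g c \<noteq> 0" for c
      by (induction c) (use h that in \<open>auto simp: g0 is_endoD simp flip: hg\<close>)
    then have N0: "N \<noteq> 0" by (simp add: N_def)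
    have "N = f * (\<Prod>c\<in>{1..<p}. g c)"
      unfolding N_def by (simp add: lessThan_atLeast0 prod.atLeast_Suc_lessThan g0)
    then have "inverse f = (inverse N * t ^ 0) * (\<Prod>c\<in>{1..<p}. g c)" using N0 that by (simp add: field_simps)
    moreover have "(inverse N * t ^ 0) * (\<Prod>c\<in>{1..<p}. g c) \<in> A"
      by (intro multA BA prodA gA is_subfieldD(4)[OF B(1)] NB)
    ultimately show ?thesis by simp
  qed
  have "f \<in> A" using f(1)
  proof (induction rule: field_gen_induct)
    case (incl a)
    then show ?case using BA[of a 0] BA[of 1 1] is_subfieldD(1)[OF B(1)] by auto
  next
    case one
    show ?case by (rule oneA)
  next
    case (minus a)
    have "(- 1) * t ^ 0 \<in> A" by (intro BA is_subfieldD(3)[OF B(1)] is_subfieldD(1)[OF B(1)])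
    from multA[OF this minus] show ?case by simp
  qed (auto intro: addA multA invA)
  then show ?thesis using f(2) by (rule fixed)
qed

end

section \<open>Derivations and algebraic independence\<close>

text \<open>Gives the fields of rational functions characteristic 0, as the locale for roots of
  unity and the derivation argument require.\<close>

instance fract :: ("{idom, ring_char_0}") field_char_0
proof
  have *: "of_nat k = Fraction_Field.Fract (of_nat k :: 'a) 1" for k
    by (induction k) (simp_all add: Zero_fract_def One_fract_def)
  show "inj (of_nat :: nat \<Rightarrow> 'a fract)"
    by (rule injI) (simp add: * eq_fract)
qed

definition is_deriv :: "('b::field \<Rightarrow> 'b) \<Rightarrow> bool" where
  "is_deriv D \<longleftrightarrow> (\<forall>a b. D (a + b) = D a + D b \<and> D (a * b) = D a * b + a * D b)"

lemma is_derivD: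
  assumes "is_deriv D"
  shows "D (a + b) = D a + D b" "D (a * b) = D a * b + a * D b" "D 0 = 0" "D 1 = 0" "D (- a) = - D a"
    "D (sum f A) = (\<Sum>i\<in>A. D (f i))" "D (of_nat k) = 0" "D (a ^ Suc k) = of_nat (Suc k) * a ^ k * D a"
proof -
  show add: "D (a + b) = D a + D b" and mult: "D (a * b) = D a * b + a * D b" for a b
    using assms by (auto simp: is_deriv_def)
  show zero: "D 0 = 0" by (metis add add_0 add_cancel_left_left)
  show one: "D 1 = 0" by (metis mult mult_1 mult_1_right add_cancel_left_left)
  show "D (- a) = - D a" using add[of a "- a"] zero by (simp add: eq_neg_iff_add_eq_0 add.commute)
  show "D (sum f A) = (\<Sum>i\<in>A. D (f i))"
    by (induction A rule: infinite_finite_induct) (auto simp: zero add)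
  show "D (of_nat k) = 0" by (induction k) (auto simp: zero one add)
  show "D (a ^ Suc k) = of_nat (Suc k) * a ^ k * D a"
    by (induction k) (simp_all add: mult one algebra_simps)
qed

lemma is_subfield_deriv_kernel:
  assumes "is_deriv D"
  shows "is_subfield {a. D a = 0}"
proof -
  have "D (inverse a) = 0" if "D a = 0" for a
  proof (cases "a = 0")
    case False
    then have "0 = a * D (inverse a)"
      using is_derivD(2)[OF assms, of a "inverse a"] is_derivD(4)[OF assms] that by simp
    then show ?thesis using False by simp
  qed (simp add: is_derivD(3)[OF assms])
  then show ?thesis using is_derivD[OF assms] by (simp add: is_subfield_def)
qed

lemma deriv_poly:
  assumes "is_deriv D" "\<And>k. D (coeff q k) = 0"
  shows "D (poly q t) = poly (pderiv q) t * D t"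
  using assms(2)
proof (induction q)
  case (pCons a q)
  have "D a = 0" "D (coeff q k) = 0" for k
    using pCons.prems[of 0] pCons.prems[of "Suc k"] by simp_all
  then show ?case using pCons.IH is_derivD[OF assms(1)] by (simp add: pderiv_pCons algebra_simps)
qed (simp add: is_derivD[OF assms(1)])

text \<open>Induction on the degree stands in for a minimal polynomial. Differentiating the relation
  gives \<open>poly (pderiv q) t * D t = 0\<close>; if the first factor vanishes,
  \<open>pderiv q\<close> is a nonzero relation of smaller degree, by characteristic 0.\<close>

lemma deriv_algebraic:
  fixes D :: "'b::field_char_0 \<Rightarrow> 'b"
  assumes "is_deriv D" "\<And>k. D (coeff q k) = 0" "q \<noteq> 0" "poly q t = 0"
  shows "D t = 0"
  using assms(2-)
proof (induction "degree q" arbitrary: q rule: less_induct)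
  case less
  have *: "poly (pderiv q) t * D t = 0"
    using deriv_poly[OF assms(1), of q t] less.prems is_derivD(3)[OF assms(1)] by simp
  show ?case
  proof (cases "poly (pderiv q) t = 0")
    case True
    have deg: "degree q \<noteq> 0"
    proof
      assume "degree q = 0"
      then obtain a where "q = [:a:]" by (rule degree_eq_zeroE)
      then show False using less.prems by simp
    qed
    show ?thesis
    proof (rule less.hyps)
      show "degree (pderiv q) < degree q" using deg by (simp add: degree_pderiv)
      show "D (coeff (pderiv q) k) = 0" for k
        using less.prems(1) is_derivD[OF assms(1)] by (simp add: coeff_pderiv del: of_nat_Suc)
      show "pderiv q \<noteq> 0" using deg by (simp add: pderiv_eq_0_iff)
    qed (rule True)
  qed (use * in simp)
qed

text \<open>Gaussian elimination, one equation at a time: a nonzero entry \<open>A i j0\<close>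
  eliminates the unknown \<open>j0\<close>, and an equation with zero coefficients is
  dropped.\<close>

lemma homogeneous_system:
  fixes A :: "'i \<Rightarrow> 'j \<Rightarrow> 'b::field"
  assumes "finite I" "finite J" "card I < card J"
  shows "\<exists>d. (\<exists>j\<in>J. d j \<noteq> 0) \<and> (\<forall>i\<in>I. (\<Sum>j\<in>J. A i j * d j) = 0)"
  using assms
proof (induction I arbitrary: J A rule: finite_induct)
  case empty
  then have "J \<noteq> {}" by auto
  then show ?case by (intro exI[of _ "\<lambda>_. 1"]) auto
next
  case (insert i I)
  show ?case
  proof (cases "\<forall>j\<in>J. A i j = 0")
    case True
    obtain d where "\<exists>j\<in>J. d j \<noteq> 0" "\<forall>i\<in>I. (\<Sum>j\<in>J. A i j * d j) = 0"
      using insert.IH[of J A] insert.prems insert.hyps by auto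
    then show ?thesis using True by (intro exI[of _ d]) auto
  next
    case False
    then obtain j0 where j0: "j0 \<in> J" "A i j0 \<noteq> 0" by blast
    define J' where "J' = J - {j0}"
    have J: "J = insert j0 J'" "j0 \<notin> J'" "finite J'" using j0 insert.prems by (auto simp: J'_def)
    have "card I < card J'" using insert.prems insert.hyps J by simp
    then obtain d where d: "\<exists>j\<in>J'. d j \<noteq> 0"
      "\<And>k. k \<in> I \<Longrightarrow> (\<Sum>j\<in>J'. (A k j - A k j0 * A i j / A i j0) * d j) = 0"
      using insert.IH[OF J(3), of "\<lambda>k j. A k j - A k j0 * A i j / A i j0"] by blast
    \<comment> \<open>The value of the eliminated unknown that makes equation \<open>i\<close>
      hold.\<close>
    define s where "s = - (\<Sum>j\<in>J'. A i j * d j) / A i j0"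
    have sum: "(\<Sum>j\<in>J. A k j * (d(j0 := s)) j) = A k j0 * s + (\<Sum>j\<in>J'. A k j * d j)" for k
    proof -
      have "(\<Sum>j\<in>J'. A k j * (d(j0 := s)) j) = (\<Sum>j\<in>J'. A k j * d j)"
        using J by (intro sum.cong) auto
      then show ?thesis using J by simp
    qed
    have "(\<Sum>j\<in>J. A k j * (d(j0 := s)) j) = 0" if "k \<in> insert i I" for k
    proof (cases "k = i")
      case True
      then show ?thesis unfolding sum using j0 by (simp add: s_def)
    next
      case False
      have "(\<Sum>j\<in>J'. (A k j - A k j0 * A i j / A i j0) * d j) =
          (\<Sum>j\<in>J'. A k j * d j) - A k j0 * (\<Sum>j\<in>J'. A i j * d j) / A i j0"
        by (simp add: left_diff_distrib sum_subtractf sum_distrib_left sum_divide_distrib mult.assoc)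
      then show ?thesis unfolding sum using d(2)[of k] False that by (simp add: s_def)
    qed
    moreover have "\<exists>j\<in>J. (d(j0 := s)) j \<noteq> 0" using d(1) J by (metis fun_upd_other insertI2)
    ultimately show ?thesis by blast
  qed
qed

definition algebraic_over :: "'b::field set \<Rightarrow> 'b \<Rightarrow> bool" where
  "algebraic_over K t \<longleftrightarrow> (\<exists>q. q \<noteq> 0 \<and> (\<forall>k. coeff q k \<in> K) \<and> poly q t = 0)"

lemma deriv_algebraic_over:
  fixes D :: "'b::field_char_0 \<Rightarrow> 'b"
  assumes "is_deriv D" "\<And>a. a \<in> K \<Longrightarrow> D a = 0" "algebraic_over K t"
  shows "D t = 0"
  using assms deriv_algebraic[OF assms(1)] unfolding algebraic_over_def by blast

text \<open>Sort the relation by powers of \<open>y v\<close>. If some coefficient is nonzero,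
  \<open>y v\<close> is algebraic over the field generated by the rest; otherwise the terms with the
  same power of \<open>y v\<close> as \<open>m0\<close> form a relation in fewer variables. Indexing
  monomials by an arbitrary set keeps such parts of the same shape.\<close>

lemma dependent_algebraic:
  fixes y :: "'i \<Rightarrow> 'b::field" and A :: "'m set" and e :: "'m \<Rightarrow> 'i \<Rightarrow> nat"
  assumes "finite V" "finite A" "\<And>m. m \<in> A \<Longrightarrow> b m \<in> K" "m0 \<in> A" "b m0 \<noteq> 0"
    and "\<And>m m'. m \<in> A \<Longrightarrow> m' \<in> A \<Longrightarrow> \<forall>i\<in>V. e m i = e m' i \<Longrightarrow> m = m'"
    and "(\<Sum>m\<in>A. b m * (\<Prod>i\<in>V. y i ^ e m i)) = 0"
  shows "\<exists>v\<in>V. algebraic_over (field_gen (K \<union> y ` (V - {v}))) (y v)"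
  using assms
proof (induction V arbitrary: A m0 rule: finite_induct)
  case empty
  \<comment> \<open>Without variables all exponent vectors agree, so the relation reduces to
    \<open>b m0 = 0\<close>.\<close>
  then have "A = {m0}" by auto
  then show ?case using empty by simp
next
  case (insert v V)
  define s where "s k = (\<Sum>m\<in>{m \<in> A. e m v = k}. b m * (\<Prod>i\<in>V. y i ^ e m i))" for k
  let ?ks = "(\<lambda>m. e m v) ` A"
  have fin: "finite ?ks" using insert.prems by simp
  have "(\<Sum>m\<in>A. b m * (\<Prod>i\<in>insert v V. y i ^ e m i)) =
      (\<Sum>k\<in>?ks. \<Sum>m\<in>{m \<in> A. e m v = k}. b m * (\<Prod>i\<in>insert v V. y i ^ e m i))"
    by (rule sum.image_gen) (use insert.prems in simp)
  also have "\<dots> = (\<Sum>k\<in>?ks. s k * y v ^ k)"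
    unfolding s_def sum_distrib_right using insert.hyps by (intro sum.cong) (auto simp: mult_ac)
  finally have zero: "(\<Sum>k\<in>?ks. s k * y v ^ k) = 0" using insert.prems by simp
  show ?case
  proof (cases "\<exists>k\<in>?ks. s k \<noteq> 0")
    case True
    then obtain k where k: "k \<in> ?ks" "s k \<noteq> 0" by blast
    define q where "q = (\<Sum>k\<in>?ks. monom (s k) k)"
    have coeff: "coeff q k = (if k \<in> ?ks then s k else 0)" for k
      using fin by (simp add: q_def coeff_sum sum.delta)
    have sK: "s k \<in> field_gen (K \<union> y ` V)" for k unfolding s_def
      using insert.prems(2) field_gen_superset[of "K \<union> y ` V"]
      by (intro is_subfield_sum is_subfield_prod is_subfieldD(6,9) is_subfield_field_gen) auto
    have "algebraic_over (field_gen (K \<union> y ` V)) (y v)" unfolding algebraic_over_def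
    proof (intro exI[of _ q] conjI allI)
      show "q \<noteq> 0" using k coeff[of k] by auto
      show "coeff q k \<in> field_gen (K \<union> y ` V)" for k
        by (auto simp: coeff sK intro!: is_subfieldD(2) is_subfield_field_gen)
      show "poly q (y v) = 0" using zero by (simp add: q_def poly_sum poly_monom)
    qed
    moreover have "insert v V - {v} = V" using insert.hyps by auto
    ultimately show ?thesis by (intro bexI[of _ v]) simp_all
  next
    case False
    have "\<exists>i\<in>V. algebraic_over (field_gen (K \<union> y ` (V - {i}))) (y i)"
    proof (rule insert.IH[of "{m \<in> A. e m v = e m0 v}" m0])
      show "(\<Sum>m\<in>{m \<in> A. e m v = e m0 v}. b m * (\<Prod>i\<in>V. y i ^ e m i)) = 0"
        using False insert.prems(3) by (auto simp: s_def)
      show "m = m'" if "m \<in> {m \<in> A. e m v = e m0 v}" "m' \<in> {m \<in> A. e m v = e m0 v}" "\<forall>i\<in>V. e m i = e m' i"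
        for m m' using insert.prems(5)[of m m'] that by auto
    qed (use insert.prems in auto)
    then obtain i where i: "i \<in> V" "algebraic_over (field_gen (K \<union> y ` (V - {i}))) (y i)" by blast
    have "field_gen (K \<union> y ` (V - {i})) \<subseteq> field_gen (K \<union> y ` (insert v V - {i}))"
      by (rule field_gen_mono) auto
    then show ?thesis using i by (intro bexI[of _ i]) (auto simp: algebraic_over_def)
  qed
qed

section \<open>Derivations of the field of rational functions\<close>

definition mon_val :: "(nat \<Rightarrow>\<^sub>0 nat) \<Rightarrow> 'a::field ratfun" where
  "mon_val m = Fract (Poly_Mapping.single m 1) 1"

definition log_deriv :: "(nat \<Rightarrow> 'b) \<Rightarrow> (nat \<Rightarrow>\<^sub>0 nat) \<Rightarrow> 'b::field" where
  "log_deriv d m = (\<Sum>j\<in>Poly_Mapping.keys m. of_nat (Poly_Mapping.lookup m j) * d j)"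

text \<open>The derivation with \<open>x\<^sub>j \<mapsto> d\<^sub>j x\<^sub>j\<close>: in this logarithmic form it multiplies every monomial
  by a factor that is additive in the exponents.\<close>

definition mpol_deriv :: "(nat \<Rightarrow> 'a ratfun) \<Rightarrow> 'a::field mpol \<Rightarrow> 'a ratfun" where
  "mpol_deriv d P = (\<Sum>m\<in>Poly_Mapping.keys P. rconst (Poly_Mapping.lookup P m) * mon_val m * log_deriv d m)"

lemma rconst_add: "rconst (a + b) = rconst a + rconst b"
  and rconst_mult: "rconst (a * b) = rconst a * rconst b"
  and rconst_0 [simp]: "rconst 0 = 0" and rconst_1 [simp]: "rconst 1 = 1"
  by (simp_all add: rconst_def single_add mult_single Zero_fract_def One_fract_def)

lemma rconst_eq_iff [simp]: "rconst a = rconst b \<longleftrightarrow> a = b"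
proof
  assume "rconst a = rconst b"
  then have "Poly_Mapping.single 0 a = (Poly_Mapping.single 0 b :: 'a mpol)" by (simp add: rconst_def eq_fract)
  then show "a = b" by (metis lookup_single_eq)
qed simp

lemma rconst_eq_0_iff [simp]: "rconst a = 0 \<longleftrightarrow> a = 0"
  using rconst_eq_iff[of a 0] by simp

lemma mon_val_add: "mon_val (m + m') = mon_val m * mon_val m'"
  by (simp add: mon_val_def mult_single)

lemma log_deriv_superset:
  assumes "finite A" "Poly_Mapping.keys m \<subseteq> A"
  shows "log_deriv d m = (\<Sum>j\<in>A. of_nat (Poly_Mapping.lookup m j) * d j)"
  unfolding log_deriv_def by (rule sum.mono_neutral_left) (use assms in \<open>auto simp: in_keys_iff\<close>)

lemma log_deriv_add: "log_deriv d (m + m') = log_deriv d m + log_deriv d m'"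
proof -
  let ?A = "Poly_Mapping.keys m \<union> Poly_Mapping.keys m'"
  have "Poly_Mapping.keys (m + m') \<subseteq> ?A" by (rule keys_add)
  then show ?thesis
    by (simp add: log_deriv_superset[of ?A] lookup_add distrib_right sum.distrib)
qed

lemma mpol_deriv_superset:
  assumes "finite A" "Poly_Mapping.keys P \<subseteq> A"
  shows "mpol_deriv d P = (\<Sum>m\<in>A. rconst (Poly_Mapping.lookup P m) * mon_val m * log_deriv d m)"
  unfolding mpol_deriv_def by (rule sum.mono_neutral_left) (use assms in \<open>auto simp: in_keys_iff\<close>)

lemma mpol_deriv_add: "mpol_deriv d (P + Q) = mpol_deriv d P + mpol_deriv d Q"
proof -
  let ?A = "Poly_Mapping.keys P \<union> Poly_Mapping.keys Q"
  have "Poly_Mapping.keys (P + Q) \<subseteq> ?A" by (rule keys_add)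
  then show ?thesis
    by (simp add: mpol_deriv_superset[of ?A] lookup_add rconst_add distrib_right sum.distrib)
qed

lemma mpol_deriv_0: "mpol_deriv d 0 = 0"
  by (simp add: mpol_deriv_def)

lemma mpol_deriv_sum: "mpol_deriv d (\<Sum>i\<in>A. f i) = (\<Sum>i\<in>A. mpol_deriv d (f i))"
  by (induction A rule: infinite_finite_induct) (simp_all add: mpol_deriv_add mpol_deriv_0)

lemma mpol_deriv_single:
  "mpol_deriv d (Poly_Mapping.single m c) = rconst c * mon_val m * log_deriv d m"
  by (simp add: mpol_deriv_def)

lemma Fract_single: "Fract (Poly_Mapping.single m c) 1 = rconst c * mon_val m"
  by (simp add: rconst_def mon_val_def mult_single)

lemma mpol_deriv_mult:
  "mpol_deriv d (P * Q) = mpol_deriv d P * Fract Q 1 + Fract P 1 * mpol_deriv d Q"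
proof -
  let ?P = "Poly_Mapping.lookup P" and ?Q = "Poly_Mapping.lookup Q"
  have "P * Q = (\<Sum>m\<in>Poly_Mapping.keys P. \<Sum>m'\<in>Poly_Mapping.keys Q.
      Poly_Mapping.single (m + m') (?P m * ?Q m'))"
    by (subst mpol_expand[of P], subst mpol_expand[of Q]) (simp add: sum_product mult_single)
  then have "mpol_deriv d (P * Q) = (\<Sum>m\<in>Poly_Mapping.keys P. \<Sum>m'\<in>Poly_Mapping.keys Q.
      (rconst (?P m) * mon_val m * log_deriv d m) * (rconst (?Q m') * mon_val m') +
      (rconst (?P m) * mon_val m) * (rconst (?Q m') * mon_val m' * log_deriv d m'))"
    by (simp add: mpol_deriv_sum mpol_deriv_single rconst_mult mon_val_add log_deriv_add algebra_simps)
  also have "\<dots> = mpol_deriv d P * Fract Q 1 + Fract P 1 * mpol_deriv d Q"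
    by (subst (2) mpol_expand[of Q], subst (3) mpol_expand[of P])
      (simp add: mpol_deriv_def Fract_sum Fract_single sum_product sum.distrib)
  finally show ?thesis .
qed

text \<open>The logarithmic derivation of polynomials extends to fractions by the quotient
  rule.\<close>

lemma exists_deriv:
  fixes d :: "nat \<Rightarrow> 'a::field ratfun"
  shows "\<exists>D. is_deriv D \<and> (\<forall>c. D (rconst c) = 0) \<and> (\<forall>j. D (rvar j) = d j * rvar j)"
proof -
  define \<delta> where "\<delta> a b = (mpol_deriv d a * Fract b 1 - Fract a 1 * mpol_deriv d b) / Fract b 1 ^ 2" for a b
  \<comment> \<open>\<open>SOME\<close> picks a representative of the fraction; \<open>wd\<close>
    shows that the choice does not matter.\<close>
  define D where "D f = (let (a, b) = (SOME (a, b). b \<noteq> 0 \<and> f = Fract a b) in \<delta> a b)" for f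
  have nz: "Fract b 1 \<noteq> 0" if "b \<noteq> 0" for b :: "'a mpol"
    using that by (simp add: Zero_fract_def eq_fract)
  have fr: "Fract a b = Fract a 1 / Fract b 1" if "b \<noteq> 0" for a b :: "'a mpol"
    using that by simp
  have wd: "\<delta> a b = \<delta> a' b'" if "b \<noteq> 0" "b' \<noteq> 0" "Fract a b = Fract a' b'" for a b a' b'
  proof -
    have e: "a * b' = a' * b" using that by (simp add: eq_fract)
    define A B A' B' where defs: "A = Fract a 1" "B = Fract b 1" "A' = Fract a' 1" "B' = Fract b' 1"
    define u v u' v' where defs': "u = mpol_deriv d a" "v = mpol_deriv d b" "u' = mpol_deriv d a'" "v' = mpol_deriv d b'"
    have B: "B \<noteq> 0" "B' \<noteq> 0" using that nz by (auto simp: defs)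
    have 1: "A * B' = A' * B" unfolding defs using e by simp
    \<comment> \<open>The derivative of \<open>a * b' = a' * b\<close>; together with
      \<open>1\<close> it makes the quotient rule independent of the representative.\<close>
    have 2: "u * B' + A * v' = u' * B + A' * v"
      using arg_cong[OF e, of "mpol_deriv d"] by (simp add: mpol_deriv_mult defs defs')
    have "(u * B - A * v) * B' ^ 2 = (u * B') * B * B' - v * B' * (A * B')"
      by (simp add: algebra_simps power2_eq_square)
    also have "u * B' = u' * B + A' * v - A * v'" using 2 by (simp add: algebra_simps)
    also have "(u' * B + A' * v - A * v') * B * B' - v * B' * (A * B') = u' * B * B * B' + A' * v * B * B' - (A * B') * (v' * B + v * B')"
      by (simp add: algebra_simps)
    also have "\<dots> = (u' * B' - A' * v') * B ^ 2" unfolding 1 by (simp add: algebra_simps power2_eq_square)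
    finally have "(u * B - A * v) / B ^ 2 = (u' * B' - A' * v') / B' ^ 2"
      using B by (simp add: frac_eq_eq)
    then show ?thesis by (simp add: \<delta>_def defs defs')
  qed
  have D: "D (Fract a b) = \<delta> a b" if "b \<noteq> 0" for a b
  proof -
    obtain a' b' where ab: "(SOME (a', b'). b' \<noteq> 0 \<and> Fract a b = Fract a' b') = (a', b')" by fastforce
    have "case (SOME (a', b'). b' \<noteq> 0 \<and> Fract a b = Fract a' b') of (a', b') \<Rightarrow> b' \<noteq> 0 \<and> Fract a b = Fract a' b'"
      by (rule someI[of _ "(a, b)"]) (use that in simp)
    then have "b' \<noteq> 0" "Fract a b = Fract a' b'" by (simp_all add: ab)
    then show ?thesis unfolding D_def ab using wd[of b b' a a'] that by simp
  qed
  have add: "D (f + g) = D f + D g \<and> D (f * g) = D f * g + f * D g" for f g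
  proof -
    obtain a b where f: "f = Fract a b" "b \<noteq> 0" by (cases f) auto
    obtain a' b' where g: "g = Fract a' b'" "b' \<noteq> 0" by (cases g) auto
    define A B A' B' where defs: "A = Fract a 1" "B = Fract b 1" "A' = Fract a' 1" "B' = Fract b' 1"
    define u v u' v' where defs': "u = mpol_deriv d a" "v = mpol_deriv d b" "u' = mpol_deriv d a'" "v' = mpol_deriv d b'"
    have B: "B \<noteq> 0" "B' \<noteq> 0" using f g nz by (auto simp: defs)
    have nb: "b * b' \<noteq> 0" using f g by simp
    have prods: "Fract (x * y) 1 = Fract x 1 * Fract y 1" "Fract (x + y) 1 = Fract x 1 + Fract y 1"
      for x y :: "'a mpol" by simp_all
    have Dfg: "D f = (u * B - A * v) / B ^ 2" "D g = (u' * B' - A' * v') / B' ^ 2"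
      using f g by (simp_all add: D \<delta>_def defs defs')
    have fg: "f = A / B" "g = A' / B'" using f g fr by (simp_all only: defs)
    have "D (f + g) = \<delta> (a * b' + a' * b) (b * b')"
      using D[OF nb, of "a * b' + a' * b"] f g by simp
    also have "\<dots> = ((u * B' + A * v' + (u' * B + A' * v)) * (B * B') - (A * B' + A' * B) * (v * B' + B * v')) / (B * B') ^ 2"
      unfolding \<delta>_def mpol_deriv_add mpol_deriv_mult prods by (simp only: defs defs')
    also have "\<dots> = (u * B - A * v) / B ^ 2 + (u' * B' - A' * v') / B' ^ 2"
      using B by (simp add: divide_simps) (simp add: algebra_simps power2_eq_square)
    also have "\<dots> = D f + D g" by (simp only: Dfg)
    finally have 1: "D (f + g) = D f + D g" .
    have "D (f * g) = \<delta> (a * a') (b * b')"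
      using D[OF nb, of "a * a'"] f g by simp
    also have "\<dots> = ((u * A' + A * u') * (B * B') - (A * A') * (v * B' + B * v')) / (B * B') ^ 2"
      unfolding \<delta>_def mpol_deriv_mult prods by (simp only: defs defs')
    also have "\<dots> = (u * B - A * v) / B ^ 2 * (A' / B') + (A / B) * ((u' * B' - A' * v') / B' ^ 2)"
      using B by (simp add: divide_simps) (simp add: algebra_simps power2_eq_square)
    also have "\<dots> = D f * g + f * D g" unfolding Dfg by (simp only: fg)
    finally show ?thesis using 1 by blast
  qed
  have 0: "log_deriv d 0 = 0" by (simp add: log_deriv_def)
  have F1: "Fract (1 :: 'a mpol) 1 = 1" by (simp add: One_fract_def)
  have d1: "mpol_deriv d 1 = 0"
    using mpol_deriv_single[of d 0 1] by (simp add: 0)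
  have "D (rconst c) = 0" for c
    unfolding rconst_def by (simp add: D \<delta>_def mpol_deriv_single 0 d1)
  moreover have "D (rvar j) = d j * rvar j" for j
    unfolding rvar_def
    by (simp add: D \<delta>_def mpol_deriv_single d1 F1 mon_val_def log_deriv_def mult.commute)
  ultimately show ?thesis using add by (intro exI[of _ D]) (auto simp: is_deriv_def)
qed

lemma rvar_nonzero [simp]: "rvar j \<noteq> 0"
proof
  assume "rvar j = (0 :: 'a ratfun)"
  then have "Poly_Mapping.single (Poly_Mapping.single j (1::nat)) (1::'a) = 0"
    by (simp add: rvar_def Zero_fract_def eq_fract del: One_nat_def)
  then show False by (metis lookup_single_eq lookup_zero zero_neq_one)
qed

text \<open>This is the operator \<open>x_j d/dx_j\<close>, in the logarithmic form of
  \<open>exists_deriv\<close>.\<close>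

definition coord_deriv :: "nat \<Rightarrow> 'a::field ratfun \<Rightarrow> 'a ratfun" where
  "coord_deriv j = (SOME D. is_deriv D \<and> (\<forall>c. D (rconst c) = 0) \<and>
     (\<forall>i. D (rvar i) = (if i = j then 1 else 0) * rvar i))"

lemma coord_deriv:
  fixes c :: "'a::field"
  shows "is_deriv (coord_deriv j :: 'a ratfun \<Rightarrow> 'a ratfun)" "coord_deriv j (rconst c) = 0"
    "coord_deriv j (rvar i :: 'a ratfun) = (if i = j then rvar i else 0)"
  using someI_ex[OF exists_deriv[of "\<lambda>i. if i = j then 1 else 0 :: 'a ratfun"]]
  unfolding coord_deriv_def[symmetric] by simp_all

text \<open>Linear algebra replaces the transcendence degree: leaving out a dependent
  \<open>y v\<close> leaves room for a nonzero derivation that kills all \<open>y i\<close>.\<close>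

lemma alg_indepI:
  fixes y :: "nat \<Rightarrow> 'a::field_char_0 ratfun"
  assumes alg: "\<And>j. j \<in> {1..n} \<Longrightarrow> algebraic_over (field_gen (range rconst \<union> y ` {1..n})) (rvar j)"
  shows "alg_indep rconst n y"
  unfolding alg_indep_def
proof (intro allI impI)
  fix P :: "'a mpol"
  assume vars: "mpol_vars P \<subseteq> {1..n}" and eval: "mpol_eval rconst y P = 0"
  show "P = 0"
  proof (rule ccontr)
    assume "P \<noteq> 0"
    then obtain m0 where m0: "m0 \<in> Poly_Mapping.keys P" by (metis all_not_in_conv keys_eq_empty)
    have keys: "Poly_Mapping.keys m \<subseteq> {1..n}" if "m \<in> Poly_Mapping.keys P" for m
      using vars that by (auto simp: mpol_vars_def)
    have prod: "(\<Prod>i\<in>Poly_Mapping.keys m. y i ^ Poly_Mapping.lookup m i) = (\<Prod>i\<in>{1..n}. y i ^ Poly_Mapping.lookup m i)"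
      if "m \<in> Poly_Mapping.keys P" for m
      by (rule prod.mono_neutral_left) (use keys[OF that] in \<open>auto simp: in_keys_iff\<close>)
    have "\<exists>v\<in>{1..n}. algebraic_over (field_gen (range rconst \<union> y ` ({1..n} - {v}))) (y v)"
    proof (rule dependent_algebraic[of _ "Poly_Mapping.keys P" "\<lambda>m. rconst (Poly_Mapping.lookup P m)" _ m0
          "Poly_Mapping.lookup"])
      show "(\<Sum>m\<in>Poly_Mapping.keys P. rconst (Poly_Mapping.lookup P m) * (\<Prod>i\<in>{1..n}. y i ^ Poly_Mapping.lookup m i)) = 0"
        unfolding eval[unfolded mpol_eval_def, symmetric] by (intro sum.cong refl) (simp only: prod)
      show "rconst (Poly_Mapping.lookup P m0) \<noteq> 0"
        using m0 by (simp add: in_keys_iff)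
      show "m = m'" if "m \<in> Poly_Mapping.keys P" "m' \<in> Poly_Mapping.keys P"
        "\<forall>i\<in>{1..n}. Poly_Mapping.lookup m i = Poly_Mapping.lookup m' i" for m m'
      proof (rule poly_mapping_eqI)
        fix i
        show "Poly_Mapping.lookup m i = Poly_Mapping.lookup m' i"
        proof (cases "i \<in> {1..n}")
          case False
          then have "i \<notin> Poly_Mapping.keys m" "i \<notin> Poly_Mapping.keys m'"
            using keys[OF that(1)] keys[OF that(2)] by blast+
          then show ?thesis by (simp add: in_keys_iff)
        qed (use that(3) in blast)
      qed
    qed (simp_all add: m0)
    then obtain v where v: "v \<in> {1..n}" "algebraic_over (field_gen (range rconst \<union> y ` ({1..n} - {v}))) (y v)"
      by blast
    \<comment> \<open>The \<open>n - 1\<close> remaining elements impose \<open>n - 1\<close> linear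
      conditions on the \<open>n\<close> unknown coefficients \<open>d j\<close> of the
      derivation.\<close>
    have "card ({1..n} - {v}) < card {1..n}" by (rule card_Diff1_less) (use v(1) in simp_all)
    note system = homogeneous_system[OF _ _ this, where A = "\<lambda>i j. coord_deriv j (y i)"]
    obtain d where d: "\<exists>j\<in>{1..n}. d j \<noteq> 0"
      "\<And>i. i \<in> {1..n} - {v} \<Longrightarrow> (\<Sum>j\<in>{1..n}. coord_deriv j (y i) * d j) = 0"
      using system[OF finite_Diff[OF finite_atLeastAtMost] finite_atLeastAtMost] by blast
    define D where "D f = (\<Sum>j\<in>{1..n}. coord_deriv j f * d j)" for f
    have D: "is_deriv D" unfolding is_deriv_def D_def
      by (auto simp: is_derivD(1,2)[OF coord_deriv(1)] sum_distrib_left sum_distrib_right distrib_left distrib_right mult_ac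
          simp flip: sum.distrib intro!: sum.cong)
    note ker = is_subfield_deriv_kernel[OF D]
    have Dc: "D (rconst c) = 0" for c by (simp add: D_def coord_deriv)
    have Dv: "D (rvar j) = d j * rvar j" if "j \<in> {1..n}" for j
    proof -
      have "coord_deriv i (rvar j) * d i = (if i = j then d j * rvar j else 0)" for i by (simp add: coord_deriv)
      then show ?thesis using that by (simp add: D_def)
    qed
    have Dy: "D (y i) = 0" if "i \<in> {1..n} - {v}" for i using d(2)[OF that] by (simp add: D_def)
    have "field_gen (range rconst \<union> y ` ({1..n} - {v})) \<subseteq> {a. D a = 0}"
      by (rule field_gen_least[OF ker]) (use Dc Dy in auto)
    then have "D (y v) = 0" using deriv_algebraic_over[OF D _ v(2)] by blast
    then have "D (y i) = 0" if "i \<in> {1..n}" for i using Dy[of i] that by (cases "i = v") auto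
    then have "field_gen (range rconst \<union> y ` {1..n}) \<subseteq> {a. D a = 0}"
      by (intro field_gen_least[OF ker]) (use Dc in auto)
    then have "D (rvar j) = 0" if "j \<in> {1..n}" for j
      using deriv_algebraic_over[OF D _ alg[OF that]] by blast
    \<comment> \<open>\<open>D\<close> multiplies \<open>x_j\<close> by \<open>d j\<close>, and some
      \<open>d j\<close> is nonzero.\<close>
    then show False using d(1) Dv by auto
  qed
qed

text \<open>\<open>coord_deriv j\<close> isolates the \<open>j\<close>-th term, which is
  nonzero.\<close>

lemma linear_form_nonzero:
  fixes a :: "nat \<Rightarrow> 'a::field"
  assumes "finite A" "j \<in> A" "a j \<noteq> 0"
  shows "(\<Sum>i\<in>A. rconst (a i) * rvar i) \<noteq> 0"
proof
  assume z: "(\<Sum>i\<in>A. rconst (a i) * rvar i) = 0"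
  have "0 = coord_deriv j (\<Sum>i\<in>A. rconst (a i) * rvar i)" by (simp add: z is_derivD(3)[OF coord_deriv(1)])
  also have "\<dots> = (\<Sum>i\<in>A. if i = j then rconst (a i) * rvar i else 0)"
    unfolding is_derivD(6)[OF coord_deriv(1)]
    by (intro sum.cong) (auto simp: is_derivD(2)[OF coord_deriv(1)] coord_deriv)
  also have "\<dots> = rconst (a j) * rvar j" using assms by (simp add: sum.delta')
  finally show False using assms(3) by simp
qed

section \<open>Exchanging the parameters of a split cyclic algebra\<close>

context root_of_unity
begin

lemma sum_zeta_orbit: "(\<Sum>i<p. f (\<zeta> ^ i * (\<zeta> * z))) = (\<Sum>i<p. f (\<zeta> ^ i * z))"
  for f :: "'b \<Rightarrow> 'c::comm_monoid_add"
proof -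
  have "(\<Sum>i<p. f (\<zeta> ^ i * (\<zeta> * z))) = (\<Sum>i<p. f (\<zeta> ^ (Suc i mod p) * z))"
    by (simp only: zeta_power_mod) (simp add: mult_ac)
  also have "\<dots> = (\<Sum>i<p. f (\<zeta> ^ i * z))"
    by (rule sum_shift_mod[where f = "\<lambda>i. f (\<zeta> ^ i * z)"])
  finally show ?thesis .
qed

lemma prod_zeta_orbit: "(\<Prod>i<p. f (\<zeta> ^ Suc i * z)) = (\<Prod>i<p. f (\<zeta> ^ i * z))"
  for f :: "'b \<Rightarrow> 'c::comm_monoid_mult"
proof -
  have "(\<Prod>i<p. f (\<zeta> ^ Suc i * z)) = (\<Prod>i<p. f (\<zeta> ^ (Suc i mod p) * z))"
    by (simp only: zeta_power_mod)
  also have "\<dots> = (\<Prod>i<p. f (\<zeta> ^ i * z))"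
    by (rule prod_shift_mod[where f = "\<lambda>i. f (\<zeta> ^ i * z)"])
  finally show ?thesis .
qed

end

text \<open>
  Let \<open>\<tau>\<close> be the automorphism with \<open>\<tau> e = \<zeta> e\<close> and \<open>\<tau> (L c) = L (c + 1)\<close>. The operators
  \<open>X = L 0 \<cdot> \<tau>\<close> and \<open>Y = e\<close> satisfy \<open>X Y = \<zeta> Y X\<close> and \<open>X\<^sup>p = \<theta>\<^sup>p\<close>, \<open>Y\<^sup>p = e\<^sup>p\<close>. Expanding \<open>Y 1\<close> in the
  basis \<open>X\<^sup>j 1\<close> exchanges the roles of \<open>X\<close> and \<open>Y\<close>: the coefficients \<open>swap_coeff j\<close> and \<open>\<theta>\<^sup>p\<close>
  determine \<open>e\<^sup>p\<close> and the coefficients of \<open>X 1 = L 0\<close> in the basis \<open>Y\<^sup>j 1 = e\<^sup>j\<close>. The component of \<open>1\<close> in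
  the eigenspace of \<open>X\<close> for the eigenvalue \<open>z\<close> is \<open>eigen z\<close>.
\<close>

locale kummer_swap = root_of_unity \<zeta> p for \<zeta> :: "'b::field_char_0" and p +
  fixes L :: "nat \<Rightarrow> 'b" and e \<theta> :: 'b and \<sigma> :: "'b \<Rightarrow> 'b"
  assumes e_neq_0: "e \<noteq> 0" and theta_neq_0 [simp]: "\<theta> \<noteq> 0" and theta_power: "\<theta> ^ p = (\<Prod>c<p. L c)"
    and sigma_endo: "is_endo \<sigma>" and sigma_zeta: "\<sigma> \<zeta> = \<zeta>" and sigma_theta: "\<sigma> \<theta> = \<zeta> * \<theta>"
    and sigma_L: "\<And>c. c < p \<Longrightarrow> \<sigma> (L c) = L c"
begin

text \<open>This is \<open>X\<^sup>j 1\<close>, since \<open>X\<close> shifts the factors and then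
  multiplies by \<open>L 0\<close>.\<close>

definition part :: "nat \<Rightarrow> 'b" where "part j = (\<Prod>c<j. L c)"

definition eigen :: "'b \<Rightarrow> 'b" where "eigen z = (\<Sum>j<p. part j / z ^ j) / of_nat p"

text \<open>By \<open>X Y = \<zeta> Y X\<close>, the operator \<open>Y\<close> sends the eigenspace
  for \<open>z / \<zeta>\<close> to the one for \<open>z\<close>; \<open>mu z\<close> is the factor
  by which \<open>Y (eigen (z / \<zeta>))\<close> differs from \<open>eigen z\<close>.\<close>

definition mu :: "'b \<Rightarrow> 'b" where "mu z = e * eigen (z / \<zeta>) / eigen z"

text \<open>Fourier inversion of \<open>mu\<close> over the eigenvalues
  \<open>\<zeta> ^ i * \<theta>\<close>. These are the coefficients of \<open>Y 1\<close> in the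
  basis \<open>X\<^sup>j 1\<close>.\<close>

definition swap_coeff :: "nat \<Rightarrow> 'b" where
  "swap_coeff j = (\<Sum>i<p. mu (\<zeta> ^ i * \<theta>) / (\<zeta> ^ i * \<theta>) ^ j) / of_nat p"

section \<open>Eigenvectors of the operator \<open>X\<close>\<close>

lemma L_neq_0: "c < p \<Longrightarrow> L c \<noteq> 0"
  using theta_power theta_neq_0 by (metis finite_lessThan lessThan_iff power_not_zero prod_zero_iff)

lemma part_neq_0: "j \<le> p \<Longrightarrow> part j \<noteq> 0"
  by (auto simp: part_def L_neq_0)

lemma endo_part: "is_endo h \<Longrightarrow> (\<And>c. c < p \<Longrightarrow> h (L c) = L c) \<Longrightarrow> j \<le> p \<Longrightarrow> h (part j) = part j"
  by (auto simp: part_def is_endoD intro!: prod.cong)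

lemma endo_eigen: "is_endo h \<Longrightarrow> (\<And>c. c < p \<Longrightarrow> h (L c) = L c) \<Longrightarrow> h (eigen z) = eigen (h z)"
  by (auto simp: eigen_def is_endoD endo_part intro!: sum.cong)

text \<open>This is \<open>X\<^sup>j\<close> applied to the decomposition of 1 into eigenvectors;
  for \<open>j = 0\<close> it says that they sum to 1.\<close>

lemma part_eq_sum_eigen:
  assumes "j < p"
  shows "(\<Sum>i<p. (\<zeta> ^ i * \<theta>) ^ j * eigen (\<zeta> ^ i * \<theta>)) = part j"
proof -
  have "(\<Sum>i<p. (\<zeta> ^ i * \<theta>) ^ j * eigen (\<zeta> ^ i * \<theta>)) =
      (\<Sum>i<p. \<Sum>k<p. part k * \<theta> ^ j / \<theta> ^ k / of_nat p * (\<zeta> ^ (i * j) / \<zeta> ^ (i * k)))"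
    by (simp add: eigen_def sum_divide_distrib sum_distrib_left power_mult_distrib power_mult mult_ac)
  also have "\<dots> = (\<Sum>k<p. part k * \<theta> ^ j / \<theta> ^ k / of_nat p * (\<Sum>i<p. \<zeta> ^ (i * j) / \<zeta> ^ (i * k)))"
    by (subst sum.swap) (simp add: sum_distrib_left)
  also have "\<dots> = (\<Sum>k<p. if k = j then part k else 0)"
    by (rule sum.cong) (use assms in \<open>auto simp: sum_zeta_quotient\<close>)
  finally show ?thesis using assms by simp
qed

lemma sigma_eigen: "\<sigma> (eigen (\<zeta> ^ i * \<theta>)) = eigen (\<zeta> ^ Suc i * \<theta>)"
  by (simp add: endo_eigen[OF sigma_endo sigma_L] is_endoD[OF sigma_endo] sigma_zeta sigma_theta mult_ac)

text \<open>\<open>\<sigma>\<close> carries each eigenvector to the next, so if one vanished, all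
  would, although they sum to 1.\<close>

lemma eigen_neq_0: "eigen (\<zeta> ^ i * \<theta>) \<noteq> 0"
proof -
  have eq0: "eigen (\<zeta> ^ i * \<theta>) = 0 \<longleftrightarrow> eigen \<theta> = 0" for i
  proof (induction i)
    case (Suc i)
    then show ?case using sigma_eigen[of i] is_endoD(13)[OF sigma_endo, of "eigen (\<zeta> ^ i * \<theta>)"] by simp
  qed simp
  have "(\<Sum>i<p. eigen (\<zeta> ^ i * \<theta>)) = 1"
    using part_eq_sum_eigen[of 0] by (simp add: part_def)
  then show ?thesis using eq0 by (metis sum.neutral zero_neq_one)
qed

lemma e_times_eigen: "e * eigen (\<zeta> ^ i * \<theta>) = mu (\<zeta> ^ Suc i * \<theta>) * eigen (\<zeta> ^ Suc i * \<theta>)"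
  using eigen_neq_0[of "Suc i"] by (simp add: mu_def mult_ac)

lemma mu_neq_0: "mu (\<zeta> ^ i * \<theta>) \<noteq> 0"
proof -
  \<comment> \<open>Adding \<open>p\<close> to the index writes it as a successor, the form in which
    \<open>e_times_eigen\<close> applies, also for \<open>i = 0\<close>.\<close>
  have "mu (\<zeta> ^ Suc (i + (p - 1)) * \<theta>) \<noteq> 0"
    using e_times_eigen[of "i + (p - 1)"] eigen_neq_0[of "i + (p - 1)"] e_neq_0 by auto
  moreover have "Suc (i + (p - 1)) = i + p" using p_gt_0 by simp
  ultimately show ?thesis by (simp add: power_add zeta_power_p)
qed

lemma mu_eq_sum:
  assumes "i < p"
  shows "mu (\<zeta> ^ i * \<theta>) = (\<Sum>j<p. swap_coeff j * (\<zeta> ^ i * \<theta>) ^ j)"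
proof -
  have "swap_coeff j = fourier (\<lambda>i. mu (\<zeta> ^ i * \<theta>)) j / \<theta> ^ j / of_nat p" for j
    by (simp add: fourier_def swap_coeff_def power_mult_distrib power_mult sum_divide_distrib)
  then have "fourier (\<lambda>i. mu (\<zeta> ^ i * \<theta>)) j = swap_coeff j * \<theta> ^ j * of_nat p" for j by simp
  then have "mu (\<zeta> ^ i * \<theta>) = (\<Sum>j<p. \<zeta> ^ (i * j) * (swap_coeff j * \<theta> ^ j * of_nat p)) / of_nat p"
    using fourier_inversion[OF assms, of "\<lambda>i. mu (\<zeta> ^ i * \<theta>)"] by simp
  also have "\<dots> = (\<Sum>j<p. swap_coeff j * (\<zeta> ^ i * \<theta>) ^ j)"
    unfolding sum_divide_distrib by (intro sum.cong) (simp_all add: power_mult_distrib mult_ac flip: power_mult)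
  finally show ?thesis .
qed

text \<open>Multiplying \<open>e_times_eigen\<close> around the full cycle cancels the eigenvectors.
  Thus \<open>e ^ p\<close> is a norm in \<open>\<theta>\<close>, just as
  \<open>\<theta> ^ p\<close> is a norm in \<open>e\<close>.\<close>

lemma e_power: "e ^ p = (\<Prod>i<p. mu (\<zeta> ^ i * \<theta>))"
proof -
  let ?v = "\<Prod>i<p. eigen (\<zeta> ^ i * \<theta>)"
  have "e ^ p * ?v = (\<Prod>i<p. e * eigen (\<zeta> ^ i * \<theta>))" by (simp add: prod.distrib)
  also have "\<dots> = (\<Prod>i<p. mu (\<zeta> ^ Suc i * \<theta>)) * (\<Prod>i<p. eigen (\<zeta> ^ Suc i * \<theta>))"
    by (simp only: e_times_eigen prod.distrib)
  also have "\<dots> = (\<Prod>i<p. mu (\<zeta> ^ i * \<theta>)) * ?v" by (simp only: prod_zeta_orbit)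
  finally show ?thesis using eigen_neq_0 by simp
qed

section \<open>Recovering the old parameters from the new ones\<close>

context
  fixes K assumes K: "is_subfield K" "\<zeta> \<in> K" "\<theta> \<in> K" "\<And>j. j < p \<Longrightarrow> swap_coeff j \<in> K"
begin

lemma mu_in: "mu (\<zeta> ^ i * \<theta>) \<in> K"
proof -
  have "mu (\<zeta> ^ (i mod p) * \<theta>) \<in> K"
    unfolding mu_eq_sum[OF mod_less_divisor[OF p_gt_0]] using K
    by (intro is_subfield_sum is_subfieldD(6,9)) auto
  then show ?thesis by (simp add: zeta_power_mod)
qed

lemma e_power_in: "e ^ p \<in> K"
  unfolding e_power using K(1) mu_in by (intro is_subfield_prod) auto

text \<open>The inverse direction of the exchange: \<open>e\<close> and the values of
  \<open>mu\<close> produce all eigenvectors from one, and these produce the products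
  \<open>part j\<close>.\<close>

lemma L_in:
  assumes "e \<in> K" "c < p"
  shows "L c \<in> K"
proof -
  have "\<exists>w. \<forall>i. w i \<in> K \<and> eigen (\<zeta> ^ i * \<theta>) = w i * eigen \<theta>"
  proof (intro choice allI)
    show "\<exists>w. w \<in> K \<and> eigen (\<zeta> ^ i * \<theta>) = w * eigen \<theta>" for i
    proof (induction i)
      case 0
      show ?case using is_subfieldD(1)[OF K(1)] by (intro exI[of _ 1]) simp
    next
      case (Suc i)
      then obtain w where w: "w \<in> K" "eigen (\<zeta> ^ i * \<theta>) = w * eigen \<theta>" by blast
      have "eigen (\<zeta> ^ Suc i * \<theta>) = e * eigen (\<zeta> ^ i * \<theta>) / mu (\<zeta> ^ Suc i * \<theta>)"
        unfolding e_times_eigen using mu_neq_0[of "Suc i"] by (simp add: field_simps)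
      also have "\<dots> = e * w / mu (\<zeta> ^ Suc i * \<theta>) * eigen \<theta>" by (simp add: w)
      finally show ?case using w assms mu_in K(1)
        by (intro exI[of _ "e * w / mu (\<zeta> ^ Suc i * \<theta>)"] conjI is_subfieldD(6,8))
    qed
  qed
  then obtain w where w: "\<And>i. w i \<in> K" "\<And>i. eigen (\<zeta> ^ i * \<theta>) = w i * eigen \<theta>" by blast
  \<comment> \<open>Every eigenvector is known up to the common factor
    \<open>eigen \<theta>\<close>; their sum being 1 determines this factor.\<close>
  have "(\<Sum>i<p. w i) * eigen \<theta> = 1"
    using part_eq_sum_eigen[of 0] by (simp add: part_def w sum_distrib_right)
  then have "eigen \<theta> = inverse (\<Sum>i<p. w i)"
    by (metis inverse_unique mult.commute)
  then have "eigen \<theta> \<in> K" using K(1) w by (auto intro!: is_subfieldD(4) is_subfield_sum)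
  then have ev: "eigen (\<zeta> ^ i * \<theta>) \<in> K" for i
    unfolding w by (intro is_subfieldD(6)[OF K(1)] w)
  have part_in: "part j \<in> K" if "j < p" for j
    unfolding part_eq_sum_eigen[OF that, symmetric] using K ev
    by (intro is_subfield_sum is_subfieldD(6,9)) auto
  \<comment> \<open>The case \<open>j = p\<close> lies outside \<open>part_eq_sum_eigen\<close> and
    comes from \<open>theta_power\<close>.\<close>
  have pp: "part p = \<theta> ^ p" by (simp add: part_def theta_power)
  have part_in: "part j \<in> K" if "j \<le> p" for j
    using part_in[of j] is_subfieldD(9)[OF K(1,3), of p] pp that by (cases "j = p") auto
  have "L c = part (Suc c) / part c" using part_neq_0[of c] assms by (simp add: part_def)
  then show ?thesis using part_in assms by (auto intro!: is_subfieldD(8)[OF K(1)])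
qed

end

text \<open>The defining sum runs over the whole orbit of \<open>\<theta>\<close> under
  multiplication by \<open>\<zeta>\<close>, so a factor \<open>\<zeta>\<close> in
  \<open>h \<theta>\<close> only permutes its terms.\<close>

lemma swap_coeff_fixed:
  assumes h: "is_endo h" "h \<zeta> = \<zeta>" "h e = e" "\<And>c. c < p \<Longrightarrow> h (L c) = L c"
    and "h \<theta> = \<theta> \<or> h \<theta> = \<zeta> * \<theta>"
  shows "h (swap_coeff j) = swap_coeff j"
proof -
  have mu: "h (mu z) = mu (h z)" for z
    using h by (simp add: mu_def is_endoD endo_eigen)
  have "h (swap_coeff j) = (\<Sum>i<p. mu (\<zeta> ^ i * h \<theta>) / (\<zeta> ^ i * h \<theta>) ^ j) / of_nat p"
    using h by (simp add: swap_coeff_def is_endoD mu)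
  also have "\<dots> = swap_coeff j"
    using assms(5) sum_zeta_orbit[of "\<lambda>z. mu z / z ^ j" \<theta>] by (auto simp: swap_coeff_def)
  finally show ?thesis .
qed

text \<open>Here \<open>h\<close> is the shift \<open>\<tau>\<close>. It changes
  \<open>eigen z\<close> by the factor \<open>z / L 0\<close> and \<open>eigen (z / \<zeta>)\<close>
  by \<open>z / (\<zeta> * L 0)\<close>; in \<open>mu z\<close> the quotient of these factors
  cancels the \<open>\<zeta>\<close> coming from \<open>h e\<close>.\<close>

lemma swap_coeff_shift:
  assumes h: "is_endo h" "h \<zeta> = \<zeta>" "h \<theta> = \<theta>" "h e = \<zeta> * e" "\<And>c. c < p \<Longrightarrow> h (L c) = L (Suc c mod p)"
  shows "h (swap_coeff j) = swap_coeff j"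
proof -
  \<comment> \<open>\<open>eigen z\<close> is an eigenvector of \<open>X\<close> for the eigenvalue
    \<open>z\<close>.\<close>
  have eig: "L 0 * h (eigen z) = z * eigen z" if z: "h z = z" "z ^ p = \<theta> ^ p" for z
  proof -
    have z0: "z \<noteq> 0" using z by (auto simp: power_0_left)
    have hp: "L 0 * h (part j) = part (Suc j)" if "j < p" for j
    proof -
      have "h (part j) = (\<Prod>c<j. L (Suc c))"
        unfolding part_def is_endoD(12)[OF h(1)] using h that by (intro prod.cong) auto
      then show ?thesis by (simp only: part_def prod.lessThan_Suc_shift)
    qed
    have "L 0 * h (eigen z) = (\<Sum>j<p. L 0 * h (part j) / z ^ j) / of_nat p"
      using h z by (simp add: eigen_def is_endoD sum_distrib_left)
    also have "\<dots> = (\<Sum>j<p. z * (part (Suc j) / z ^ Suc j)) / of_nat p"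
      using z0 by (intro arg_cong[where f = "\<lambda>x. x / of_nat p"] sum.cong) (simp_all add: hp)
    also have "\<dots> = z * ((\<Sum>j<p. part (Suc j) / z ^ Suc j) / of_nat p)"
      by (simp only: sum_distrib_left times_divide_eq_right)
    also have "(\<Sum>j<p. part (Suc j) / z ^ Suc j) = (\<Sum>j<p. part j / z ^ j)"
    proof -
      \<comment> \<open>The index shift trades the first term for the one at \<open>p\<close>; both
        equal 1, the latter because \<open>z ^ p = \<theta> ^ p\<close>.\<close>
      have "(\<Sum>j<p. part (Suc j) / z ^ Suc j) + part 0 / z ^ 0 = (\<Sum>j<p. part j / z ^ j) + part p / z ^ p"
        using sum.lessThan_Suc_shift[of "\<lambda>j. part j / z ^ j" p] by (simp add: add.commute)
      moreover have "part p / z ^ p = 1" "part 0 / z ^ 0 = 1"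
        by (simp_all add: part_def z(2) flip: theta_power)
      ultimately show ?thesis by simp
    qed
    finally show ?thesis by (simp add: eigen_def)
  qed
  have mu: "h (mu z) = mu z" if z: "h z = z" "z ^ p = \<theta> ^ p" for z
  proof -
    have z': "h (z / \<zeta>) = z / \<zeta>" "(z / \<zeta>) ^ p = \<theta> ^ p"
      using z h by (simp_all add: is_endoD power_divide zeta_power_p)
    have z0: "z \<noteq> 0" using z by (auto simp: power_0_left)
    have L0: "L 0 \<noteq> 0" by (simp add: L_neq_0)
    have "h (eigen z) = z * eigen z / L 0" "h (eigen (z / \<zeta>)) = z / \<zeta> * eigen (z / \<zeta>) / L 0"
      using eig[OF z] eig[OF z'] L0 by (simp_all add: field_simps)
    then have "h (mu z) = \<zeta> * e * (z / \<zeta> * eigen (z / \<zeta>) / L 0) / (z * eigen z / L 0)"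
      using h by (simp add: mu_def is_endoD)
    then show ?thesis using L0 z0 by (simp add: mu_def)
  qed
  have "h (mu (\<zeta> ^ i * \<theta>)) = mu (\<zeta> ^ i * \<theta>)" for i
  proof (rule mu)
    show "h (\<zeta> ^ i * \<theta>) = \<zeta> ^ i * \<theta>" using h by (simp add: is_endoD)
    show "(\<zeta> ^ i * \<theta>) ^ p = \<theta> ^ p"
      by (simp add: power_mult_distrib zeta_power_eq_1_iff flip: power_mult)
  qed
  then show ?thesis using h by (simp add: swap_coeff_def is_endoD)
qed

end

section \<open>Invariants of permutation actions\<close>

lemma is_endo_perm_act: "inj g \<Longrightarrow> is_endo (perm_act g)"
  using perm_act_rconst[of g 1] by (simp add: is_endo_def perm_act_add perm_act_mult)

lemma mon_rename_single: "mon_rename g (Poly_Mapping.single j k) = Poly_Mapping.single (g j) k"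
  by (cases "k = 0") (simp_all add: mon_rename_def)

lemma mon_rename_sum: "mon_rename g (\<Sum>i\<in>A. f i) = (\<Sum>i\<in>A. mon_rename g (f i))"
proof (induction A rule: infinite_finite_induct)
  case (insert x F)
  then show ?case by (simp add: mon_rename_add)
qed (simp_all add: mon_rename_def)

lemma mon_rename_comp: "mon_rename g (mon_rename h m) = mon_rename (g \<circ> h) m"
  by (simp add: mon_rename_def[of h] mon_rename_def[of "g \<circ> h"] mon_rename_sum mon_rename_single)

lemma mpol_rename_comp: "mpol_rename g (mpol_rename h P) = mpol_rename (g \<circ> h) P"
  by (simp add: mpol_rename_def[of h] mpol_rename_def[of "g \<circ> h"] mpol_rename_sum mpol_rename_single mon_rename_comp)

lemma perm_act_comp: "inj g \<Longrightarrow> inj h \<Longrightarrow> perm_act g (perm_act h f) = perm_act (g \<circ> h) f"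
  by (cases f) (simp add: perm_act_Fract mpol_rename_eq_0_iff mpol_rename_comp inj_compose)

lemma mon_rename_id: "mon_rename id m = m"
  by (rule poly_mapping_eqI) (use lookup_mon_rename[of id m] in simp)

lemma perm_act_id: "perm_act id f = f"
proof -
  have "mpol_rename id P = P" for P :: "'a mpol"
    by (simp add: mpol_rename_def mon_rename_id flip: mpol_expand)
  then show ?thesis by (cases f) (simp add: perm_act_Fract)
qed

lemma is_subfield_eq_set: "is_endo h \<Longrightarrow> is_endo h' \<Longrightarrow> is_subfield {a. h a = h' a}"
  by (simp add: is_subfield_def is_endoD)

lemma endo_field_gen:
  assumes "is_endo h" "f \<in> field_gen S"
  shows "h f \<in> field_gen (h ` S)"
  using assms(2)
proof (induction rule: field_gen_induct)
  case (incl a)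
  then show ?case using field_gen_superset[of "h ` S"] by blast
qed (simp_all add: is_endoD[OF assms(1)] is_subfieldD[OF is_subfield_field_gen])

lemma is_subfield_image: "is_endo h \<Longrightarrow> is_subfield K \<Longrightarrow> is_subfield (h ` K)"
proof -
  assume h: "is_endo h" and K: "is_subfield K"
  have "1 \<in> h ` K" using is_subfieldD(1)[OF K] is_endoD(1)[OF h] by force
  moreover have "- h a \<in> h ` K" "inverse (h a) \<in> h ` K" "h a + h b \<in> h ` K" "h a * h b \<in> h ` K"
    if "a \<in> K" "b \<in> K" for a b
    using that K by (auto simp flip: is_endoD[OF h] intro!: imageI is_subfieldD)
  ultimately show ?thesis unfolding is_subfield_def by blast
qed

section \<open>Subfields generated by some of the variables\<close>

definition varfield :: "nat set \<Rightarrow> 'a::field ratfun set" where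
  "varfield V = field_gen (range rconst \<union> rvar ` V)"

lemma ratfun_field_eq_varfield: "ratfun_field n = varfield {1..n}"
  by (simp add: ratfun_field_def varfield_def)

lemma is_subfield_varfield: "is_subfield (varfield V)"
  by (simp add: varfield_def is_subfield_field_gen)

lemma rconst_in_varfield: "rconst c \<in> varfield V"
  and rvar_in_varfield: "j \<in> V \<Longrightarrow> rvar j \<in> varfield V"
  using field_gen_superset[of "range rconst \<union> rvar ` V"] by (auto simp: varfield_def)

lemma varfield_mono: "V \<subseteq> W \<Longrightarrow> varfield V \<subseteq> varfield W"
  unfolding varfield_def by (rule field_gen_mono) auto

lemma perm_act_cong:
  assumes "inj g" "inj h" "\<And>j. j \<in> V \<Longrightarrow> g j = h j" "f \<in> varfield V"
  shows "perm_act g f = perm_act h f"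
proof -
  have "varfield V \<subseteq> {f. perm_act g f = perm_act h f}"
    unfolding varfield_def using assms
    by (intro field_gen_least is_subfield_eq_set is_endo_perm_act)
      (auto simp: perm_act_rconst perm_act_rvar)
  then show ?thesis using assms by blast
qed

lemma perm_act_fixes_varfield:
  assumes "inj g" "\<And>j. j \<in> V \<Longrightarrow> g j = j" "f \<in> varfield V"
  shows "perm_act g f = f"
  using perm_act_cong[of g id V f] assms perm_act_id[of f] by simp

lemma perm_act_varfield:
  assumes "inj g" "f \<in> varfield V"
  shows "perm_act g f \<in> varfield (g ` V)"
proof -
  have "perm_act g ` (range rconst \<union> rvar ` V) \<subseteq> range rconst \<union> rvar ` g ` V"
    using assms by (auto simp: perm_act_rconst perm_act_rvar)
  then show ?thesis
    using endo_field_gen[OF is_endo_perm_act[OF assms(1)], of f] assms(2) field_gen_mono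
    unfolding varfield_def by blast
qed

section \<open>Generating sets of invariants\<close>

definition fixed_by :: "(nat \<Rightarrow> nat) set \<Rightarrow> 'a::field ratfun set" where
  "fixed_by G = {f. \<forall>g\<in>G. perm_act g f = f}"

lemma is_subfield_fixed_by: "G \<subseteq> {g. inj g} \<Longrightarrow> is_subfield (fixed_by G)"
  unfolding is_subfield_def fixed_by_def by (auto simp: is_endoD[OF is_endo_perm_act] subset_iff)

lemma rconst_fixed_by: "G \<subseteq> {g. inj g} \<Longrightarrow> range rconst \<subseteq> fixed_by G"
  by (auto simp: fixed_by_def perm_act_rconst subset_iff)

lemma fixed_by_Un: "fixed_by (G \<union> H) = fixed_by G \<inter> fixed_by H"
  by (auto simp: fixed_by_def)

text \<open>The base field \<open>B\<close> is arbitrary so that the statement can be applied successively to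
  groups that act on disjoint sets of variables.\<close>

definition generates_invariants :: "(nat \<Rightarrow> nat) set \<Rightarrow> 'a::field ratfun set \<Rightarrow> 'a ratfun set \<Rightarrow> bool" where
  "generates_invariants G U Y \<longleftrightarrow> (\<forall>B. is_subfield B \<longrightarrow> range rconst \<subseteq> B \<longrightarrow> B \<subseteq> fixed_by G \<longrightarrow>
     field_gen (B \<union> U) \<inter> fixed_by G \<subseteq> field_gen (B \<union> Y))"

lemma generates_invariantsD:
  "generates_invariants G U Y \<Longrightarrow> is_subfield B \<Longrightarrow> range rconst \<subseteq> B \<Longrightarrow> B \<subseteq> fixed_by G \<Longrightarrow>
     f \<in> field_gen (B \<union> U) \<Longrightarrow> f \<in> fixed_by G \<Longrightarrow> f \<in> field_gen (B \<union> Y)"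
  unfolding generates_invariants_def by blast

lemma generates_invariants_empty: "generates_invariants {} U U"
  by (auto simp: generates_invariants_def)

text \<open>One group at a time: the first hypothesis is applied over the base generated by
  \<open>B\<close> and \<open>U'\<close>, which \<open>G\<close> fixes, the second over the base
  generated by \<open>B\<close> and \<open>Y\<close>, which \<open>H\<close> fixes.\<close>

lemma generates_invariants_Un:
  assumes inj: "G \<subseteq> {g. inj g}" "H \<subseteq> {g. inj g}"
    and 1: "generates_invariants G U Y" and 2: "generates_invariants H U' Y'"
    and fix1: "U' \<subseteq> fixed_by G" and fix2: "Y \<subseteq> fixed_by H"
  shows "generates_invariants (G \<union> H) (U \<union> U') (Y \<union> Y')"
  unfolding generates_invariants_def
proof (intro allI impI subsetI)
  fix B f
  assume B: "is_subfield B" "range rconst \<subseteq> B" "B \<subseteq> fixed_by (G \<union> H)"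
    and f: "f \<in> field_gen (B \<union> (U \<union> U')) \<inter> fixed_by (G \<union> H)"
  have "f \<in> field_gen (field_gen (B \<union> U') \<union> Y)"
  proof (rule generates_invariantsD[OF 1 is_subfield_field_gen])
    show "range rconst \<subseteq> field_gen (B \<union> U')" using B field_gen_superset[of "B \<union> U'"] by blast
    show "field_gen (B \<union> U') \<subseteq> fixed_by G"
      using B fix1 by (intro field_gen_least is_subfield_fixed_by inj) (auto simp: fixed_by_Un)
    have "B \<union> U' \<union> U = B \<union> (U \<union> U')" by blast
    then show "f \<in> field_gen (field_gen (B \<union> U') \<union> U)" using f by (simp add: field_gen_field_gen_Un)
  qed (use f in \<open>simp add: fixed_by_Un\<close>)
  moreover have "B \<union> U' \<union> Y = B \<union> Y \<union> U'" by blast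
  ultimately have "f \<in> field_gen (field_gen (B \<union> Y) \<union> U')" by (simp add: field_gen_field_gen_Un)
  then have "f \<in> field_gen (field_gen (B \<union> Y) \<union> Y')"
  proof (rule generates_invariantsD[OF 2 is_subfield_field_gen, rotated 2])
    show "range rconst \<subseteq> field_gen (B \<union> Y)" using B field_gen_superset[of "B \<union> Y"] by blast
    show "field_gen (B \<union> Y) \<subseteq> fixed_by H"
      using B fix2 by (intro field_gen_least is_subfield_fixed_by inj) (auto simp: fixed_by_Un)
  qed (use f in \<open>simp add: fixed_by_Un\<close>)
  then show "f \<in> field_gen (B \<union> (Y \<union> Y'))" by (simp add: field_gen_field_gen_Un Un_assoc)
qed

lemma generates_invariants_UN:
  fixes G :: "nat \<Rightarrow> (nat \<Rightarrow> nat) set"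
  assumes "\<And>c. c < k \<Longrightarrow> G c \<subseteq> {g. inj g}" "\<And>c. c < k \<Longrightarrow> generates_invariants (G c) (U c) (Y c)"
    and "\<And>c d. c < k \<Longrightarrow> d < k \<Longrightarrow> c \<noteq> d \<Longrightarrow> U d \<subseteq> fixed_by (G c) \<and> Y d \<subseteq> fixed_by (G c)"
  shows "generates_invariants (\<Union>c<k. G c) (\<Union>c<k. U c) (\<Union>c<k. Y c)"
  using assms
proof (induction k)
  case 0
  show ?case using generates_invariants_empty[of "{}"] by simp
next
  case (Suc k)
  have fixd: "U d \<subseteq> fixed_by (G c)" "Y d \<subseteq> fixed_by (G c)" if "c < Suc k" "d < Suc k" "c \<noteq> d" for c d
    using Suc.prems(3)[OF that] by blast+
  have "generates_invariants ((\<Union>c<k. G c) \<union> G k) ((\<Union>c<k. U c) \<union> U k) ((\<Union>c<k. Y c) \<union> Y k)"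
  proof (rule generates_invariants_Un)
    show "(\<Union>c<k. G c) \<subseteq> {g. inj g}" "G k \<subseteq> {g. inj g}"
      using Suc.prems(1) by (meson UN_least lessI lessThan_iff less_SucI)+
    show "generates_invariants (\<Union>c<k. G c) (\<Union>c<k. U c) (\<Union>c<k. Y c)"
      using Suc.prems by (intro Suc.IH) auto
    show "generates_invariants (G k) (U k) (Y k)" using Suc.prems(2) by simp
    have "U k \<subseteq> fixed_by (G c)" if "c < k" for c using fixd(1)[of c k] that by simp
    then show "U k \<subseteq> fixed_by (\<Union>c<k. G c)" by (auto simp: fixed_by_def)
    have "Y c \<subseteq> fixed_by (G k)" if "c < k" for c using fixd(2)[of k c] that by simp
    then show "(\<Union>c<k. Y c) \<subseteq> fixed_by (G k)" by auto
  qed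
  then show ?case by (simp add: lessThan_Suc Un_commute)
qed

text \<open>Apply \<open>\<pi>\<close> to \<open>f\<close> and \<open>B\<close>, use the statement
  for \<open>G\<close>, and apply \<open>\<pi>\<close> again; as an involution it is its own
  inverse.\<close>

lemma generates_invariants_conj:
  fixes U Y :: "'a::field ratfun set"
  assumes G: "G \<subseteq> {g. inj g}" "G' \<subseteq> {g. inj g}" and \<pi>: "\<And>x. \<pi> (\<pi> x) = x"
    and conj: "\<And>g. g \<in> G \<Longrightarrow> \<exists>g'\<in>G'. g' \<circ> \<pi> = \<pi> \<circ> g"
    and gen: "generates_invariants G U Y"
  shows "generates_invariants G' (perm_act \<pi> ` U) (perm_act \<pi> ` Y)"
  unfolding generates_invariants_def
proof (intro allI impI subsetI)
  fix B f
  assume B: "is_subfield B" "range rconst \<subseteq> B" "B \<subseteq> fixed_by G'"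
    and f: "f \<in> field_gen (B \<union> perm_act \<pi> ` U) \<inter> fixed_by G'"
  have inj: "inj \<pi>" using \<pi> by (metis injI)
  note endo = is_endo_perm_act[OF inj]
  have "\<pi> \<circ> \<pi> = id" using \<pi> by auto
  then have invol: "perm_act \<pi> (perm_act \<pi> u) = u" for u :: "'a ratfun"
    using perm_act_comp[OF inj inj, of u] by (simp add: perm_act_id)
  then have invol_image: "perm_act \<pi> ` perm_act \<pi> ` V = V" for V :: "'a ratfun set" by (simp add: image_image)
  have fixed: "perm_act \<pi> u \<in> fixed_by G" if "u \<in> fixed_by G'" for u
    unfolding fixed_by_def
  proof (intro CollectI ballI)
    fix g assume g: "g \<in> G"
    then obtain g' where g': "g' \<in> G'" "g' \<circ> \<pi> = \<pi> \<circ> g" using conj by blast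
    have "g (\<pi> x) = \<pi> (g' x)" for x using fun_cong[OF g'(2), of "\<pi> x"] by (simp add: \<pi>)
    then have "g \<circ> \<pi> = \<pi> \<circ> g'" by auto
    moreover have "inj g" "inj g'" using g g' G by auto
    ultimately have "perm_act g (perm_act \<pi> u) = perm_act \<pi> (perm_act g' u)"
      by (simp add: perm_act_comp inj)
    then show "perm_act g (perm_act \<pi> u) = perm_act \<pi> u" using that g' by (simp add: fixed_by_def)
  qed
  have "rconst c \<in> perm_act \<pi> ` B" for c
    using B(2) perm_act_rconst[OF inj, of c] by (metis image_eqI range_subsetD)
  then have "field_gen (perm_act \<pi> ` B \<union> U) \<inter> fixed_by G \<subseteq> field_gen (perm_act \<pi> ` B \<union> Y)"
    using gen[unfolded generates_invariants_def, rule_format, of "perm_act \<pi> ` B"] B fixed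
    by (auto simp: is_subfield_image[OF endo])
  moreover have "perm_act \<pi> f \<in> field_gen (perm_act \<pi> ` (B \<union> perm_act \<pi> ` U))"
    using f by (intro endo_field_gen[OF endo]) blast
  ultimately have "perm_act \<pi> f \<in> field_gen (perm_act \<pi> ` B \<union> Y)"
    using f fixed by (auto simp: image_Un invol_image)
  from endo_field_gen[OF endo this] show "f \<in> field_gen (B \<union> perm_act \<pi> ` Y)"
    by (simp add: image_Un invol_image invol)
qed

section \<open>Algebraicity of the variables over the invariants\<close>

lemma coeff_linear_mult:
  "coeff ([:- b, 1:] * q) k = (case k of 0 \<Rightarrow> 0 | Suc l \<Rightarrow> coeff q l) - b * coeff q k" for b :: "'b::field"
  by (simp add: coeff_pCons split: nat.split)

lemma endo_coeff_prod_linear: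
  assumes "is_endo h"
  shows "h (coeff (\<Prod>i\<in>A. [:- a i, 1:]) k) = coeff (\<Prod>i\<in>A. [:- h (a i), 1:]) k"
proof (induction A arbitrary: k rule: infinite_finite_induct)
  case (insert x F)
  show ?case using insert assms
    by (simp add: coeff_linear_mult is_endoD del: mult_pCons_left split: nat.split)
qed (use assms in \<open>simp_all add: coeff_1 is_endoD\<close>)

lemma coeff_prod_linear_in:
  assumes "is_subfield K" "\<And>i. i \<in> A \<Longrightarrow> a i \<in> K"
  shows "coeff (\<Prod>i\<in>A. [:- a i, 1:]) k \<in> K"
  using assms(2)
proof (induction A arbitrary: k rule: infinite_finite_induct)
  case (insert x F)
  have "(case k of 0 \<Rightarrow> 0 | Suc l \<Rightarrow> coeff (\<Prod>i\<in>F. [:- a i, 1:]) l) \<in> K"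
    using insert is_subfieldD(2)[OF assms(1)] by (cases k) auto
  then show ?case using insert
    by (simp add: coeff_linear_mult del: mult_pCons_left) (auto intro!: is_subfieldD(6,7)[OF assms(1)])
qed (use assms(1) in \<open>simp_all add: coeff_1 is_subfieldD\<close>)

text \<open>\<open>x_j\<close> is a root of the product of all \<open>T - x_i\<close>, whose
  coefficients are symmetric in the variables.\<close>

lemma rvar_algebraic_over_fixed:
  assumes "\<And>g. g \<in> G \<Longrightarrow> g permutes {1..n}" "j \<in> {1..n}"
  shows "algebraic_over (fixed_field n G) (rvar j)"
proof -
  let ?q = "\<Prod>i\<in>{1..n}. [:- rvar i, 1:]"
  have "coeff ?q k \<in> fixed_field n G" for k unfolding fixed_field_def
  proof (intro CollectI conjI ballI)
    show "coeff ?q k \<in> ratfun_field n"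
      unfolding ratfun_field_eq_varfield
      by (intro coeff_prod_linear_in is_subfield_varfield rvar_in_varfield)
  next
    fix g assume "g \<in> G"
    then have g: "g permutes {1..n}" by (rule assms)
    then have inj: "inj g" by (rule permutes_inj)
    have "perm_act g (coeff ?q k) = coeff (\<Prod>i\<in>{1..n}. [:- perm_act g (rvar i), 1:]) k"
      by (rule endo_coeff_prod_linear[OF is_endo_perm_act[OF inj]])
    also have "(\<Prod>i\<in>{1..n}. [:- perm_act g (rvar i), 1:]) = ?q"
      unfolding perm_act_rvar[OF inj] using prod.permute[OF g, of "\<lambda>i. [:- rvar i, 1:]"] by (simp only: o_def eq_commute)
    finally show "perm_act g (coeff ?q k) = coeff ?q k" .
  qed
  moreover have "?q \<noteq> 0" by simp
  moreover have "poly ?q (rvar j) = 0" using assms(2) by (auto simp: poly_prod)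
  ultimately show ?thesis unfolding algebraic_over_def by blast
qed

section \<open>Blocks\<close>

text \<open>The block moved by \<open>\<sigma>\<^bsub>i,s\<^esub>\<close> is contained in \<open>{a+1..a+q}\<close>.\<close>

definition block_in :: "nat \<Rightarrow> nat \<Rightarrow> nat \<Rightarrow> nat \<Rightarrow> nat \<Rightarrow> bool" where
  "block_in p a q i s \<longleftrightarrow> 1 \<le> s \<and> a \<le> (s - 1) * p ^ (i + 1) \<and> s * p ^ (i + 1) \<le> a + q"

definition block_gens :: "nat \<Rightarrow> nat \<Rightarrow> nat \<Rightarrow> (nat \<Rightarrow> nat) set" where
  "block_gens p a q = {sigma p i s | i s. block_in p a q i s}"

lemma sigma_permutes_block:
  assumes "1 \<le> s" "0 < p"
  shows "sigma p i s permutes {(s - 1) * p ^ (i + 1) <.. s * p ^ (i + 1)}"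
proof -
  have "sigma p i s permutes {1..s * p ^ (i + 1)}"
    using assms by (intro sigma_permutes) auto
  moreover have "sigma p i s x = x" if "x \<notin> {(s - 1) * p ^ (i + 1) <.. s * p ^ (i + 1)}" for x
    using that by (rule sigma_fixed)
  ultimately show ?thesis unfolding permutes_def by blast
qed

lemma sigma_inj: "1 \<le> s \<Longrightarrow> 0 < p \<Longrightarrow> inj (sigma p i s)"
  using sigma_permutes_block by (rule permutes_inj)

lemma block_in_permutes:
  assumes "block_in p a q i s" "0 < p"
  shows "sigma p i s permutes {a+1..a+q}"
  by (rule permutes_subset[OF sigma_permutes_block]) (use assms in \<open>auto simp: block_in_def\<close>)

lemma block_gens_inj: "0 < p \<Longrightarrow> block_gens p a q \<subseteq> {g. inj g}"
  by (auto simp: block_gens_def block_in_def intro: sigma_inj)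

section \<open>Translating blocks\<close>

lemma sigma_shift:
  assumes "1 \<le> s" "0 < p"
  shows "sigma p i (s + u) (x + u * p ^ (i + 1)) = sigma p i s x + u * p ^ (i + 1)"
proof -
  obtain t where t: "s = Suc t" using assms(1) by (cases s) auto
  obtain r where r: "p = Suc r" using assms(2) by (cases p) auto
  define d where "d = p ^ i"
  have pd: "p ^ (i + 1) = r * d + d" by (simp add: d_def r)
  show ?thesis unfolding sigma_def pd d_def[symmetric] t by (auto simp: r algebra_simps)
qed

text \<open>For \<open>q \<le> a\<close>, exchanging the two intervals instead of translating by
  \<open>a\<close> gives an involution of the natural numbers, hence an automorphism of the function
  field. For \<open>a = 0\<close> it is the identity.\<close>

definition block_swap :: "nat \<Rightarrow> nat \<Rightarrow> nat \<Rightarrow> nat" where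
  "block_swap a q x = (if x \<in> {1..q} then x + a else if x \<in> {a+1..a+q} then x - a else x)"

lemma block_swap_invol: "a = 0 \<or> q \<le> a \<Longrightarrow> block_swap a q (block_swap a q x) = x"
  by (auto simp: block_swap_def)

lemma block_swap_inj: "a = 0 \<or> q \<le> a \<Longrightarrow> inj (block_swap a q)"
  using block_swap_invol by (metis injI)

lemma block_swap_image: "block_swap a q ` {1..q} = {a+1..a+q}"
proof -
  have "block_swap a q ` {1..q} = (\<lambda>x. x + a) ` {1..q}"
    by (intro image_cong) (auto simp: block_swap_def)
  then show ?thesis by (simp add: add.commute)
qed

text \<open>Because the block length divides \<open>a\<close>, translation by \<open>a\<close> moves
  blocks of level \<open>i\<close> onto blocks of the same level, \<open>a div p ^ (i + 1)\<close>
  places further.\<close>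

lemma sigma_block_swap:
  assumes "block_in p 0 q i s" "0 < p" "p ^ (i + 1) dvd a" "a = 0 \<or> q \<le> a"
  shows "sigma p i (s + a div p ^ (i + 1)) \<circ> block_swap a q = block_swap a q \<circ> sigma p i s"
proof
  fix x
  let ?D = "p ^ (i + 1)" and ?u = "a div p ^ (i + 1)"
  have a: "?u * ?D = a" using assms(3) by simp
  have s: "1 \<le> s" "s * ?D \<le> q" using assms(1) by (auto simp: block_in_def)
  have perm: "sigma p i s permutes {1..q}" using block_in_permutes[OF assms(1,2)] by simp
  obtain t where t: "s = Suc t" using s(1) by (cases s) auto
  have "(t + ?u) * ?D = t * ?D + a" "(Suc t + ?u) * ?D = Suc t * ?D + a"
    by (simp_all only: add_mult_distrib a)
  then have "block_in p a q i (s + ?u)" using s(2) unfolding block_in_def t by simp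
  then have perm': "sigma p i (s + ?u) permutes {a+1..a+q}" using block_in_permutes assms(2) by blast
  show "(sigma p i (s + ?u) \<circ> block_swap a q) x = (block_swap a q \<circ> sigma p i s) x"
  proof (cases "x \<in> {1..q}")
    case True
    then have "sigma p i s x \<in> {1..q}" using permutes_in_image[OF perm] by blast
    then show ?thesis using True sigma_shift[OF s(1) assms(2), of i ?u x] unfolding a
      by (simp add: block_swap_def)
  next
    case False
    then have 1: "sigma p i s x = x" using permutes_not_in[OF perm] by blast
    have "block_swap a q x \<notin> {a+1..a+q}" using False assms(4) by (auto simp: block_swap_def)
    then have "sigma p i (s + ?u) (block_swap a q x) = block_swap a q x" using permutes_not_in[OF perm'] by blast
    then show ?thesis using 1 by simp
  qed
qed

text \<open>A block that fits into length \<open>p ^ k\<close> has \<open>i + 1 \<le> k\<close>, so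
  its length divides \<open>p ^ k\<close> and thus \<open>a\<close>.\<close>

lemma block_in_translate:
  assumes "prime p" "p ^ k dvd a" "block_in p a (p ^ k) i s"
  shows "p ^ (i + 1) dvd a" "\<exists>s'. s = s' + a div p ^ (i + 1) \<and> block_in p 0 (p ^ k) i s'"
proof -
  let ?D = "p ^ (i + 1)"
  have p: "1 < p" using assms(1) by (rule prime_gt_1_nat)
  obtain t where t: "s = Suc t" using assms(3) by (cases s) (auto simp: block_in_def)
  have le: "a \<le> t * ?D" "t * ?D + ?D \<le> a + p ^ k"
    using assms(3) unfolding block_in_def t by (simp_all del: power_Suc add: algebra_simps)
  then have "?D \<le> p ^ k" by linarith
  then have "i + 1 \<le> k" using p by (rule power_le_imp_le_exp[rotated])
  then have "?D dvd p ^ k" by (rule le_imp_power_dvd)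
  then show D: "?D dvd a" using assms(2) by (rule dvd_trans)
  then obtain u where u: "a = u * ?D" by (metis dvd_div_mult_self)
  have D0: "0 < ?D" using p by simp
  have "u \<le> t" using le(1) D0 unfolding u by simp
  then obtain t' where t': "t = u + t'" by (metis le_add_diff_inverse)
  have "t' * ?D + ?D \<le> p ^ k" using le(2) unfolding u t' by (simp add: algebra_simps del: power_Suc)
  then have "block_in p 0 (p ^ k) i (Suc t')" by (simp add: block_in_def algebra_simps del: power_Suc)
  moreover have "a div ?D = u" unfolding u using D0 by simp
  ultimately show "\<exists>s'. s = s' + a div ?D \<and> block_in p 0 (p ^ k) i s'"
    using t t' by (intro exI[of _ "Suc t'"]) simp
qed

lemma block_in_translate':
  assumes "prime p" "p ^ k dvd a" "block_in p 0 (p ^ k) i s"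
  shows "p ^ (i + 1) dvd a" "block_in p a (p ^ k) i (s + a div p ^ (i + 1))"
proof -
  let ?D = "p ^ (i + 1)"
  have p: "1 < p" using assms(1) by (rule prime_gt_1_nat)
  obtain t where t: "s = Suc t" using assms(3) by (cases s) (auto simp: block_in_def)
  have le: "t * ?D + ?D \<le> p ^ k"
    using assms(3) unfolding block_in_def t by (simp_all del: power_Suc add: algebra_simps)
  then have "?D \<le> p ^ k" by linarith
  then have "i + 1 \<le> k" using p by (rule power_le_imp_le_exp[rotated])
  then have "?D dvd p ^ k" by (rule le_imp_power_dvd)
  then show D: "?D dvd a" using assms(2) by (rule dvd_trans)
  then obtain u where u: "a = u * ?D" by (metis dvd_div_mult_self)
  have D0: "0 < ?D" using p by simp
  have "a div ?D = u" unfolding u using D0 by simp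
  then show "block_in p a (p ^ k) i (s + a div ?D)"
    using le unfolding block_in_def t u by (simp add: algebra_simps del: power_Suc)
qed

text \<open>A block with \<open>i < k\<close> has length dividing \<open>p ^ k\<close>, so it cannot
  straddle two of the \<open>p\<close> subintervals; the only new block is the full interval, with
  \<open>i = k\<close>.\<close>

lemma block_in_power_Suc:
  assumes "prime p"
  shows "block_in p 0 (p ^ Suc k) i s \<longleftrightarrow> (\<exists>c<p. block_in p (c * p ^ k) (p ^ k) i s) \<or> (i = k \<and> s = 1)"
proof
  let ?D = "p ^ (i + 1)"
  have p: "1 < p" using assms(1) by (rule prime_gt_1_nat)
  have D0: "0 < ?D" using p by simp
  {
    assume b: "block_in p 0 (p ^ Suc k) i s"
    then obtain t where t: "s = Suc t" by (cases s) (auto simp: block_in_def)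
    have le: "Suc t * ?D \<le> p ^ Suc k" using b unfolding block_in_def t by simp
    then have "?D \<le> p ^ Suc k" by (metis dvd_imp_le dvd_triv_right le_trans mult_pos_pos D0 zero_less_Suc)
    then have ik: "i + 1 \<le> Suc k" using p by (rule power_le_imp_le_exp[rotated])
    show "(\<exists>c<p. block_in p (c * p ^ k) (p ^ k) i s) \<or> (i = k \<and> s = 1)"
    proof (cases "i = k")
      case True
      then have "s = 1" using le D0 t by simp
      then show ?thesis using True by simp
    next
      case False
      then have "?D dvd p ^ k" using ik by (intro le_imp_power_dvd) simp
      then obtain r where r: "p ^ k = r * ?D" by (metis dvd_div_mult_self)
      have r0: "0 < r" using r p by (metis gr0I mult_0 power_not_zero not_one_less_zero)
      \<comment> \<open>A subinterval holds \<open>r\<close> blocks of level \<open>i\<close>, so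
        this is the number of the subinterval containing the block with zero-based index
        \<open>t\<close>.\<close>
      define c where "c = t div r"
      have "Suc t * ?D \<le> p * r * ?D" using le r by (simp add: mult.assoc)
      then have "t < p * r" using D0 by (metis Suc_le_lessD mult_le_cancel2)
      then have "c < p" unfolding c_def using r0 by (simp add: less_mult_imp_div_less)
      have "c * r \<le> t" unfolding c_def by simp
      then have 1: "c * r * ?D \<le> t * ?D" by (rule mult_le_mono1)
      have "t < c * r + r" unfolding c_def using div_mult_mod_eq[of t r] mod_less_divisor[OF r0, of t] by linarith
      then have "Suc t \<le> c * r + r" by simp
      then have 2: "Suc t * ?D \<le> (c * r + r) * ?D" by (rule mult_le_mono1)
      have "block_in p (c * p ^ k) (p ^ k) i s" unfolding block_in_def t r
        using 1 2 by (simp add: algebra_simps del: power_Suc)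
      then show ?thesis using \<open>c < p\<close> by blast
    qed
  }
  assume "(\<exists>c<p. block_in p (c * p ^ k) (p ^ k) i s) \<or> (i = k \<and> s = 1)"
  then show "block_in p 0 (p ^ Suc k) i s"
  proof
    assume "\<exists>c<p. block_in p (c * p ^ k) (p ^ k) i s"
    then obtain c where c: "c < p" "block_in p (c * p ^ k) (p ^ k) i s" by blast
    have "Suc c * p ^ k \<le> p * p ^ k" using c by (intro mult_le_mono1) simp
    moreover have "s * ?D \<le> Suc c * p ^ k" using c by (simp only: block_in_def mult_Suc add.commute)
    ultimately have "s * ?D \<le> p * p ^ k" by (rule order_trans[rotated])
    then have "s * ?D \<le> p ^ Suc k" by (simp only: power_Suc)
    then show ?thesis using c(2) by (simp only: block_in_def add_0) simp
  qed (simp add: block_in_def)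
qed

text \<open>No block straddles \<open>n\<close>. For \<open>i < j\<close> the block length divides
  \<open>n\<close>. A longer block ends at a multiple of \<open>p ^ Suc j\<close>, hence before
  \<open>n + p ^ j\<close>, and then at \<open>n\<close> or earlier, since its end and
  \<open>n\<close> are multiples of \<open>p ^ j\<close>.\<close>

lemma block_in_add_power:
  assumes "prime p" "p ^ j dvd n" "\<not> p ^ Suc j dvd n + p ^ j"
  shows "block_in p 0 (n + p ^ j) i s \<longleftrightarrow> block_in p 0 n i s \<or> block_in p n (p ^ j) i s"
proof
  let ?D = "p ^ (i + 1)"
  have p: "1 < p" using assms(1) by (rule prime_gt_1_nat)
  have D0: "0 < ?D" using p by simp
  assume b: "block_in p 0 (n + p ^ j) i s"
  then obtain t where t: "s = Suc t" by (cases s) (auto simp: block_in_def)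
  have le: "Suc t * ?D \<le> n + p ^ j" using b unfolding block_in_def t by simp
  show "block_in p 0 n i s \<or> block_in p n (p ^ j) i s"
  proof (cases "i + 1 \<le> j")
    case True
    then have "?D dvd p ^ j" by (rule le_imp_power_dvd)
    then have "?D dvd n" using assms(2) dvd_trans by blast
    then obtain u where u: "n = u * ?D" by (metis dvd_div_mult_self)
    show ?thesis
    proof (cases "Suc t \<le> u")
      case True
      then have "Suc t * ?D \<le> u * ?D" by (rule mult_le_mono1)
      then show ?thesis using u t by (simp add: block_in_def)
    next
      case False
      then have "u * ?D \<le> t * ?D" by (intro mult_le_mono1) simp
      then show ?thesis using le u t by (simp add: block_in_def)
    qed
  next
    case False
    then have "p ^ Suc j dvd ?D" by (intro le_imp_power_dvd) simp
    then have dv: "p ^ Suc j dvd Suc t * ?D" by (rule dvd_mult)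
    then have "Suc t * ?D \<noteq> n + p ^ j" using assms(3) by metis
    then have lt: "Suc t * ?D < n + p ^ j" using le by simp
    have "p ^ j dvd Suc t * ?D" using dv by (meson dvd_trans le_imp_power_dvd le_SucI order_refl)
    then obtain v where v: "Suc t * ?D = p ^ j * v" by blast
    obtain w where w: "n = p ^ j * w" using assms(2) by blast
    have "p ^ j * v < p ^ j * Suc w" using lt unfolding v w by simp
    then have "v \<le> w" by (metis mult_less_cancel1 less_Suc_eq_le)
    then have "Suc t * ?D \<le> n" unfolding v w by simp
    then show ?thesis using t by (simp add: block_in_def)
  qed
next
  assume "block_in p 0 n i s \<or> block_in p n (p ^ j) i s"
  then show "block_in p 0 (n + p ^ j) i s" by (auto simp: block_in_def)
qed

lemma block_gens_fix:
  assumes "0 < p" "g \<in> block_gens p a q" "V \<inter> {a+1..a+q} = {}" "f \<in> varfield V"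
  shows "perm_act g f = f"
proof (rule perm_act_fixes_varfield[OF _ _ assms(4)])
  obtain i s where g: "g = sigma p i s" "block_in p a q i s" using assms(2) by (auto simp: block_gens_def)
  have perm: "g permutes {a+1..a+q}" unfolding g(1) using g(2) assms(1) by (rule block_in_permutes)
  show "inj g" using perm by (rule permutes_inj)
  show "g j = j" if "j \<in> V" for j using that assms(3) permutes_not_in[OF perm] by blast
qed

text \<open>The top generator shifts the \<open>p\<close> translates of a block cyclically, which
  makes their Fourier coefficients its eigenvectors.\<close>

lemma sigma_top_block_swap:
  assumes "c < p" "j \<in> {1..p ^ k}"
  shows "sigma p k 1 (block_swap (c * p ^ k) (p ^ k) j) = block_swap ((Suc c mod p) * p ^ k) (p ^ k) j"
  using sigma_cycle[of 1 c p j k] assms by (simp add: block_swap_def add.commute)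

section \<open>The field fixed by the Sylow subgroup\<close>

declare One_nat_def [simp del]

locale const_root_of_unity = root_of_unity "rconst \<zeta>0" p for \<zeta>0 :: "'a::field_char_0" and p
begin

abbreviation "\<zeta> \<equiv> (rconst \<zeta>0 :: 'a ratfun)"

lemma zeta0_neq_0 [simp]: "\<zeta>0 \<noteq> 0"
  using zeta_neq_0 by auto

text \<open>\<open>\<theta>\<close> is the eigenvector for the character with kernel
  \<open>H\<close>. Only the bound on \<open>card Y\<close> is carried along; algebraic independence
  is obtained from the number of generators at the end, by \<open>alg_indepI\<close>.\<close>

definition invariant_basis :: "nat \<Rightarrow> nat \<Rightarrow> 'a ratfun set \<Rightarrow> 'a ratfun \<Rightarrow> bool" where
  "invariant_basis a q Y \<theta> \<longleftrightarrow> finite Y \<and> card Y \<le> q \<and> Y \<subseteq> varfield {a+1..a+q} \<and>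
     \<theta> \<in> varfield {a+1..a+q} \<and> \<theta> \<noteq> 0 \<and> Y \<subseteq> fixed_by (block_gens p a q) \<and>
     (\<forall>i s. block_in p a q i s \<longrightarrow> perm_act (sigma p i s) \<theta> = (if i = 0 then \<zeta> * \<theta> else \<theta>)) \<and>
     generates_invariants (block_gens p a q) (rvar ` {a+1..a+q}) Y"

lemma invariant_basisD:
  assumes "invariant_basis a q Y \<theta>"
  shows "finite Y" "card Y \<le> q" "Y \<subseteq> varfield {a+1..a+q}" "\<theta> \<in> varfield {a+1..a+q}" "\<theta> \<noteq> 0"
    "Y \<subseteq> fixed_by (block_gens p a q)"
    "block_in p a q i s \<Longrightarrow> perm_act (sigma p i s) \<theta> = (if i = 0 then \<zeta> * \<theta> else \<theta>)"
    "generates_invariants (block_gens p a q) (rvar ` {a+1..a+q}) Y"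
  using assms unfolding invariant_basis_def by blast+

lemma block_gens_subset_inj: "block_gens p a q \<subseteq> {g. inj g}"
  by (rule block_gens_inj[OF p_gt_0])

lemma is_endo_sigma: "block_in p a q i s \<Longrightarrow> is_endo (perm_act (sigma p i s))"
  by (intro is_endo_perm_act sigma_inj) (auto simp: block_in_def)

lemma perm_act_sigma_zeta: "block_in p a q i s \<Longrightarrow> perm_act (sigma p i s) \<zeta> = \<zeta>"
  by (intro perm_act_rconst sigma_inj) (auto simp: block_in_def)

lemma block_gensI: "block_in p a q i s \<Longrightarrow> sigma p i s \<in> block_gens p a q"
  by (auto simp: block_gens_def)

section \<open>Translating, changing and merging invariant bases\<close>

lemma invariant_basis_translate:
  assumes good: "invariant_basis 0 (p ^ k) Y \<theta>" and a: "p ^ k dvd a"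
  shows "invariant_basis a (p ^ k) (perm_act (block_swap a (p ^ k)) ` Y) (perm_act (block_swap a (p ^ k)) \<theta>)"
proof -
  let ?q = "p ^ k" and ?\<pi> = "block_swap a (p ^ k)"
  have a': "a = 0 \<or> ?q \<le> a" using a by (auto dest: dvd_imp_le)
  have inj: "inj ?\<pi>" using a' by (rule block_swap_inj)
  note endo = is_endo_perm_act[OF inj]
  have in_varfield: "perm_act ?\<pi> f \<in> varfield {a+1..a+?q}" if "f \<in> varfield {1..?q}" for f
    using perm_act_varfield[OF inj that] block_swap_image[of a ?q] by simp
  have conj: "\<exists>s'. block_in p 0 ?q i s' \<and> (\<forall>f. perm_act (sigma p i s) (perm_act ?\<pi> f) = perm_act ?\<pi> (perm_act (sigma p i s') f))"
    if b: "block_in p a ?q i s" for i s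
  proof -
    obtain s' where s': "s = s' + a div p ^ (i + 1)" "block_in p 0 ?q i s'"
      using block_in_translate(2)[OF prime_p a b] by blast
    have D: "p ^ (i + 1) dvd a" using block_in_translate(1)[OF prime_p a b] .
    have "sigma p i s \<circ> ?\<pi> = ?\<pi> \<circ> sigma p i s'"
      unfolding s'(1) using s'(2) p_gt_0 D a' by (rule sigma_block_swap)
    moreover have "inj (sigma p i s)" "inj (sigma p i s')"
      using b s'(2) by (auto simp: block_in_def intro!: sigma_inj)
    ultimately show ?thesis using s'(2) by (auto simp: perm_act_comp inj)
  qed
  have "generates_invariants (block_gens p a ?q) (perm_act ?\<pi> ` rvar ` {1..?q}) (perm_act ?\<pi> ` Y)"
  proof (rule generates_invariants_conj[OF block_gens_subset_inj block_gens_subset_inj])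
    show "?\<pi> (?\<pi> x) = x" for x using a' by (rule block_swap_invol)
    show "generates_invariants (block_gens p 0 ?q) (rvar ` {1..?q}) Y" using invariant_basisD(8)[OF good] by simp
    fix g assume "g \<in> block_gens p 0 ?q"
    then obtain i s where g: "g = sigma p i s" "block_in p 0 ?q i s" by (auto simp: block_gens_def)
    note t = block_in_translate'[OF prime_p a g(2)]
    show "\<exists>g'\<in>block_gens p a ?q. g' \<circ> ?\<pi> = ?\<pi> \<circ> g"
      using sigma_block_swap[OF g(2) p_gt_0 t(1) a'] block_gensI[OF t(2)] g(1) by blast
  qed
  moreover have "perm_act ?\<pi> ` rvar ` {1..?q} = (rvar ` {a+1..a+?q} :: 'a ratfun set)"
    unfolding block_swap_image[of a ?q, symmetric] image_image perm_act_rvar[OF inj] ..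
  ultimately have gen: "generates_invariants (block_gens p a ?q) (rvar ` {a+1..a+?q}) (perm_act ?\<pi> ` Y)" by simp
  have fixed: "perm_act ?\<pi> y \<in> fixed_by (block_gens p a ?q)" if "y \<in> Y" for y
    unfolding fixed_by_def
  proof (intro CollectI ballI)
    fix g assume "g \<in> block_gens p a ?q"
    then obtain i s where g: "g = sigma p i s" "block_in p a ?q i s" by (auto simp: block_gens_def)
    obtain s' where s': "block_in p 0 ?q i s'"
      "perm_act (sigma p i s) (perm_act ?\<pi> y) = perm_act ?\<pi> (perm_act (sigma p i s') y)" using conj[OF g(2)] by blast
    have "perm_act (sigma p i s') y = y"
      using invariant_basisD(6)[OF good] that block_gensI[OF s'(1)] by (auto simp: fixed_by_def)
    then show "perm_act g (perm_act ?\<pi> y) = perm_act ?\<pi> y" using s' g by simp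
  qed
  have eig: "perm_act (sigma p i s) (perm_act ?\<pi> \<theta>) = (if i = 0 then \<zeta> * perm_act ?\<pi> \<theta> else perm_act ?\<pi> \<theta>)"
    if b: "block_in p a ?q i s" for i s
  proof -
    obtain s' where s': "block_in p 0 ?q i s'"
      "perm_act (sigma p i s) (perm_act ?\<pi> \<theta>) = perm_act ?\<pi> (perm_act (sigma p i s') \<theta>)" using conj[OF b] by blast
    then show ?thesis using invariant_basisD(7)[OF good s'(1)] by (auto simp: is_endoD[OF endo] perm_act_rconst[OF inj])
  qed
  have "card (perm_act ?\<pi> ` Y) \<le> ?q" using card_image_le[OF invariant_basisD(1)[OF good], of "perm_act ?\<pi>"] invariant_basisD(2)[OF good] by simp
  moreover have "perm_act ?\<pi> \<theta> \<noteq> 0" using invariant_basisD(5)[OF good] is_endoD(13)[OF endo] by blast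
  moreover have "Y \<subseteq> varfield {1..?q}" "\<theta> \<in> varfield {1..?q}" using invariant_basisD(3,4)[OF good] by auto
  ultimately show ?thesis unfolding invariant_basis_def
    using finite_imageI[OF invariant_basisD(1)[OF good]] in_varfield fixed eig gen by blast
qed

text \<open>Used to trade one generator for another: the invariants depend only on the field that
  the generators span over the constants.\<close>

lemma invariant_basis_change:
  assumes good: "invariant_basis a q Y \<theta>" and "finite Y'" "card Y' \<le> q"
    and Y': "Y' \<subseteq> field_gen (range rconst \<union> Y)" and Y: "Y \<subseteq> field_gen (range rconst \<union> Y')"
  shows "invariant_basis a q Y' \<theta>"
proof -
  have "field_gen (range rconst \<union> Y) \<subseteq> varfield {a+1..a+q}"
    by (rule field_gen_least[OF is_subfield_varfield]) (use invariant_basisD(3)[OF good] in \<open>auto intro: rconst_in_varfield\<close>)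
  moreover have "field_gen (range rconst \<union> Y) \<subseteq> fixed_by (block_gens p a q)"
    by (rule field_gen_least[OF is_subfield_fixed_by[OF block_gens_subset_inj]
          Un_least[OF rconst_fixed_by[OF block_gens_subset_inj] invariant_basisD(6)[OF good]]])
  moreover have "generates_invariants (block_gens p a q) (rvar ` {a+1..a+q}) Y'"
    unfolding generates_invariants_def
  proof (intro allI impI)
    fix B :: "'a ratfun set"
    assume B: "is_subfield B" "range rconst \<subseteq> B" "B \<subseteq> fixed_by (block_gens p a q)"
    have "field_gen (range rconst \<union> Y') \<subseteq> field_gen (B \<union> Y')" using B by (intro field_gen_mono) auto
    then have "B \<union> Y \<subseteq> field_gen (B \<union> Y')" using Y field_gen_superset[of "B \<union> Y'"] by blast
    then have "field_gen (B \<union> Y) \<subseteq> field_gen (B \<union> Y')" by (rule field_gen_least[OF is_subfield_field_gen])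
    then show "field_gen (B \<union> rvar ` {a+1..a+q}) \<inter> fixed_by (block_gens p a q) \<subseteq> field_gen (B \<union> Y')"
      using generates_invariantsD[OF invariant_basisD(8)[OF good] B] by auto
  qed
  ultimately show ?thesis unfolding invariant_basis_def using assms(2,3) Y' invariant_basisD(7)[OF good]
    by (intro conjI invariant_basisD(4,5)[OF good]) auto
qed

text \<open>Each block lies in one of the two intervals, so its generator acts on only one factor of
  \<open>\<theta> * \<theta>'\<close>, and the eigenvalues are those of that factor.\<close>

lemma invariant_basis_merge:
  assumes 1: "invariant_basis 0 n Y \<theta>" and 2: "invariant_basis n q Y' \<theta>'"
    and blocks: "\<And>i s. block_in p 0 (n + q) i s \<longleftrightarrow> block_in p 0 n i s \<or> block_in p n q i s"
  shows "invariant_basis 0 (n + q) (Y \<union> Y') (\<theta> * \<theta>')"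
proof -
  have gens: "block_gens p 0 (n + q) = block_gens p 0 n \<union> block_gens p n q"
    by (auto simp: block_gens_def blocks)
  have fix2: "perm_act g f = f" if "g \<in> block_gens p 0 n" "f \<in> varfield {n+1..n+q}" for g and f :: "'a ratfun"
    using that p_gt_0 by (intro block_gens_fix[of p g 0 n "{n+1..n+q}" f]) auto
  have fix1: "perm_act g f = f" if "g \<in> block_gens p n q" "f \<in> varfield {1..n}" for g and f :: "'a ratfun"
    using that p_gt_0 by (intro block_gens_fix[of p g n q "{1..n}" f]) auto
  have vars: "{1..n+q} = {0+1..0+n} \<union> {n+1..n+q}" by auto
  have sub: "varfield {1..n} \<subseteq> (varfield {1..n+q} :: 'a ratfun set)"
    "varfield {n+1..n+q} \<subseteq> (varfield {1..n+q} :: 'a ratfun set)"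
    by (auto intro!: varfield_mono)
  have Y1: "Y \<subseteq> varfield {1..n}" "\<theta> \<in> varfield {1..n}" using invariant_basisD(3,4)[OF 1] by auto
  note Y2 = invariant_basisD(3,4)[OF 2]
  have gen: "generates_invariants (block_gens p 0 n \<union> block_gens p n q)
      (rvar ` {0+1..0+n} \<union> rvar ` {n+1..n+q}) (Y \<union> Y')"
  proof (rule generates_invariants_Un[OF block_gens_subset_inj block_gens_subset_inj invariant_basisD(8)[OF 1] invariant_basisD(8)[OF 2]])
    show "rvar ` {n+1..n+q} \<subseteq> (fixed_by (block_gens p 0 n) :: 'a ratfun set)"
      by (auto simp: fixed_by_def intro!: fix2 rvar_in_varfield)
    show "Y \<subseteq> fixed_by (block_gens p n q)" using fix1 Y1 by (auto simp: fixed_by_def)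
  qed
  have eig: "perm_act (sigma p i s) (\<theta> * \<theta>') = (if i = 0 then \<zeta> * (\<theta> * \<theta>') else \<theta> * \<theta>')"
    if b: "block_in p 0 (n + q) i s" for i s
  proof -
    note endo = is_endo_sigma[OF b]
    from b consider "block_in p 0 n i s" | "block_in p n q i s" unfolding blocks by blast
    then show ?thesis
    proof cases
      case 1
      then show ?thesis using invariant_basisD(7)[OF assms(1) 1] fix2[OF block_gensI[OF 1] Y2(2)]
        by (simp add: is_endoD[OF endo])
    next
      case 2
      then show ?thesis using invariant_basisD(7)[OF assms(2) 2] fix1[OF block_gensI[OF 2] Y1(2)]
        by (simp add: is_endoD[OF endo])
    qed
  qed
  have fixed: "Y \<union> Y' \<subseteq> fixed_by (block_gens p 0 n \<union> block_gens p n q)"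
    unfolding fixed_by_Un using invariant_basisD(6)[OF 1] invariant_basisD(6)[OF 2] fix1 fix2 Y1 Y2
    by (auto simp: fixed_by_def)
  have "card (Y \<union> Y') \<le> n + q"
    using card_Un_le[of Y Y'] invariant_basisD(2)[OF 1] invariant_basisD(2)[OF 2] by linarith
  moreover have "\<theta> * \<theta>' \<in> varfield {1..n+q}"
    using Y1 Y2 sub by (intro is_subfieldD(6)[OF is_subfield_varfield]) auto
  moreover have "rvar ` {0+1..0+n} \<union> rvar ` {n+1..n+q} = (rvar ` {0+1..0+(n+q)} :: 'a ratfun set)"
    using vars by (simp only: add_0 image_Un)
  moreover have "Y \<union> Y' \<subseteq> varfield {1..n+q}" using Y1 Y2 sub by blast
  moreover have "finite (Y \<union> Y')" "\<theta> * \<theta>' \<noteq> 0" using invariant_basisD(1,5)[OF 1] invariant_basisD(1,5)[OF 2] by auto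
  ultimately show ?thesis unfolding invariant_basis_def gens using fixed eig gen by (simp only: add_0) blast
qed

section \<open>Fourier coefficients of translates\<close>

lemma fourier_recover:
  assumes "is_subfield K" "\<zeta> \<in> K" "\<And>k. k < p \<Longrightarrow> fourier f k \<in> K" "c < p"
  shows "f c \<in> K"
  unfolding fourier_inversion[OF assms(4), of f] using assms(1-3)
  by (intro is_subfieldD(6,8,9,10) is_subfield_sum) auto

lemma fourier_in:
  assumes "is_subfield K" "\<zeta> \<in> K" "\<And>c. c < p \<Longrightarrow> f c \<in> K"
  shows "fourier f k \<in> K"
  unfolding fourier_def using assms
  by (intro is_subfieldD(6,8,9,10) is_subfield_sum) auto

lemma fourier_fixed:
  assumes "is_endo h" "h \<zeta> = \<zeta>" "\<And>c. c < p \<Longrightarrow> h (f c) = f c"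
  shows "h (fourier f k) = fourier f k"
  unfolding fourier_def using assms by (simp add: is_endoD)

lemma sum_blocks: "(\<Sum>c<m. \<Sum>j\<in>{1..q}. F (c * q + j)) = (\<Sum>i\<in>{1..m * q}. F i)"
  for F :: "nat \<Rightarrow> 'c::comm_monoid_add"
proof (induction m)
  case (Suc m)
  have "(\<Sum>i\<in>{1..Suc m * q}. F i) = (\<Sum>i\<in>{1..m * q}. F i) + (\<Sum>i\<in>{m * q + 1..m * q + q}. F i)"
    using sum.ub_add_nat[of 1 "m * q" F q] by (simp add: add.commute)
  also have "(\<Sum>i\<in>{m * q + 1..m * q + q}. F i) = (\<Sum>j\<in>{1..q}. F (m * q + j))"
    using sum.shift_bounds_cl_nat_ivl[of F 1 "m * q" q] by (simp add: add.commute)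
  finally show ?case using Suc by simp
qed simp

text \<open>The block sum \<open>x\<^sub>1 + \<dots> + x\<^sub>q\<close> is kept among the generators because its translates have a
  nonzero Fourier coefficient \<open>e\<close>, which is the Kummer generator of the next step.\<close>

definition power_invariant_basis :: "nat \<Rightarrow> 'a ratfun set \<Rightarrow> 'a ratfun \<Rightarrow> bool" where
  "power_invariant_basis q Z \<theta> \<longleftrightarrow> invariant_basis 0 q ({\<theta> ^ p, \<Sum>j\<in>{1..q}. rvar j} \<union> Z) \<theta> \<and> finite Z \<and> card Z + 2 \<le> q"

lemma card_insert2_le: "finite Z \<Longrightarrow> card Z + 2 \<le> q \<Longrightarrow> finite ({a, b} \<union> Z) \<and> card ({a, b} \<union> Z) \<le> q"
  by (auto simp: card_insert_if)

text \<open>This is the Fourier coefficient \<open>e\<close> of the block sums: a linear form in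
  distinct variables in which \<open>x_1\<close> has coefficient 1.\<close>

lemma zeta_linear_form_nonzero:
  assumes "1 \<le> q"
  shows "(\<Sum>c<p. (\<Sum>j\<in>{1..q}. rvar (c * q + j)) / \<zeta> ^ (c * 1)) \<noteq> 0"
proof -
  have rp: "rconst (x ^ k) = rconst x ^ k" for x :: 'a and k
    by (induction k) (simp_all add: rconst_mult)
  have ri: "rconst (inverse x) = inverse (rconst x)" for x :: 'a
    using rconst_mult[of x "inverse x"] by (cases "x = 0") (simp_all add: inverse_unique)
  have z: "\<zeta>0 \<noteq> 0" using zeta_neq_0 by simp
  \<comment> \<open>As \<open>j\<close> runs from 1 to \<open>q\<close>,
    \<open>(i - 1) div q\<close> recovers \<open>c\<close> from
    \<open>i = c * q + j\<close>.\<close>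
  define w where "w i = inverse (\<zeta>0 ^ ((i - 1) div q))" for i
  have w: "w (c * q + j) = inverse (\<zeta>0 ^ c)" if jq: "j \<in> {1..q}" for c j
  proof -
    obtain j' where "j = Suc j'" "j' < q" using jq by (cases j) auto
    then show ?thesis by (simp add: w_def)
  qed
  have "(\<Sum>c<p. (\<Sum>j\<in>{1..q}. rvar (c * q + j)) / \<zeta> ^ (c * 1)) =
      (\<Sum>c<p. \<Sum>j\<in>{1..q}. rconst (w (c * q + j)) * rvar (c * q + j))"
    by (intro sum.cong) (auto simp: w sum_divide_distrib ri rp divide_inverse mult.commute sum_distrib_left intro!: sum.cong)
  also have "\<dots> = (\<Sum>i\<in>{1..p * q}. rconst (w i) * rvar i)"
    by (rule sum_blocks)
  also have "\<dots> \<noteq> 0"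
    by (rule linear_form_nonzero[of _ 1]) (use assms z p_gt_0 in \<open>auto simp: w_def Suc_le_eq One_nat_def\<close>)
  finally show ?thesis .
qed

text \<open>The Fourier coefficient \<open>e\<close> is at once the Kummer generator and the
  eigenvector \<open>\<theta>\<close>. Dividing the other coefficients by \<open>e ^ k\<close> makes
  them invariant, which leaves at most \<open>2 + (p - 2)\<close> generators.\<close>

lemma power_invariant_basis_base: "\<exists>Z \<theta>. power_invariant_basis p Z \<theta>"
proof -
  define f where "f c = (rvar (c + 1) :: 'a ratfun)" for c
  define e where "e = fourier f 1"
  define Z where "Z = (\<lambda>k. fourier f k / e ^ k) ` {2..<p}"
  define Y where "Y = {e ^ p, \<Sum>j\<in>{1..p}. rvar j} \<union> Z"
  let ?h = "perm_act (sigma p 0 1) :: 'a ratfun \<Rightarrow> 'a ratfun"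
  \<comment> \<open>A single block fits into length \<open>p\<close>, so the group is generated by
    one \<open>p\<close>-cycle.\<close>
  have blocks: "block_in p 0 p i s \<longleftrightarrow> i = 0 \<and> s = 1" for i s
  proof -
    have "\<not> block_in p (c * p ^ 0) (p ^ 0) i s" for c
    proof
      assume b: "block_in p (c * p ^ 0) (p ^ 0) i s"
      then obtain t where t: "s = Suc t" by (cases s) (auto simp: block_in_def)
      have "p ^ (i + 1) \<le> 1" using b unfolding block_in_def t by simp
      moreover have "p ^ 1 \<le> p ^ (i + 1)" by (intro power_increasing) (use p_gt_1 in auto)
      ultimately show False using p_gt_1 unfolding power_one_right by linarith
    qed
    then show ?thesis using block_in_power_Suc[OF prime_p, of 0 i s] by simp
  qed
  then have gens: "block_gens p 0 p = {sigma p 0 1}" by (auto simp: block_gens_def)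
  have b1: "block_in p 0 p 0 1" by (simp add: blocks)
  note endo = is_endo_sigma[OF b1] and hz = perm_act_sigma_zeta[OF b1]
  have inj: "inj (sigma p 0 1)" using p_gt_0 by (intro sigma_inj) auto
  have hf: "?h (f c) = f (Suc c mod p)" if "c < p" for c
    using sigma_cycle[of 1 c p 1 0] that by (simp add: f_def perm_act_rvar[OF inj])
  have hF: "?h (fourier f k) = \<zeta> ^ k * fourier f k" for k
    using endo hz hf by (rule fourier_shift)
  have he: "?h e = \<zeta> * e" using hF[of 1] by (simp add: e_def)
  have "e = (\<Sum>c<p. (\<Sum>j\<in>{1..1}. rvar (c * 1 + j)) / \<zeta> ^ (c * 1))"
    by (simp add: e_def fourier_def f_def)
  then have e0: "e \<noteq> 0" using zeta_linear_form_nonzero[of 1] by simp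
  have sum: "(\<Sum>j\<in>{1..p}. rvar j) = fourier f 0"
    by (simp add: fourier_def f_def sum.atLeast1_atMost_eq One_nat_def)
  have F_in: "fourier f k \<in> varfield {1..p}" for k
    by (rule fourier_in[OF is_subfield_varfield rconst_in_varfield]) (auto simp: f_def intro!: rvar_in_varfield)
  have Yh: "?h y = y" if "y \<in> Y" for y
    using that hF he e0 unfolding Y_def Z_def sum
    by (auto simp: is_endoD[OF endo] power_mult_distrib zeta_power_p)
  have Yvar: "Y \<subseteq> varfield {1..p}"
    unfolding Y_def Z_def sum e_def using F_in by (auto intro!: is_subfieldD(8,9)[OF is_subfield_varfield])
  have gen: "generates_invariants {sigma p 0 1} (rvar ` {1..p}) Y"
    unfolding generates_invariants_def
  proof (intro allI impI subsetI)
    fix B :: "'a ratfun set" and g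
    assume B: "is_subfield B" "range rconst \<subseteq> B" "B \<subseteq> fixed_by {sigma p 0 1}"
      and g: "g \<in> field_gen (B \<union> rvar ` {1..p}) \<inter> fixed_by {sigma p 0 1}"
    let ?M = "field_gen (B \<union> Y)" and ?K = "field_gen (field_gen (B \<union> Y) \<union> {e})"
    have M: "B \<subseteq> ?M" "Y \<subseteq> ?M" using field_gen_superset[of "B \<union> Y"] by auto
    have K: "?M \<subseteq> ?K" "e \<in> ?K" using field_gen_superset[of "?M \<union> {e}"] by auto
    have zM: "\<zeta> \<in> ?M" using B M by blast
    have F: "fourier f k \<in> ?K" if k: "k < p" for k
    proof -
      consider "k = 0" | "k = 1" | "k \<in> {2..<p}" using k by force
      then show ?thesis
      proof cases
        case 1
        have "fourier f 0 \<in> Y" by (simp add: Y_def sum)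
        then show ?thesis using 1 M K by blast
      next
        case 2
        then show ?thesis using K by (simp add: e_def)
      next
        case 3
        then have "fourier f k / e ^ k \<in> Y" by (auto simp: Y_def Z_def)
        then have "fourier f k / e ^ k \<in> ?K" using M K by blast
        then have "fourier f k / e ^ k * e ^ k \<in> ?K"
          using K by (intro is_subfieldD(6,9)[OF is_subfield_field_gen])
        then show ?thesis using e0 by simp
      qed
    qed
    have fK: "f c \<in> ?K" if "c < p" for c
      by (rule fourier_recover[OF is_subfield_field_gen _ F that]) (use zM K in auto)
    have "rvar j \<in> ?K" if "j \<in> {1..p}" for j
    proof -
      have "j - 1 < p" "j - 1 + 1 = j" using that by auto
      then show ?thesis using fK[of "j - 1"] by (simp only: f_def)
    qed
    then have "B \<union> rvar ` {1..p} \<subseteq> ?K" using M K by blast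
    then have gK: "g \<in> ?K" using g field_gen_least[OF is_subfield_field_gen] by blast
    \<comment> \<open>Adjoining \<open>e\<close> to the claimed field has recovered all variables;
      Kummer descent removes \<open>e\<close> again.\<close>
    show "g \<in> ?M"
    proof (rule kummer_descent[OF is_subfield_field_gen zM _ endo _ he gK])
      have "e ^ p \<in> Y" by (simp add: Y_def)
      then show "e ^ p \<in> ?M" using M by blast
      show "?h b = b" if "b \<in> ?M" for b
        by (rule field_gen_fixed[OF endo _ that]) (use B Yh in \<open>auto simp: fixed_by_def\<close>)
      show "?h g = g" using g by (simp add: fixed_by_def)
    qed
  qed
  have "card Z \<le> p - 2" unfolding Z_def using card_image_le[of "{2..<p}" "\<lambda>k. fourier f k / e ^ k"] by simp
  then have Z: "finite Z" "card Z + 2 \<le> p" using p_gt_1 by (auto simp: Z_def)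
  have "invariant_basis 0 p Y e" unfolding invariant_basis_def gens
  proof (intro conjI)
    show "finite Y" "card Y \<le> p" using card_insert2_le[OF Z] by (auto simp: Y_def)
    show "\<forall>i s. block_in p 0 p i s \<longrightarrow> perm_act (sigma p i s) e = (if i = 0 then \<zeta> * e else e)"
      using he by (auto simp: blocks)
    show "e \<in> varfield {0 + 1..0 + p}" using F_in[of 1] by (simp add: e_def)
  qed (use Yvar e0 Yh gen in \<open>auto simp: fixed_by_def\<close>)
  then show ?thesis using Z unfolding power_invariant_basis_def Y_def by blast
qed

text \<open>The translates of the old generators fall into \<open>L\<close> (from
  \<open>\<theta>0 ^ p\<close>), \<open>S\<close> (the block sums) and the rest. The exchange of
  parameters puts \<open>\<theta> ^ p\<close> and the \<open>swap_coeff j\<close> in place of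
  \<open>e ^ p\<close> and the coefficients of \<open>L\<close>; everything else enters through
  Fourier coefficients divided by powers of \<open>e\<close>.\<close>

lemma power_invariant_basis_step:
  assumes pg: "power_invariant_basis (p ^ k) Z0 \<theta>0" and k: "1 \<le> k"
  shows "\<exists>Z \<theta>. power_invariant_basis (p ^ Suc k) Z \<theta>"
proof -
  define q where "q = p ^ k"
  define s0 :: "'a ratfun" where "s0 = (\<Sum>j\<in>{1..q}. rvar j)"
  define Y0 where "Y0 = {\<theta>0 ^ p, s0} \<union> Z0"
  have good0: "invariant_basis 0 q Y0 \<theta>0" and Z0: "finite Z0" "card Z0 + 2 \<le> q"
    using pg unfolding power_invariant_basis_def Y0_def s0_def q_def by blast+
  have pq: "p \<le> q" using power_increasing[of 1 k p] k p_gt_1 by (simp add: q_def)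
  define \<pi> where "\<pi> c = block_swap (c * q) q" for c
  have inj: "inj (\<pi> c)" for c unfolding \<pi>_def by (rule block_swap_inj) (cases c, auto)
  have endo: "is_endo (perm_act (\<pi> c) :: 'a ratfun \<Rightarrow> _)" for c by (rule is_endo_perm_act[OF inj])
  define \<Theta> where "\<Theta> c = perm_act (\<pi> c) \<theta>0" for c
  define T where "T y c = perm_act (\<pi> c) y" for y :: "'a ratfun" and c
  have good: "invariant_basis (c * q) q (perm_act (\<pi> c) ` Y0) (\<Theta> c)" for c
    using invariant_basis_translate[of k Y0 \<theta>0 "c * q"] good0 unfolding \<Theta>_def \<pi>_def q_def by simp
  have Y0_var: "Y0 \<subseteq> varfield {1..q}" "\<theta>0 \<in> varfield {1..q}" using invariant_basisD(3,4)[OF good0] by auto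
  have T_var: "T y c \<in> varfield {c * q + 1..c * q + q}" if "y \<in> Y0" for y c
    using invariant_basisD(3)[OF good, of c] that by (auto simp: T_def)
  have disj: "{d * q + 1..d * q + q} \<inter> {c * q + 1..c * q + q} = {}" if "c \<noteq> d" for c d
  proof -
    have "Suc c * q \<le> d * q \<or> Suc d * q \<le> c * q"
      using that by (metis Suc_leI linorder_neqE_nat mult_le_mono1)
    then show ?thesis by auto
  qed
  have T_fixed: "perm_act (sigma p i s) (T y d) = T y d"
    if b: "block_in p (c * q) q i s" and y: "y \<in> Y0" for i s c d y
  proof (cases "c = d")
    case True
    then show ?thesis using invariant_basisD(6)[OF good, of c] y block_gensI[OF b] by (auto simp: fixed_by_def T_def)
  next
    case False
    show ?thesis using p_gt_0 block_gensI[OF b] disj[OF False] T_var[OF y] by (rule block_gens_fix)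
  qed
  define L where "L = T (\<theta>0 ^ p)"
  have L: "L c = \<Theta> c ^ p" for c by (simp add: L_def T_def \<Theta>_def is_endoD[OF endo])
  define S where "S = T s0"
  \<comment> \<open>Each generator of level 0 acts on a single factor and multiplies it by
    \<open>\<zeta>\<close>, while the shift of the translates only permutes the factors.\<close>
  define \<theta> where "\<theta> = (\<Prod>c<p. \<Theta> c)"
  define e where "e = fourier S 1"
  have mem: "\<theta>0 ^ p \<in> Y0" "s0 \<in> Y0" "z \<in> Z0 \<Longrightarrow> z \<in> Y0" for z by (auto simp: Y0_def)

  have S: "S c = (\<Sum>j\<in>{1..q}. rvar (c * q + j))" for c
    unfolding S_def T_def s0_def is_endoD(11)[OF endo] perm_act_rvar[OF inj]
    by (intro sum.cong) (auto simp: \<pi>_def block_swap_def add.commute)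
  have e0: "e \<noteq> 0" unfolding e_def fourier_def S using pq p_gt_1 by (intro zeta_linear_form_nonzero) simp
  have sum_S: "(\<Sum>j\<in>{1..p ^ Suc k}. rvar j) = fourier S 0"
    using sum_blocks[of "rvar :: _ \<Rightarrow> 'a ratfun" q p] by (simp add: fourier_def S q_def)
  have \<theta>_nz: "\<theta> \<noteq> 0" unfolding \<theta>_def using invariant_basisD(5)[OF good] by simp
  have \<theta>_power: "\<theta> ^ p = (\<Prod>c<p. L c)" by (simp add: \<theta>_def L prod_power_distrib)

  have \<theta>_sigma: "perm_act (sigma p i s) \<theta> = (if i = 0 then \<zeta> * \<theta> else \<theta>)"
    if b: "block_in p (c * q) q i s" and c: "c < p" for i s c
  proof -
    have "perm_act (sigma p i s) (\<Theta> d) = (if d = c then (if i = 0 then \<zeta> else 1) else 1) * \<Theta> d" for d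
    proof (cases "c = d")
      case True
      then show ?thesis using invariant_basisD(7)[OF good b] by auto
    next
      case False
      then show ?thesis
        using block_gens_fix[OF p_gt_0 block_gensI[OF b] disj[OF False] invariant_basisD(4)[OF good, of d]] by simp
    qed
    then have "perm_act (sigma p i s) \<theta> = (\<Prod>d<p. if d = c then (if i = 0 then \<zeta> else 1) else 1) * \<theta>"
      by (simp add: \<theta>_def is_endoD[OF is_endo_sigma[OF b]] prod.distrib)
    then show ?thesis using c by simp
  qed

  let ?\<sigma> = "perm_act (sigma p 0 1) :: 'a ratfun \<Rightarrow> 'a ratfun"
  \<comment> \<open>The automorphism \<open>\<sigma>\<close> of the exchange is given by
    \<open>sigma p 0 1\<close>, whose block fits into the first subinterval because
    \<open>p \<le> q\<close>.\<close>
  have b0: "block_in p (0 * q) q 0 1" using pq by (simp add: block_in_def)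
  note \<sigma>_endo = is_endo_sigma[OF b0] and \<sigma>_zeta = perm_act_sigma_zeta[OF b0]
  interpret sw: kummer_swap \<zeta> p L e \<theta> ?\<sigma>
  proof
    show "e \<noteq> 0" "\<theta> \<noteq> 0" "\<theta> ^ p = (\<Prod>c<p. L c)" "is_endo ?\<sigma>" "?\<sigma> \<zeta> = \<zeta>"
      by (fact e0 \<theta>_nz \<theta>_power \<sigma>_endo \<sigma>_zeta)+
    show "?\<sigma> \<theta> = \<zeta> * \<theta>" using \<theta>_sigma[OF b0] p_gt_0 by simp
    show "?\<sigma> (L c) = L c" for c unfolding L_def using b0 mem(1) by (rule T_fixed)
  qed

  \<comment> \<open>Together with \<open>\<theta> ^ p\<close> and \<open>fourier S 0\<close> these
    are at most \<open>2 + p + (p - 2) + card Z0 * p\<close> elements, which is within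
    \<open>p * q\<close> by the bound on \<open>card Z0\<close>.\<close>
  define Z where "Z = sw.swap_coeff ` {..<p} \<union> (\<lambda>k. fourier S k / e ^ k) ` {2..<p} \<union>
    (\<lambda>(z, k). fourier (T z) k / e ^ k) ` (Z0 \<times> {..<p})"
  define Y where "Y = {\<theta> ^ p, fourier S 0} \<union> Z"
  have "card Z \<le> p + (p - 2) + card Z0 * p"
  proof -
    have "card (sw.swap_coeff ` {..<p}) \<le> p" using card_image_le[of "{..<p}" sw.swap_coeff] by simp
    moreover have "card ((\<lambda>k. fourier S k / e ^ k) ` {2..<p}) \<le> p - 2"
      using card_image_le[of "{2..<p}" "\<lambda>k. fourier S k / e ^ k"] by simp
    moreover have "card ((\<lambda>(z, k). fourier (T z) k / e ^ k) ` (Z0 \<times> {..<p})) \<le> card Z0 * p"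
      using card_image_le[of "Z0 \<times> {..<p}" "\<lambda>(z, k). fourier (T z) k / e ^ k"] Z0(1)
      by (simp add: card_cartesian_product)
    ultimately show ?thesis unfolding Z_def by (meson add_mono card_Un_le le_trans)
  qed
  moreover have "p + (p - 2) + card Z0 * p + 2 = (card Z0 + 2) * p" using p_gt_1 by (simp add: algebra_simps)
  moreover have "(card Z0 + 2) * p \<le> q * p" using Z0(2) by (rule mult_le_mono1)
  ultimately have card_Z: "card Z + 2 \<le> p ^ Suc k" by (simp add: q_def mult.commute)
  have fin_Z: "finite Z" using Z0(1) by (simp add: Z_def)

  have Y_fixed: "perm_act (sigma p i s) y = y"
    if b: "block_in p (c * q) q i s" and c: "c < p" and y: "y \<in> Y" for i s c y
  proof -
    let ?h = "perm_act (sigma p i s) :: 'a ratfun \<Rightarrow> 'a ratfun"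
    note h = is_endo_sigma[OF b] perm_act_sigma_zeta[OF b]
    have F: "?h (fourier (T z) k) = fourier (T z) k" if "z \<in> Y0" for z k
      using h T_fixed[OF b that] by (rule fourier_fixed)
    have he: "?h e = e" unfolding e_def S_def using mem(2) by (rule F)
    have sc: "?h (sw.swap_coeff j) = sw.swap_coeff j" for j
    proof (rule sw.swap_coeff_fixed[OF h he])
      show "?h (L c) = L c" for c unfolding L_def using b mem(1) by (rule T_fixed)
      show "?h \<theta> = \<theta> \<or> ?h \<theta> = \<zeta> * \<theta>" using \<theta>_sigma[OF b c] by auto
    qed
    have "?h (\<theta> ^ p) = \<theta> ^ p"
      using \<theta>_sigma[OF b c] by (simp add: is_endoD[OF h(1)] power_mult_distrib zeta_power_p)
    moreover have "?h (fourier S k) = fourier S k" for k unfolding S_def using mem(2) by (rule F)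
    ultimately show ?thesis using y sc F mem(3) he
      unfolding Y_def Z_def by (auto simp: is_endoD[OF h(1)])
  qed

  \<comment> \<open>The one generator not inside a subinterval; it shifts the translates
    cyclically.\<close>
  let ?\<tau> = "perm_act (sigma p k 1) :: 'a ratfun \<Rightarrow> 'a ratfun"
  have bk: "block_in p 0 (p ^ Suc k) k 1" using block_in_power_Suc[OF prime_p] by blast
  note \<tau>_endo = is_endo_sigma[OF bk] and \<tau>_zeta = perm_act_sigma_zeta[OF bk]
  have \<tau>_shift: "?\<tau> (perm_act (\<pi> c) f) = perm_act (\<pi> (Suc c mod p)) f" if "c < p" "f \<in> varfield {1..q}" for c f
  proof -
    have "inj (sigma p k 1)" using p_gt_0 by (intro sigma_inj) auto
    then have "?\<tau> (perm_act (\<pi> c) f) = perm_act (sigma p k 1 \<circ> \<pi> c) f" by (rule perm_act_comp[OF _ inj])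
    also have "\<dots> = perm_act (\<pi> (Suc c mod p)) f"
    proof (rule perm_act_cong[OF _ inj _ that(2)])
      show "inj (sigma p k 1 \<circ> \<pi> c)" using \<open>inj (sigma p k 1)\<close> inj by (rule inj_compose)
      show "(sigma p k 1 \<circ> \<pi> c) j = \<pi> (Suc c mod p) j" if "j \<in> {1..q}" for j
        using sigma_top_block_swap[OF \<open>c < p\<close>, of j k] that by (simp add: \<pi>_def q_def)
    qed
    finally show ?thesis .
  qed
  have \<tau>_T: "?\<tau> (T y c) = T y (Suc c mod p)" if "y \<in> Y0" "c < p" for y c
    unfolding T_def using that Y0_var by (intro \<tau>_shift) auto
  have \<tau>_F: "?\<tau> (fourier (T y) l) = \<zeta> ^ l * fourier (T y) l" if "y \<in> Y0" for y l
    using \<tau>_endo \<tau>_zeta \<tau>_T[OF that] by (rule fourier_shift)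
  have \<tau>_e: "?\<tau> e = \<zeta> * e" using \<tau>_F[OF mem(2), of 1] by (simp add: e_def S_def)
  have \<tau>_\<theta>: "?\<tau> \<theta> = \<theta>"
  proof -
    have "?\<tau> \<theta> = (\<Prod>c<p. \<Theta> (Suc c mod p))"
      unfolding \<theta>_def is_endoD(12)[OF \<tau>_endo] \<Theta>_def using Y0_var(2) by (intro prod.cong) (auto intro: \<tau>_shift)
    then show ?thesis unfolding \<theta>_def prod_shift_mod .
  qed
  have \<tau>_sc: "?\<tau> (sw.swap_coeff j) = sw.swap_coeff j" for j
    using \<tau>_endo \<tau>_zeta \<tau>_\<theta> \<tau>_e \<tau>_T[OF mem(1)] unfolding L_def[symmetric] by (rule sw.swap_coeff_shift)
  have \<tau>_Fe: "?\<tau> (fourier (T y) l / e ^ l) = fourier (T y) l / e ^ l" if "y \<in> Y0" for y l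
    using \<tau>_F[OF that, of l] \<tau>_e by (simp add: is_endoD[OF \<tau>_endo] power_mult_distrib)
  have "?\<tau> (fourier S l / e ^ l) = fourier S l / e ^ l" for l unfolding S_def by (rule \<tau>_Fe[OF mem(2)])
  \<comment> \<open>The instance \<open>l = 0\<close> is the invariance of
    \<open>fourier S 0\<close> itself.\<close>
  note \<tau>_S = this this[of 0, simplified]
  have \<tau>_Y: "?\<tau> y = y" if "y \<in> Y" for y
    using that unfolding Y_def Z_def
    by (auto simp: \<tau>_sc \<tau>_S \<tau>_Fe[OF mem(3)]) (simp add: is_endoD[OF \<tau>_endo] \<tau>_\<theta>)

  have gens: "block_gens p 0 (p ^ Suc k) = (\<Union>c<p. block_gens p (c * q) q) \<union> {sigma p k 1}"
    unfolding block_gens_def block_in_power_Suc[OF prime_p] q_def by blast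
  have vars: "{1..p ^ Suc k} = (\<Union>c<p. {c * q + 1..c * q + q})"
  proof (intro equalityI subsetI)
    fix x assume "x \<in> {1..p ^ Suc k}"
    then have x: "x - 1 < p * q" "1 \<le> x" by (auto simp: q_def)
    have q0: "0 < q" using pq p_gt_0 by linarith
    have "(x - 1) div q < p" using x(1) q0 by (simp add: less_mult_imp_div_less)
    moreover have "(x - 1) div q * q + (x - 1) mod q = x - 1" "(x - 1) mod q < q" using q0 by simp_all
    then have "x \<in> {(x - 1) div q * q + 1..(x - 1) div q * q + q}"
      unfolding atLeastAtMost_iff using x(2) by linarith
    ultimately show "x \<in> (\<Union>c<p. {c * q + 1..c * q + q})" by blast
  next
    fix x assume "x \<in> (\<Union>c<p. {c * q + 1..c * q + q})"
    then obtain c where c: "c < p" "c * q + 1 \<le> x" "x \<le> c * q + q" by auto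
    have "Suc c * q \<le> p * q" using c(1) by (intro mult_le_mono1) simp
    then show "x \<in> {1..p ^ Suc k}" using c unfolding q_def power_Suc by simp
  qed

  have T_all: "T y c \<in> varfield {1..p ^ Suc k}" if "y \<in> Y0" "c < p" for y c
    using T_var[OF that(1), of c] varfield_mono[of "{c * q + 1..c * q + q}" "{1..p ^ Suc k}"] that(2)
    unfolding vars by blast
  have F_all: "fourier (T y) l \<in> varfield {1..p ^ Suc k}" if "y \<in> Y0" for y l
    by (rule fourier_in[OF is_subfield_varfield rconst_in_varfield T_all[OF that]])
  have e_all: "e \<in> varfield {1..p ^ Suc k}" unfolding e_def S_def using mem(2) by (rule F_all)
  have \<theta>_all: "\<theta> \<in> varfield {1..p ^ Suc k}"
    unfolding \<theta>_def
  proof (rule is_subfield_prod[OF is_subfield_varfield])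
    show "\<Theta> c \<in> varfield {1..p ^ Suc k}" if "c \<in> {..<p}" for c
      using invariant_basisD(4)[OF good, of c] varfield_mono[of "{c * q + 1..c * q + q}" "{1..p ^ Suc k}"] that
      unfolding vars by blast
  qed
  have sc_all: "sw.swap_coeff j \<in> varfield {1..p ^ Suc k}" for j
  proof -
    note sub = is_subfield_varfield[of "{1..p ^ Suc k}"]
    note zeta_in = rconst_in_varfield[of \<zeta>0 "{1..p ^ Suc k}"]
    have part: "sw.part j \<in> varfield {1..p ^ Suc k}" if "j \<le> p" for j
      unfolding sw.part_def unfolding L_def using T_all[OF mem(1)] that by (intro is_subfield_prod[OF sub]) auto
    have eig: "sw.eigen z \<in> varfield {1..p ^ Suc k}" if "z \<in> varfield {1..p ^ Suc k}" for z
      unfolding sw.eigen_def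
      by (intro is_subfieldD(8,9,10)[OF sub] is_subfield_sum[OF sub] part that) simp
    show ?thesis unfolding sw.swap_coeff_def sw.mu_def
      by (intro is_subfieldD(6,8,9,10)[OF sub] is_subfield_sum[OF sub] eig zeta_in \<theta>_all e_all)
  qed
  have Y_all: "Y \<subseteq> varfield {1..p ^ Suc k}"
    unfolding Y_def Z_def S_def using sc_all F_all mem e_all \<theta>_all
    by (auto intro!: is_subfieldD(8,9)[OF is_subfield_varfield])

  have gen: "generates_invariants ((\<Union>c<p. block_gens p (c * q) q) \<union> {sigma p k 1}) (rvar ` {1..p ^ Suc k}) Y"
    unfolding generates_invariants_def
  proof (intro allI impI subsetI)
    fix B :: "'a ratfun set" and g
    assume B: "is_subfield B" "range rconst \<subseteq> B" "B \<subseteq> fixed_by ((\<Union>c<p. block_gens p (c * q) q) \<union> {sigma p k 1})"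
      and g: "g \<in> field_gen (B \<union> rvar ` {1..p ^ Suc k}) \<inter> fixed_by ((\<Union>c<p. block_gens p (c * q) q) \<union> {sigma p k 1})"
    let ?G = "\<Union>c<p. block_gens p (c * q) q" and ?old = "\<Union>c<p. perm_act (\<pi> c) ` Y0"
    \<comment> \<open>First the invariants of the \<open>p\<close> translated groups together, which
      act on disjoint sets of variables.\<close>
    have "generates_invariants ?G (\<Union>c<p. rvar ` {c * q + 1..c * q + q}) ?old"
    proof (rule generates_invariants_UN)
      show "block_gens p (c * q) q \<subseteq> {g. inj g}" for c by (rule block_gens_subset_inj)
      show "generates_invariants (block_gens p (c * q) q) (rvar ` {c * q + 1..c * q + q}) (perm_act (\<pi> c) ` Y0)" for c
        by (rule invariant_basisD(8)[OF good])
      fix c d :: nat assume "c \<noteq> d"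
      have fixd: "f \<in> fixed_by (block_gens p (c * q) q)" if "f \<in> varfield {d * q + 1..d * q + q}" for f :: "'a ratfun"
        unfolding fixed_by_def using block_gens_fix[OF p_gt_0 _ disj[OF \<open>c \<noteq> d\<close>] that] by blast
      show "rvar ` {d * q + 1..d * q + q} \<subseteq> (fixed_by (block_gens p (c * q) q) :: 'a ratfun set) \<and>
          perm_act (\<pi> d) ` Y0 \<subseteq> fixed_by (block_gens p (c * q) q)"
        using T_var[of _ d] by (auto simp: T_def intro!: fixd rvar_in_varfield)
    qed
    moreover have "(\<Union>c<p. rvar ` {c * q + 1..c * q + q}) = (rvar ` {1..p ^ Suc k} :: 'a ratfun set)"
      unfolding vars image_UN ..
    ultimately have "generates_invariants ?G (rvar ` {1..p ^ Suc k}) ?old" by simp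
    then have g_old: "g \<in> field_gen (B \<union> ?old)"
      by (rule generates_invariantsD[OF _ B(1,2)]) (use B(3) g in \<open>unfold fixed_by_Un, blast\<close>)+
    \<comment> \<open>In the tower \<open>?M\<close>, \<open>?M\<theta>\<close>, \<open>?K\<close>
      the top contains every old generator; then \<open>e\<close> is removed by descent along
      \<open>?\<tau>\<close> and \<open>\<theta>\<close> by descent along
      \<open>?\<sigma>\<close>.\<close>
    let ?M = "field_gen (B \<union> Y)"
    let ?M\<theta> = "field_gen (?M \<union> {\<theta>})"
    let ?K = "field_gen (?M\<theta> \<union> {e})"
    have M: "B \<subseteq> ?M" "Y \<subseteq> ?M" using field_gen_superset[of "B \<union> Y"] by auto
    have M\<theta>: "?M \<subseteq> ?M\<theta>" "\<theta> \<in> ?M\<theta>" using field_gen_superset[of "?M \<union> {\<theta>}"] by auto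
    have K: "?M\<theta> \<subseteq> ?K" "e \<in> ?K" using field_gen_superset[of "?M\<theta> \<union> {e}"] by auto
    have zM: "\<zeta> \<in> ?M" using B M by blast
    have YK: "Y \<subseteq> ?K" using M M\<theta> K by blast
    have sc_Y: "sw.swap_coeff j \<in> Y" if "j < p" for j using that by (auto simp: Y_def Z_def)
    have F_Y: "fourier (T z) k / e ^ k \<in> Y" if "z \<in> Z0" "k < p" for z k using that by (force simp: Y_def Z_def)
    have LK: "L c \<in> ?K" if "c < p" for c
      by (rule sw.L_in[OF is_subfield_field_gen _ _ _ K(2) that]) (use zM M\<theta> K YK sc_Y in blast)+
    have cancel: "f \<in> ?K" if "f / e ^ k \<in> ?K" for f k
    proof -
      have "f / e ^ k * e ^ k \<in> ?K" using that K(2) by (intro is_subfieldD(6,9)[OF is_subfield_field_gen])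
      then show ?thesis using e0 by simp
    qed
    have SF: "fourier S k \<in> ?K" if k: "k < p" for k
    proof -
      consider "k = 0" | "k = 1" | "k \<in> {2..<p}" using k by force
      then show ?thesis
      proof cases
        case 1
        have "fourier S 0 \<in> Y" by (simp add: Y_def)
        then show ?thesis using 1 YK by blast
      next
        case 2
        then show ?thesis using K by (simp add: e_def)
      next
        case 3
        then have "fourier S k / e ^ k \<in> Y" by (auto simp: Y_def Z_def)
        then show ?thesis using YK cancel by blast
      qed
    qed
    have zK: "\<zeta> \<in> ?K" using zM M\<theta> K by blast
    have SK: "S c \<in> ?K" if "c < p" for c
      by (rule fourier_recover[OF is_subfield_field_gen zK SF that])
    have ZK: "T z c \<in> ?K" if z: "z \<in> Z0" and c: "c < p" for z c
    proof (rule fourier_recover[OF is_subfield_field_gen zK _ c])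
      show "fourier (T z) k \<in> ?K" if "k < p" for k using F_Y[OF z that] YK cancel by blast
    qed
    have "T y c \<in> ?K" if "y \<in> Y0" "c < p" for y c
      using that LK[of c] SK[of c] ZK[of y c] unfolding Y0_def L_def S_def by blast
    then have "?old \<subseteq> ?K" unfolding T_def by blast
    then have "B \<union> ?old \<subseteq> ?K" using M M\<theta> K by blast
    then have gK: "g \<in> ?K" using g_old field_gen_least[OF is_subfield_field_gen] by blast
    have \<tau>_M: "?\<tau> b = b" if "b \<in> ?M" for b
      by (rule field_gen_fixed[OF \<tau>_endo _ that]) (use B(3) \<tau>_Y in \<open>auto simp: fixed_by_def\<close>)
    have "g \<in> ?M\<theta>"
    proof (rule kummer_descent[OF is_subfield_field_gen _ _ \<tau>_endo _ \<tau>_e gK])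
      show z: "\<zeta> \<in> ?M\<theta>" using zM M\<theta> by blast
      show "e ^ p \<in> ?M\<theta>"
        by (rule sw.e_power_in[OF is_subfield_field_gen z M\<theta>(2)]) (use sc_Y M M\<theta> in blast)
      show "?\<tau> b = b" if "b \<in> ?M\<theta>" for b
        by (rule field_gen_fixed[OF \<tau>_endo _ that]) (use \<tau>_M \<tau>_\<theta> in auto)
      show "?\<tau> g = g" using g by (simp add: fixed_by_def)
    qed
    have s0_in: "sigma p 0 1 \<in> ?G" using block_gensI[OF b0] p_gt_0 by blast
    have \<sigma>_B: "?\<sigma> f = f" if "f \<in> fixed_by (?G \<union> {sigma p k 1})" for f
      using that s0_in unfolding fixed_by_def by blast
    show "g \<in> ?M"
    proof (rule kummer_descent[OF is_subfield_field_gen zM _ \<sigma>_endo _ sw.sigma_theta \<open>g \<in> ?M\<theta>\<close>])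
      have "\<theta> ^ p \<in> Y" by (simp add: Y_def)
      then show "\<theta> ^ p \<in> ?M" using M by blast
      show "?\<sigma> b = b" if "b \<in> ?M" for b
        by (rule field_gen_fixed[OF \<sigma>_endo _ that]) (use B(3) \<sigma>_B Y_fixed[OF b0 p_gt_0] in blast)
      show "?\<sigma> g = g" using g \<sigma>_B by blast
    qed
  qed
  have Y_fixed_by: "Y \<subseteq> fixed_by ((\<Union>c<p. block_gens p (c * q) q) \<union> {sigma p k 1})"
    using Y_fixed \<tau>_Y by (auto simp: fixed_by_def block_gens_def)
  \<comment> \<open>The hypothesis \<open>1 \<le> k\<close> enters here: the top generator has level
    \<open>k\<close>, not 0, so the character requires it to fix \<open>\<theta>\<close>.\<close>
  have eig: "perm_act (sigma p i s) \<theta> = (if i = 0 then \<zeta> * \<theta> else \<theta>)"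
    if "block_in p 0 (p ^ Suc k) i s" for i s
    using that \<theta>_sigma \<tau>_\<theta> k unfolding block_in_power_Suc[OF prime_p] q_def by auto
  have "finite Y" "card Y \<le> p ^ Suc k"
    using card_insert2_le[OF fin_Z card_Z, of "\<theta> ^ p" "fourier S 0"] unfolding Y_def by blast+
  then have "invariant_basis 0 (p ^ Suc k) Y \<theta>" unfolding invariant_basis_def gens add_0
    by (intro conjI Y_all \<theta>_all \<theta>_nz Y_fixed_by gen allI impI eig)
  then show ?thesis using fin_Z card_Z unfolding power_invariant_basis_def sum_S Y_def by blast
qed

section \<open>Invariant bases for arbitrary length\<close>

lemma invariant_basis_one: "invariant_basis 0 1 {rvar 1} 1"
proof -
  have "\<not> block_in p 0 1 i s" for i s
  proof
    assume b: "block_in p 0 1 i s"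
    then obtain t where t: "s = Suc t" by (cases s) (auto simp: block_in_def)
    have "p ^ (i + 1) \<le> 1" using b unfolding block_in_def t by simp
    moreover have "p ^ 1 \<le> p ^ (i + 1)" by (intro power_increasing) (use p_gt_1 in auto)
    ultimately show False using p_gt_1 unfolding power_one_right by linarith
  qed
  then show ?thesis unfolding invariant_basis_def block_gens_def
    by (auto simp: fixed_by_def generates_invariants_empty rvar_in_varfield is_subfieldD(1)[OF is_subfield_varfield])
qed

lemma invariant_basis_zero: "invariant_basis 0 0 {} 1"
proof -
  have "\<not> block_in p 0 0 i s" for i s using p_gt_0 by (auto simp: block_in_def)
  then show ?thesis unfolding invariant_basis_def block_gens_def
    by (auto simp: generates_invariants_empty is_subfieldD(1)[OF is_subfield_varfield])
qed

lemma invariant_basis_power: "\<exists>Y \<theta>. invariant_basis 0 (p ^ k) Y \<theta> \<and> (k \<ge> 1 \<longrightarrow> \<theta> ^ p \<in> Y) \<and> (k = 0 \<longrightarrow> \<theta> = 1)"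
proof (cases "k = 0")
  case True
  then show ?thesis using invariant_basis_one by auto
next
  case False
  then have k: "1 \<le> k" by simp
  then have "\<exists>Z \<theta>. power_invariant_basis (p ^ k) Z \<theta>"
  proof (induction rule: dec_induct)
    case base
    show ?case using power_invariant_basis_base by simp
  next
    case (step k)
    then show ?case using power_invariant_basis_step by blast
  qed
  then show ?thesis using k unfolding power_invariant_basis_def by (metis UnI1 insertI1 not_one_le_zero)
qed

text \<open>With \<open>q\<close> the exact power of \<open>p\<close> dividing \<open>n\<close>, the
  interval splits into \<open>{1..n - q}\<close> and a translate of \<open>{1..q}\<close> without
  cutting a block. For \<open>n < p\<close> there is no block and \<open>\<theta> = 1\<close> stands
  for the trivial character.\<close>

lemma invariant_basis_exists: "\<exists>Y \<theta>. invariant_basis 0 n Y \<theta> \<and> (p \<le> n \<longrightarrow> \<theta> ^ p \<in> Y) \<and> (n < p \<longrightarrow> \<theta> = 1)"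
proof (induction n rule: less_induct)
  case (less n)
  show ?case
  proof (cases "n = 0")
    case True
    then show ?thesis using invariant_basis_zero p_gt_0 by auto
  next
    case False
    define j where "j = multiplicity p n"
    define q where "q = p ^ j"
    define m where "m = n - q"
    have p_unit: "\<not> is_unit p" using p_gt_1 by simp
    have q_dvd: "q dvd n" unfolding q_def j_def by (rule multiplicity_dvd)
    have not_dvd: "\<not> p ^ Suc j dvd n"
      using power_dvd_iff_le_multiplicity[of n p "Suc j"] False p_unit by (simp add: j_def)
    have q_le: "q \<le> n" "0 < q" using q_dvd False p_gt_0 by (auto simp: q_def dest: dvd_imp_le)
    have n: "n = m + q" using q_le by (simp add: m_def)
    have q_dvd_m: "q dvd m" using q_dvd by (simp add: m_def dvd_diff_nat)
    obtain Y0 \<theta>0 where 0: "invariant_basis 0 m Y0 \<theta>0" "p \<le> m \<Longrightarrow> \<theta>0 ^ p \<in> Y0" "m < p \<Longrightarrow> \<theta>0 = 1"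
      using less[of m] q_le n by auto
    obtain Yq \<theta>q where 1: "invariant_basis 0 q Yq \<theta>q" "j \<ge> 1 \<Longrightarrow> \<theta>q ^ p \<in> Yq" "j = 0 \<Longrightarrow> \<theta>q = 1"
      using invariant_basis_power[of j] unfolding q_def by blast
    let ?h = "perm_act (block_swap m q) :: 'a ratfun \<Rightarrow> 'a ratfun"
    define Y1 where "Y1 = ?h ` Yq"
    define t where "t = ?h \<theta>q"
    have "m = 0 \<or> q \<le> m" using q_dvd_m by (auto dest: dvd_imp_le)
    then have endo: "is_endo ?h" by (intro is_endo_perm_act block_swap_inj)
    have g1: "invariant_basis m q Y1 t"
      using invariant_basis_translate[of j Yq \<theta>q m] 1(1) q_dvd_m unfolding q_def Y1_def t_def by blast
    have tp: "t ^ p \<in> Y1" if "j \<ge> 1"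
      using imageI[OF 1(2)[OF that], of ?h] by (simp add: Y1_def t_def is_endoD[OF endo])
    have g: "invariant_basis 0 n (Y0 \<union> Y1) (\<theta>0 * t)" unfolding n
    proof (rule invariant_basis_merge[OF 0(1) g1])
      show "block_in p 0 (m + q) i s \<longleftrightarrow> block_in p 0 m i s \<or> block_in p m q i s" for i s
        unfolding q_def by (rule block_in_add_power[OF prime_p])
          (use q_dvd_m not_dvd n in \<open>simp_all add: q_def\<close>)
    qed
    show ?thesis
    proof (cases "j = 0")
      case True
      then have t1: "t = 1" and q1: "q = 1" using 1(3) is_endoD(1)[OF endo] by (simp_all add: t_def q_def)
      \<comment> \<open>Here \<open>m = n - 1\<close>, and \<open>n = p\<close> would be the one
        case in which \<open>p \<le> n\<close> but not \<open>p \<le> m\<close>.\<close>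
      have "n \<noteq> p" using not_dvd True by auto
      then have "p \<le> n \<Longrightarrow> p \<le> m" "n < p \<Longrightarrow> m < p" using n q1 by auto
      then show ?thesis using g 0(2,3) t1 by (intro exI[of _ "Y0 \<union> Y1"] exI[of _ \<theta>0]) auto
    next
      case False
      then have tp: "t ^ p \<in> Y1" using tp by simp
      \<comment> \<open>The new \<open>p\<close>-th power takes the place of \<open>t ^ p\<close>,
        so the count does not grow; \<open>t ^ p\<close> is recovered on division by
        \<open>\<theta>0 ^ p\<close>.\<close>
      define Y where "Y = insert ((\<theta>0 * t) ^ p) (Y0 \<union> (Y1 - {t ^ p}))"
      note sub = is_subfield_field_gen
      \<comment> \<open>For \<open>m < p\<close> this rests on the convention
        \<open>\<theta>0 = 1\<close>.\<close>
      have r_in: "\<theta>0 ^ p \<in> field_gen (range rconst \<union> V)" if "Y0 \<subseteq> V" for V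
        using 0(2,3) that field_gen_superset[of "range rconst \<union> V"] is_subfieldD(1)[OF sub]
        by (cases "p \<le> m") auto
      have "invariant_basis 0 n Y (\<theta>0 * t)"
      proof (rule invariant_basis_change[OF g])
        show "finite Y" using invariant_basisD(1)[OF 0(1)] invariant_basisD(1)[OF g1] by (simp add: Y_def)
        have "card Y \<le> Suc (card (Y0 \<union> (Y1 - {t ^ p})))" unfolding Y_def by (rule card_insert_le_m1) simp_all
        also have "\<dots> \<le> Suc (card Y0 + card (Y1 - {t ^ p}))" by (simp add: card_Un_le)
        also have "\<dots> = card Y0 + card Y1" using card_Suc_Diff1[OF invariant_basisD(1)[OF g1] tp] by simp
        also have "\<dots> \<le> n" using invariant_basisD(2)[OF 0(1)] invariant_basisD(2)[OF g1] n by simp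
        finally show "card Y \<le> n" .
        have V: "Y0 \<union> Y1 \<subseteq> field_gen (range rconst \<union> (Y0 \<union> Y1))"
          using field_gen_superset[of "range rconst \<union> (Y0 \<union> Y1)"] by blast
        have "\<theta>0 ^ p * t ^ p \<in> field_gen (range rconst \<union> (Y0 \<union> Y1))"
          by (rule is_subfieldD(6)[OF sub r_in]) (use V tp in auto)
        then show "Y \<subseteq> field_gen (range rconst \<union> (Y0 \<union> Y1))"
          using V by (auto simp: Y_def power_mult_distrib)
        have V': "Y \<subseteq> field_gen (range rconst \<union> Y)"
          using field_gen_superset[of "range rconst \<union> Y"] by blast
        have "(\<theta>0 * t) ^ p / \<theta>0 ^ p \<in> field_gen (range rconst \<union> Y)"
          by (rule is_subfieldD(8)[OF sub _ r_in]) (use V' in \<open>auto simp: Y_def\<close>)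
        then have "t ^ p \<in> field_gen (range rconst \<union> Y)"
          using invariant_basisD(5)[OF 0(1)] by (simp add: power_mult_distrib)
        then show "Y0 \<union> Y1 \<subseteq> field_gen (range rconst \<union> Y)" using V' unfolding Y_def by blast
      qed
      moreover have "\<not> n < p" using q_le power_increasing[of 1 j p] False p_gt_1 by (auto simp: q_def)
      ultimately show ?thesis by (intro exI[of _ Y] exI[of _ "\<theta>0 * t"]) (auto simp: Y_def)
    qed
  qed
qed

end

section \<open>The field fixed by its subgroup\<close>

lemma permutes_disjoint_commute:
  assumes "g permutes A" "h permutes B" "A \<inter> B = {}"
  shows "g \<circ> h = h \<circ> g"
proof
  fix x
  consider "x \<in> A" | "x \<in> B" | "x \<notin> A" "x \<notin> B" by blast
  then show "(g \<circ> h) x = (h \<circ> g) x"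
  proof cases
    case 1
    then have "g x \<in> A" using permutes_in_image[OF assms(1)] by simp
    then have "g x \<notin> B" "x \<notin> B" using 1 assms(3) by blast+
    then show ?thesis using permutes_not_in[OF assms(2)] by simp
  next
    case 2
    then have "h x \<in> B" using permutes_in_image[OF assms(2)] by simp
    then have "h x \<notin> A" "x \<notin> A" using 2 assms(3) by blast+
    then show ?thesis using permutes_not_in[OF assms(1)] by simp
  next
    case 3
    then show ?thesis using permutes_not_in[OF assms(1)] permutes_not_in[OF assms(2)] by simp
  qed
qed

section \<open>Relations among the generators\<close>

lemma sigma_commute:
  assumes "1 \<le> s" "1 \<le> s'" "0 < p"
  shows "sigma p 0 s \<circ> sigma p 0 s' = sigma p 0 s' \<circ> sigma p 0 s"
proof (cases "s = s'")
  case False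
  have "{(s - 1) * p ^ (0 + 1) <.. s * p ^ (0 + 1)} \<inter> {(s' - 1) * p ^ (0 + 1) <.. s' * p ^ (0 + 1)} = {}"
  proof -
    have "s \<le> s' - 1 \<or> s' \<le> s - 1" using False by linarith
    then have "s * p \<le> (s' - 1) * p \<or> s' * p \<le> (s - 1) * p" using mult_le_mono1 by blast
    then show ?thesis by auto
  qed
  then show ?thesis
    using sigma_permutes_block[OF assms(1,3), of 0] sigma_permutes_block[OF assms(2,3), of 0]
    by (intro permutes_disjoint_commute)
qed simp

text \<open>For \<open>t = 1\<close> the interval \<open>{1..p}\<close> is translated by
  \<open>p ^ i\<close>; otherwise the supports are disjoint. The lemma serves to show that images of
  an \<open>H\<close>-invariant under \<open>sigma p 0 1\<close> stay invariant under the generators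
  of higher level.\<close>

lemma sigma_conj_first:
  assumes "1 < p" "1 \<le> i" "block_in p 0 n i t"
  shows "\<exists>s. 1 \<le> s \<and> s \<le> n div p \<and> sigma p i t \<circ> sigma p 0 1 = sigma p 0 s \<circ> sigma p i t"
proof -
  have p0: "0 < p" using assms(1) by simp
  have t: "1 \<le> t" "t * p ^ (i + 1) \<le> n" using assms(3) by (auto simp: block_in_def)
  have pi: "p ^ 1 \<le> p ^ i" using assms by (intro power_increasing) auto
  have "p ^ i * 2 \<le> p ^ i * p" using assms(1) by (intro mult_le_mono2) simp
  then have pi': "p ^ i + p ^ i \<le> p ^ (i + 1)" unfolding power_add power_one_right by linarith
  have pn: "p ^ (i + 1) \<le> n" using t by (metis le_trans mult_le_mono1 mult_1)
  show ?thesis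
  proof (cases "t = 1")
    case True
    \<comment> \<open>The level 0 block \<open>{p ^ i + 1..p ^ i + p}\<close>, onto which
      \<open>sigma p i 1\<close> moves \<open>{1..p}\<close>.\<close>
    define s where "s = 1 + p ^ (i - 1)"
    have pp: "p ^ (i - 1) * p ^ (0 + 1) = p ^ i" using assms(2) by (simp flip: power_Suc2)
    have "s * p \<le> n" using pp pi pi' pn by (simp add: s_def algebra_simps)
    then have sn: "s \<le> n div p" using p0 by (simp add: less_eq_div_iff_mult_less_eq)
    have "{0<..p} = {1..p}" by auto
    then have perm0: "sigma p 0 1 permutes {1..p}" using sigma_permutes_block[of 1 p 0] p0 by simp
    have move: "sigma p i 1 x = x + p ^ i" if "x \<in> {1..p}" for x
      using that pi pi' by (auto simp: sigma_def)
    have inj: "inj (sigma p i 1)" using p0 by (intro sigma_inj) auto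
    have "(sigma p i 1 \<circ> sigma p 0 1) x = (sigma p 0 s \<circ> sigma p i 1) x" for x
    proof (cases "x \<in> {1..p}")
      case True
      have "sigma p 0 1 x \<in> {1..p}" using permutes_in_image[OF perm0] True by blast
      then show ?thesis using move[OF True] move sigma_shift[of 1 p 0 "p ^ (i - 1)" x] p0
        unfolding pp s_def[symmetric] by simp
    next
      case False
      let ?y = "sigma p i 1 x"
      have "?y \<notin> {(s - 1) * p ^ (0 + 1) <.. s * p ^ (0 + 1)}"
      proof
        assume y: "?y \<in> {(s - 1) * p ^ (0 + 1) <.. s * p ^ (0 + 1)}"
        have "(s - 1) * p ^ (0 + 1) = p ^ i" "s * p ^ (0 + 1) = p + p ^ i"
          using pp by (simp_all add: s_def algebra_simps)
        then have "p ^ i < ?y" "?y \<le> p + p ^ i" using y by auto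
        then have z: "?y - p ^ i \<in> {1..p}" by auto
        then have "sigma p i 1 (?y - p ^ i) = ?y" using move[OF z] \<open>p ^ i < ?y\<close> by simp
        then have "?y - p ^ i = x" using inj by (simp add: inj_eq)
        then show False using z False by simp
      qed
      then have "sigma p 0 s ?y = ?y" by (rule sigma_fixed)
      moreover have "sigma p 0 1 x = x" using permutes_not_in[OF perm0 False] .
      ultimately show ?thesis by simp
    qed
    then have "sigma p i 1 \<circ> sigma p 0 1 = sigma p 0 s \<circ> sigma p i 1" by blast
    then show ?thesis using sn True by (intro exI[of _ s]) (simp add: s_def)
  next
    case False
    then have "1 * p ^ (i + 1) \<le> (t - 1) * p ^ (i + 1)" using t by (intro mult_le_mono1) linarith
    then have "p ^ (i + 1) \<le> (t - 1) * p ^ (i + 1)" by (simp only: mult_1)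
    then have "p \<le> (t - 1) * p ^ (i + 1)" using pi pi' unfolding power_one_right by linarith
    then have disj: "{(t - 1) * p ^ (i + 1) <.. t * p ^ (i + 1)} \<inter> {(1 - 1) * p ^ (0 + 1) <.. 1 * p ^ (0 + 1)} = {}"
      by auto
    have "sigma p i t \<circ> sigma p 0 1 = sigma p 0 1 \<circ> sigma p i t"
      by (rule permutes_disjoint_commute[OF sigma_permutes_block[OF t(1) p0] sigma_permutes_block[OF order_refl p0] disj])
    moreover have "1 \<le> n div p" using pn pi pi' p0 by (simp add: less_eq_div_iff_mult_less_eq)
    ultimately show ?thesis by blast
  qed
qed

lemma sigma_funpow_p:
  assumes "1 < p"
  shows "sigma p 0 1 ^^ p = id"
proof
  fix x
  show "(sigma p 0 1 ^^ p) x = id x"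
  proof (cases "x \<in> {1..p}")
    case True
    then obtain k where k: "x = k + 1" "k < p" by (intro that[of "x - 1"]) auto
    have "(sigma p 0 1 ^^ c) (k + 1) = (k + c) mod p + 1" for c
    proof (induction c)
      case (Suc c)
      have "sigma p 0 1 ((k + c) mod p + 1) = Suc ((k + c) mod p) mod p + 1"
        using sigma_cycle[of 1 "(k + c) mod p" p 1 0] assms by simp
      then show ?case using Suc by (simp add: mod_Suc_eq)
    qed (use k in simp)
    then show ?thesis using k by simp
  next
    case False
    then have "sigma p 0 1 x = x" by (intro sigma_fixed) auto
    then have "(sigma p 0 1 ^^ c) x = x" for c by (induction c) simp_all
    then show ?thesis by simp
  qed
qed

lemma perm_act_funpow: "inj g \<Longrightarrow> (perm_act g ^^ c) f = perm_act (g ^^ c) f"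
proof (induction c)
  case (Suc c)
  moreover have "inj (g ^^ c)" using Suc.prems by (induction c) (auto intro: inj_compose)
  ultimately show ?case by (simp add: perm_act_comp o_def)
qed (simp add: perm_act_id flip: id_def)

lemma fixed_by_generate:
  assumes "A \<subseteq> carrier (sym_group n)"
  shows "fixed_by (generate (sym_group n) A) = fixed_by A"
proof
  show "fixed_by (generate (sym_group n) A) \<subseteq> fixed_by A"
    by (auto simp: fixed_by_def intro: generate.incl)
  show "fixed_by A \<subseteq> fixed_by (generate (sym_group n) A)"
  proof
    fix f assume f: "f \<in> fixed_by A"
    have perm: "g permutes {1..n}" if "g \<in> A" for g using that assms by (auto simp: sym_group_carrier)
    have sub: "g permutes {1..n}" if "g \<in> generate (sym_group n) A" for g
      using group.generate_in_carrier[OF sym_group_is_group assms that] by (simp add: sym_group_carrier)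
    have "perm_act g f = f" if "g \<in> generate (sym_group n) A" for g
      using that
    proof (induction rule: generate.induct)
      case one
      show ?case using perm_act_id[of f] by (simp add: sym_group_one id_def)
    next
      case (incl h)
      then show ?case using f by (simp add: fixed_by_def)
    next
      case (inv h)
      have h: "h permutes {1..n}" using perm inv by blast
      have "perm_act (inv' h) (perm_act h f) = f"
        using perm_act_comp[OF permutes_inj[OF permutes_inv[OF h]] permutes_inj[OF h], of f]
        by (simp add: permutes_inv_o(2)[OF h] perm_act_id)
      moreover have "perm_act h f = f" using f inv by (simp add: fixed_by_def)
      ultimately show ?case using h by (simp add: sym_group_carrier sym_group_inv_equality)
    next
      case (eng h1 h2)
      then show ?case
        using perm_act_comp[OF permutes_inj[OF sub[OF eng(1)]] permutes_inj[OF sub[OF eng(2)]], of f]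
        by (simp add: sym_group_mult o_def)
    qed
    then show "f \<in> fixed_by (generate (sym_group n) A)" by (simp add: fixed_by_def)
  qed
qed

lemma H_gens_subset:
  assumes "0 < p"
  shows "H_gens n p \<subseteq> carrier (sym_group n)"
proof -
  interpret group "sym_group n" by (rule sym_group_is_group)
  have s: "sigma p i s \<in> carrier (sym_group n)" if "1 \<le> s" "s \<le> n div p ^ (i + 1)" for i s
    using sigma_permutes[OF that assms] by (simp add: sym_group_carrier)
  show ?thesis
    unfolding H_gens_def using s s[of _ 0]
    by (auto intro!: m_closed inv_closed simp del: sym_group_inv_equality)
qed

lemma block_in_0_iff: "0 < p \<Longrightarrow> block_in p 0 n i s \<longleftrightarrow> 1 \<le> s \<and> s \<le> n div p ^ (i + 1)"
  by (simp add: block_in_def less_eq_div_iff_mult_less_eq)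

text \<open>Since the level 0 cycles commute, the product of one with the inverse of another fixes
  \<open>f\<close> exactly when both have the same effect on \<open>f\<close>.\<close>

lemma fixed_by_H_gens:
  assumes "1 < p" "1 \<le> n"
  shows "f \<in> fixed_by (H_gens n p) \<longleftrightarrow>
    (\<forall>s s'. 1 \<le> s \<and> s \<le> n div p \<and> 1 \<le> s' \<and> s' \<le> n div p \<longrightarrow>
       perm_act (sigma p 0 s) f = perm_act (sigma p 0 s') f) \<and>
    (\<forall>i s. 1 \<le> i \<longrightarrow> block_in p 0 n i s \<longrightarrow> perm_act (sigma p i s) f = f)"
proof -
  have p0: "0 < p" using assms by simp
  \<comment> \<open>A block inside \<open>{1..n}\<close> gives \<open>p ^ (i + 1) \<le> n\<close>,
    here put into logarithmic form.\<close>
  have log: "int i \<le> \<lfloor>log (real p) (real n)\<rfloor> - 1" if "block_in p 0 n i s" for i s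
  proof -
    have "1 * p ^ (i + 1) \<le> s * p ^ (i + 1)" using that by (intro mult_le_mono1) (auto simp: block_in_def)
    moreover have "s * p ^ (i + 1) \<le> n" using that by (simp add: block_in_def)
    ultimately have "p ^ (i + 1) \<le> n" unfolding mult_1 by (rule order_trans)
    then have "real p ^ (i + 1) \<le> real n" by (metis of_nat_le_iff of_nat_power)
    then have "real (i + 1) \<le> log (real p) (real n)"
      using assms by (subst le_log_iff) (simp_all add: powr_realpow del: power_Suc of_nat_add of_nat_Suc)
    then show ?thesis by linarith
  qed
  have prod: "perm_act (sigma p 0 s \<otimes>\<^bsub>sym_group n\<^esub> inv\<^bsub>sym_group n\<^esub> (sigma p 0 s')) f = f \<longleftrightarrow>
      perm_act (sigma p 0 s) f = perm_act (sigma p 0 s') f"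
    if "1 \<le> s" "s \<le> n div p" "1 \<le> s'" "s' \<le> n div p" for s s'
  proof -
    have g: "sigma p 0 s permutes {1..n}" "sigma p 0 s' permutes {1..n}"
      using sigma_permutes[of s n p 0] sigma_permutes[of s' n p 0] that p0 by auto
    note inj = permutes_inj[OF g(1)] permutes_inj[OF g(2)] permutes_inj[OF permutes_inv[OF g(2)]]
    let ?g = "sigma p 0 s" and ?h = "sigma p 0 s'" and ?k = "inv' (sigma p 0 s')"
    have k: "?k \<circ> ?h = id" "?h \<circ> ?k = id" using permutes_inv_o[OF g(2)] by auto
    have "?g \<circ> ?k = (?k \<circ> ?h) \<circ> ?g \<circ> ?k" by (simp add: k)
    also have "\<dots> = ?k \<circ> (?h \<circ> ?g) \<circ> ?k" by (simp add: o_assoc)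
    also have "\<dots> = ?k \<circ> ?g \<circ> (?h \<circ> ?k)"
      by (simp only: sigma_commute[OF that(3,1) p0] o_assoc)
    finally have "?g \<circ> ?k = ?k \<circ> ?g" by (simp add: k)
    moreover have "sigma p 0 s \<otimes>\<^bsub>sym_group n\<^esub> inv\<^bsub>sym_group n\<^esub> (sigma p 0 s') = ?g \<circ> ?k"
      using g by (simp add: sym_group_mult sym_group_carrier sym_group_inv_equality)
    ultimately have 1: "perm_act (sigma p 0 s \<otimes>\<^bsub>sym_group n\<^esub> inv\<^bsub>sym_group n\<^esub> (sigma p 0 s')) f =
        perm_act ?k (perm_act ?g f)" by (simp add: perm_act_comp inj)
    have 2: "perm_act ?k (perm_act ?h u) = u" "perm_act ?h (perm_act ?k u) = u" for u :: "'a ratfun"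
      by (simp_all add: perm_act_comp inj k perm_act_id)
    show ?thesis unfolding 1 using 2 by metis
  qed
  show ?thesis (is "_ \<longleftrightarrow> ?R")
  proof
    assume f: "f \<in> fixed_by (H_gens n p)"
    have "perm_act (sigma p 0 s) f = perm_act (sigma p 0 s') f"
      if "1 \<le> s" "s \<le> n div p" "1 \<le> s'" "s' \<le> n div p" for s s'
    proof -
      have "sigma p 0 s \<otimes>\<^bsub>sym_group n\<^esub> inv\<^bsub>sym_group n\<^esub> (sigma p 0 s') \<in> H_gens n p"
        unfolding H_gens_def using that by blast
      then show ?thesis using f prod[OF that] by (simp add: fixed_by_def)
    qed
    moreover have "perm_act (sigma p i s) f = f" if "1 \<le> i" "block_in p 0 n i s" for i s
    proof -
      have "sigma p i s \<in> H_gens n p"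
        unfolding H_gens_def using that log[OF that(2)] block_in_0_iff[OF p0] by blast
      then show ?thesis using f by (simp add: fixed_by_def)
    qed
    ultimately show ?R by blast
  next
    assume R: ?R
    show "f \<in> fixed_by (H_gens n p)" unfolding fixed_by_def
    proof (intro CollectI ballI)
      fix g assume "g \<in> H_gens n p"
      then consider s s' where "g = sigma p 0 s \<otimes>\<^bsub>sym_group n\<^esub> inv\<^bsub>sym_group n\<^esub> (sigma p 0 s')"
          "1 \<le> s" "s \<le> n div p" "1 \<le> s'" "s' \<le> n div p"
        | i s where "g = sigma p i s" "1 \<le> i" "block_in p 0 n i s"
        unfolding H_gens_def using block_in_0_iff[OF p0] by blast
      then show "perm_act g f = f"
      proof cases
        case 1
        then show ?thesis using R prod by blast
      next
        case 2
        then show ?thesis using R by blast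
      qed
    qed
  qed
qed

text \<open>The variables are algebraic over the fixed field, so \<open>alg_indepI\<close> makes any
  enumeration of generators by \<open>{1..n}\<close> independent.\<close>

lemma rational_over_fixed_field:
  fixes Y :: "'a::field_char_0 ratfun set"
  assumes "\<And>g. g \<in> G \<Longrightarrow> g permutes {1..n}" "1 \<le> n" "finite Y" "card Y \<le> n"
    and eq: "fixed_field n G = field_gen (range rconst \<union> Y)"
  shows "rational_over rconst (fixed_field n G :: 'a ratfun set)"
proof -
  \<comment> \<open>The enumeration has exactly \<open>n\<close> terms: surplus indices repeat an
    element of \<open>Y\<close>, and for empty \<open>Y\<close> the value 0 is used, which does not
    change the field.\<close>
  obtain y where y: "y ` {1..n} = insert 0 Y \<or> y ` {1..n} = Y"
  proof (cases "Y = {}")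
    case True
    then show ?thesis using assms(2) by (intro that[of "\<lambda>_. 0"]) auto
  next
    case False
    obtain h where h: "bij_betw h {0..<card Y} Y" using ex_bij_betw_nat_finite[OF assms(3)] by blast
    have c: "0 < card Y" using False assms(3) by (simp add: card_gt_0_iff)
    have "(\<lambda>i. min (i - 1) (card Y - 1)) ` {1..n} = {0..<card Y}"
    proof (intro equalityI subsetI)
      fix k assume "k \<in> {0..<card Y}"
      then show "k \<in> (\<lambda>i. min (i - 1) (card Y - 1)) ` {1..n}"
        using assms(4) by (intro image_eqI[of _ _ "k + 1"]) auto
    qed (use c in auto)
    then have "(\<lambda>i. h (min (i - 1) (card Y - 1))) ` {1..n} = Y"
      using h unfolding bij_betw_def by (metis image_image)
    then show ?thesis by (intro that) blast
  qed
  have "field_gen (range rconst \<union> insert 0 Y) = field_gen (range rconst \<union> Y)"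
    using is_subfieldD(2)[OF is_subfield_field_gen, of "range rconst \<union> Y"] field_gen_superset[of "range rconst \<union> Y"]
    by (intro equalityI field_gen_mono field_gen_least[OF is_subfield_field_gen]) auto
  then have K: "fixed_field n G = field_gen (range rconst \<union> y ` {1..n})" using y eq by auto
  have "alg_indep rconst n y"
    by (rule alg_indepI, unfold K[symmetric], rule rvar_algebraic_over_fixed[OF assms(1)])
  then show ?thesis unfolding rational_over_def using K by blast
qed

context const_root_of_unity
begin

text \<open>An \<open>H\<close>-invariant is split into Fourier components under
  \<open>sigma p 0 1\<close>. The \<open>l\<close>-th component divided by
  \<open>\<theta> ^ l\<close> is invariant under every \<open>sigma p i s\<close> of the larger
  group, so the old generators together with \<open>\<theta>\<close> suffice, and
  \<open>\<theta>\<close> can take the place of \<open>\<theta> ^ p\<close>.\<close>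

lemma fixed_field_H_group:
  assumes "1 \<le> n"
  shows "\<exists>Y. finite Y \<and> card Y \<le> n \<and> (fixed_field n (H_group n p) :: 'a ratfun set) = field_gen (range rconst \<union> Y)"
proof -
  have FH: "fixed_field n (H_group n p) = varfield {1..n} \<inter> (fixed_by (H_gens n p) :: 'a ratfun set)"
    using fixed_by_generate[OF H_gens_subset[OF p_gt_0], of n]
    by (auto simp: fixed_field_def fixed_by_def H_group_def ratfun_field_eq_varfield)
  note iff = fixed_by_H_gens[OF p_gt_1 assms]
  show ?thesis
  proof (cases "n < p")
    case True
    \<comment> \<open>For \<open>n < p\<close> there are no generators, and the fixed field is the
      whole function field.\<close>
    then have "\<not> block_in p 0 n i s" for i s
    proof -
      have "p ^ 1 \<le> p ^ (i + 1)" by (intro power_increasing) (use p_gt_1 in auto)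
      then have "n div p ^ (i + 1) = 0" using True by simp
      then show ?thesis by (simp add: block_in_0_iff)
    qed
    then have "fixed_by (H_gens n p) = (UNIV :: 'a ratfun set)" using True iff by auto
    then have "fixed_field n (H_group n p) = field_gen (range rconst \<union> (rvar ` {1..n} :: 'a ratfun set))"
      unfolding FH varfield_def by simp
    moreover have "card (rvar ` {1..n} :: 'a ratfun set) \<le> n"
      using card_image_le[of "{1..n}" "rvar :: _ \<Rightarrow> 'a ratfun"] by simp
    ultimately show ?thesis by blast
  next
    case False
    obtain Y \<theta> where Y: "invariant_basis 0 n Y \<theta>" "\<theta> ^ p \<in> Y" using invariant_basis_exists[of n] False by auto
    define Y' where "Y' = insert \<theta> (Y - {\<theta> ^ p})"
    note sub = is_subfield_field_gen
    have np: "1 \<le> n div p" using False by (simp add: less_eq_div_iff_mult_less_eq)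
    have b0: "block_in p 0 n 0 s" if "1 \<le> s" "s \<le> n div p" for s using that by (simp add: block_in_0_iff)
    have Y'_in: "Y' \<subseteq> field_gen (range rconst \<union> Y')" using field_gen_superset[of "range rconst \<union> Y'"] by blast
    have "\<theta> ^ p \<in> field_gen (range rconst \<union> Y')"
      by (rule is_subfieldD(9)[OF sub]) (use Y'_in in \<open>auto simp: Y'_def\<close>)
    then have "Y \<subseteq> field_gen (range rconst \<union> Y')" using Y'_in by (auto simp: Y'_def)
    then have Y_in: "field_gen (range rconst \<union> Y) \<subseteq> field_gen (range rconst \<union> Y')"
      using field_gen_superset[of "range rconst \<union> Y'"] by (intro field_gen_least[OF sub]) blast
    have \<theta>_in: "\<theta> \<in> field_gen (range rconst \<union> Y')" using Y'_in by (auto simp: Y'_def)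
    have card: "finite Y'" "card Y' \<le> n"
    proof -
      show "finite Y'" using invariant_basisD(1)[OF Y(1)] by (simp add: Y'_def)
      have "card Y' \<le> Suc (card (Y - {\<theta> ^ p}))" unfolding Y'_def by (rule card_insert_le_m1) simp_all
      also have "\<dots> = card Y" using card_Suc_Diff1[OF invariant_basisD(1)[OF Y(1)] Y(2)] .
      also have "\<dots> \<le> n" by (rule invariant_basisD(2)[OF Y(1)])
      finally show "card Y' \<le> n" .
    qed
    have incl: "Y' \<subseteq> varfield {1..n} \<inter> fixed_by (H_gens n p)"
    proof
      fix y assume "y \<in> Y'"
      then consider "y = \<theta>" | "y \<in> Y" by (auto simp: Y'_def)
      then show "y \<in> varfield {1..n} \<inter> fixed_by (H_gens n p)"
      proof cases
        case 1
        have "\<theta> \<in> fixed_by (H_gens n p)" unfolding iff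
          using invariant_basisD(7)[OF Y(1) b0] invariant_basisD(7)[OF Y(1)] by auto
        then show ?thesis using invariant_basisD(4)[OF Y(1)] 1 by simp
      next
        case 2
        have "perm_act (sigma p i s) y = y" if "block_in p 0 n i s" for i s
          using invariant_basisD(6)[OF Y(1)] 2 block_gensI[OF that] by (auto simp: fixed_by_def)
        then have "y \<in> fixed_by (H_gens n p)" unfolding iff using b0 by auto
        then show ?thesis using invariant_basisD(3)[OF Y(1)] 2 by auto
      qed
    qed
    have H_inj: "H_gens n p \<subseteq> {g. inj g}"
      using H_gens_subset[OF p_gt_0, of n]
      by (intro subsetI CollectI permutes_inj[of _ "{1..n}"]) (unfold sym_group_carrier[symmetric], blast)
    have "field_gen (range rconst \<union> Y') \<subseteq> varfield {1..n} \<inter> fixed_by (H_gens n p)"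
      by (rule field_gen_least[OF is_subfield_Int[OF is_subfield_varfield is_subfield_fixed_by[OF H_inj]]])
        (use incl rconst_in_varfield rconst_fixed_by[OF H_inj] in \<open>auto 0 3\<close>)
    moreover have "varfield {1..n} \<inter> fixed_by (H_gens n p) \<subseteq> field_gen (range rconst \<union> Y')"
    proof
      fix f :: "'a ratfun"
      assume f: "f \<in> varfield {1..n} \<inter> fixed_by (H_gens n p)"
      let ?\<sigma> = "perm_act (sigma p 0 1) :: 'a ratfun \<Rightarrow> 'a ratfun"
      \<comment> \<open>By \<open>H\<close>-invariance every \<open>sigma p 0 s\<close> acts on
        \<open>f\<close> as \<open>sigma p 0 1\<close> does, and by commutation also on the images
        \<open>F c\<close>.\<close>
      define F where "F c = (?\<sigma> ^^ c) f" for c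
      have b1: "block_in p 0 n 0 1" using np by (intro b0) auto
      have inj: "inj (sigma p i s)" if "block_in p 0 n i s" for i s
        using that p_gt_0 by (intro sigma_inj) (auto simp: block_in_def)
      have eq: "perm_act (sigma p 0 s) f = ?\<sigma> f" if "1 \<le> s" "s \<le> n div p" for s
        using f iff that np by blast
      have shift: "perm_act (sigma p 0 s) (F c) = F (Suc c)" if s: "1 \<le> s" "s \<le> n div p" for s c
      proof (induction c)
        case 0
        show ?case using eq[OF s] by (simp add: F_def)
      next
        case (Suc c)
        have "perm_act (sigma p 0 s) (?\<sigma> (F c)) = ?\<sigma> (perm_act (sigma p 0 s) (F c))"
          using sigma_commute[OF s(1) order_refl p_gt_0] inj[OF b0[OF s]] inj[OF b1]
          by (simp add: perm_act_comp)
        then show ?case using Suc by (simp add: F_def)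
      qed
      have upper: "perm_act (sigma p i t) (F c) = F c" if i: "1 \<le> i" "block_in p 0 n i t" for i t c
      proof (induction c)
        case 0
        have "perm_act (sigma p i t) f = f" using f iff[of f] i by blast
        then show ?case by (simp add: F_def)
      next
        case (Suc c)
        obtain s where s: "1 \<le> s" "s \<le> n div p" "sigma p i t \<circ> sigma p 0 1 = sigma p 0 s \<circ> sigma p i t"
          using sigma_conj_first[OF p_gt_1 i] by blast
        have "perm_act (sigma p i t) (?\<sigma> (F c)) = perm_act (sigma p 0 s) (perm_act (sigma p i t) (F c))"
          using s(3) inj[OF b0[OF s(1,2)]] inj[OF b1] inj[OF i(2)] by (simp add: perm_act_comp)
        then show ?case using Suc shift[OF s(1,2)] by (simp add: F_def)
      qed
      have "F p = F 0"
        using sigma_funpow_p[OF p_gt_1] perm_act_funpow[OF inj[OF b1], of p f] by (simp add: F_def perm_act_id)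
      then have cyc: "F (Suc c mod p) = F (Suc c)" if "c < p" for c
        using that by (cases "Suc c = p") auto
      have eig: "perm_act (sigma p i s) (fourier F l) = (if i = 0 then \<zeta> ^ l * fourier F l else fourier F l)"
        if b: "block_in p 0 n i s" for i s l
      proof (cases "i = 0")
        case True
        then have s: "1 \<le> s" "s \<le> n div p" using b by (simp_all add: block_in_0_iff)
        have "perm_act (sigma p 0 s) (fourier F l) = \<zeta> ^ l * fourier F l"
          using is_endo_sigma[OF b] perm_act_sigma_zeta[OF b] unfolding True
          by (rule fourier_shift) (simp add: cyc shift[OF s])
        then show ?thesis using True by simp
      next
        case False
        then have "1 \<le> i" by simp
        then have "perm_act (sigma p i s) (fourier F l) = fourier F l"
          using is_endo_sigma[OF b] perm_act_sigma_zeta[OF b] upper[OF _ b] by (intro fourier_fixed)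
        then show ?thesis using False by simp
      qed
      have F_var: "F c \<in> varfield {1..n}" for c
      proof (induction c)
        case 0
        show ?case using f by (simp add: F_def)
      next
        case (Suc c)
        have "sigma p 0 1 ` {1..n} = {1..n}"
          using block_in_permutes[OF b1 p_gt_0] by (simp add: permutes_image)
        then show ?case using perm_act_varfield[OF inj[OF b1] Suc] by (simp add: F_def)
      qed
      have quot: "fourier F l / \<theta> ^ l \<in> field_gen (range rconst \<union> Y)" for l
      proof -
        let ?B = "field_gen (range rconst) :: 'a ratfun set"
        have "fourier F l / \<theta> ^ l \<in> field_gen (?B \<union> Y)"
        proof (rule generates_invariantsD[OF invariant_basisD(8)[OF Y(1)] sub])
          show "range rconst \<subseteq> ?B" by (rule field_gen_superset)
          show "?B \<subseteq> fixed_by (block_gens p 0 n)"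
            by (rule field_gen_least[OF is_subfield_fixed_by[OF block_gens_subset_inj] rconst_fixed_by[OF block_gens_subset_inj]])
          have "fourier F l / \<theta> ^ l \<in> varfield {1..n}"
            by (intro is_subfieldD(8,9)[OF is_subfield_varfield]
                fourier_in[OF is_subfield_varfield rconst_in_varfield F_var])
              (use invariant_basisD(4)[OF Y(1)] in simp)
          then show "fourier F l / \<theta> ^ l \<in> field_gen (?B \<union> rvar ` {0+1..0+n})"
            by (simp add: varfield_def field_gen_field_gen_Un)
          show "fourier F l / \<theta> ^ l \<in> fixed_by (block_gens p 0 n)"
            unfolding fixed_by_def block_gens_def
          proof (intro CollectI ballI, clarify)
            fix i s assume b: "block_in p 0 n i s"
            show "perm_act (sigma p i s) (fourier F l / \<theta> ^ l) = fourier F l / \<theta> ^ l"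
              using eig[OF b] invariant_basisD(7)[OF Y(1) b]
              by (simp add: is_endoD[OF is_endo_sigma[OF b]] power_mult_distrib)
          qed
        qed
        then show ?thesis by (simp add: field_gen_field_gen_Un)
      qed
      have "fourier F l \<in> field_gen (range rconst \<union> Y')" for l
      proof -
        have "fourier F l / \<theta> ^ l * \<theta> ^ l \<in> field_gen (range rconst \<union> Y')"
          using quot[of l] Y_in \<theta>_in by (intro is_subfieldD(6,9)[OF sub]) auto
        then show ?thesis using invariant_basisD(5)[OF Y(1)] by simp
      qed
      moreover have "\<zeta> \<in> field_gen (range rconst \<union> Y')" using field_gen_superset[of "range rconst \<union> Y'"] by blast
      \<comment> \<open>Fourier inversion recovers \<open>f = F 0\<close> from its
        components.\<close>
      ultimately have "F 0 \<in> field_gen (range rconst \<union> Y')"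
        using p_gt_0 by (intro fourier_recover[OF sub, of _ F 0]) auto
      then show "f \<in> field_gen (range rconst \<union> Y')" by (simp add: F_def)
    qed
    ultimately show ?thesis using FH card by (intro exI[of _ Y']) auto
  qed
qed

end

text \<open>The root of unity is a zero of \<open>1 + z + ... + z ^ (p - 1)\<close> in the algebraic
  closure; it differs from 1, where this polynomial takes the value \<open>p\<close>, nonzero in
  characteristic 0.\<close>

lemma exists_root_of_unity:
  assumes "prime p" "\<forall>z :: 'a::field_char_0 alg_closure. z ^ p = 1 \<longrightarrow> z \<in> range to_ac"
  shows "\<exists>\<zeta> :: 'a. \<zeta> ^ p = 1 \<and> \<zeta> \<noteq> 1"
proof -
  have p: "1 < p" using assms(1) by (rule prime_gt_1_nat)
  define q :: "'a alg_closure poly" where "q = (\<Sum>i<p. monom 1 i)"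
  have coeff: "coeff q i = (if i < p then 1 else 0)" for i by (simp add: q_def coeff_sum)
  have "degree q \<noteq> 0"
    using le_degree[of q 1] coeff[of 1] p by auto
  then obtain z where z: "poly q z = 0" using alg_closed_imp_poly_has_root[of q] by blast
  then have sum: "(\<Sum>i<p. z ^ i) = 0" by (simp add: q_def poly_sum poly_monom)
  have "z \<noteq> 1" using sum p by auto
  moreover have "z ^ p = 1" using sum geometric_sum[OF \<open>z \<noteq> 1\<close>, of p] \<open>z \<noteq> 1\<close> by simp
  ultimately show ?thesis using assms(2) by (metis imageE to_ac_1 to_ac_eq_iff to_ac_power)
qed

theorem theorem1:
  fixes p n :: nat
  assumes "prime p"
    and "n \<ge> 1"
    and "\<forall>z :: 'a::field_char_0 alg_closure. z ^ p = 1 \<longrightarrow> z \<in> range to_ac"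
  shows "rational_over rconst (fixed_field n (H_group n p) :: 'a ratfun set)"
proof -
  obtain \<zeta> :: 'a where \<zeta>: "\<zeta> ^ p = 1" "\<zeta> \<noteq> 1" using exists_root_of_unity[OF assms(1,3)] by blast
  have pow: "rconst (\<zeta> ^ k) = rconst \<zeta> ^ k" for k by (induction k) (simp_all add: rconst_mult)
  interpret const_root_of_unity \<zeta> p
    using assms(1) \<zeta> rconst_eq_iff[of \<zeta> 1] by unfold_locales (auto simp flip: pow)
  have "g permutes {1..n}" if "g \<in> H_group n p" for g
    using subgroup.subset[OF H_group_subgroup[OF assms(1), of n]] that
    unfolding sym_group_carrier[symmetric] by blast
  then show ?thesis using fixed_field_H_group[OF assms(2)] rational_over_fixed_field[OF _ assms(2)] by blast
qed

end
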